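(* Let $d\ge2$, $\alpha\in[0,(d+1)/2)$, $\beta=(d+1-2\alpha)/(2d)$ and let $K\ge0$ be a constant. There is a constant $N=N(d,\alpha,K)$ such that the following holds. Let $a(x)=(a^{ij}(x))$ be a measurable function on $B$ with values in symmetric nonnegative definite $d\times d$ matrices such that $\mathrm{tr}\,a>0$ in $B$; let $\mu(x)$ be the smallest eigenvalue of $a(x)$. Let $b=(b^i(x))$ be a measurable $\mathbb{R}^d$-valued function on $B$ with $|b|\le K\mu$ in $B$, and let $c=c(x)$ be a nonnegative bounded measurable function on $B$. Let $u\in W^2_{d,\mathrm{loc}}(B)\cap C(\bar B)$ and $$Lu=a^{ij}D_{ij}u+b^iD_iu-cu.$$ Then for every $x_0\in B$ $$u(x_0)\le\sup_{\partial B}u_++N\psi^{\beta}(x_0)\Big(\int_B\psi^{\alpha}\,I_{Lu<0}\,(\det a)^{-1}|Lu|^d\,dx\Big)^{1/d}.$$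
   Context: $B=\{x\in\mathbb{R}^d:|x|<1\}$, $\psi(x)=1-|x|^2$, $D_i=\partial/\partial x^i$, $D_{ij}=D_iD_j$, summation over repeated indices is understood, $u_+=(|u|+u)/2$. $I_{Lu<0}$ is the indicator function of $\{x\in B:Lu(x)<0\}$. In the integrand, regarded as the quotient $I_{Lu<0}|Lu|^d/\det a$, one uses $0/0:=0$ (and a positive number divided by $0$ is $+\infty$; the right-hand side may be $+\infty$). *)

theory Defs
  imports "HOL-Analysis.Analysis"
begin

definition partial_deriv :: "'n::finite \<Rightarrow> (real^'n \<Rightarrow> real) \<Rightarrow> real^'n \<Rightarrow> real" where
  "partial_deriv i f x = frechet_derivative f (at x) (axis i 1)"

primrec Ck :: "nat \<Rightarrow> (real^'n::finite \<Rightarrow> real) \<Rightarrow> bool" where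
  "Ck 0 f \<longleftrightarrow> continuous_on UNIV f"
| "Ck (Suc k) f \<longleftrightarrow> (\<forall>x. f differentiable (at x)) \<and> (\<forall>i. Ck k (partial_deriv i f))"

text \<open>A smooth function with compact support in the open set \<open>S\<close> is represented by its extension
  by zero, so smoothness is required on the whole space.\<close>

definition test_functions :: "(real^'n::finite) set \<Rightarrow> (real^'n \<Rightarrow> real) set" where
  "test_functions S =
     {\<phi>. (\<forall>k. Ck k \<phi>) \<and> compact (closure {x. \<phi> x \<noteq> 0}) \<and> closure {x. \<phi> x \<noteq> 0} \<subseteq> S}"

definition Lp_loc :: "real \<Rightarrow> (real^'n::finite) set \<Rightarrow> (real^'n \<Rightarrow> real) set" where
  "Lp_loc p S =
     {f. f \<in> borel_measurable (lebesgue_on S) \<and>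
         (\<forall>C. compact C \<and> C \<subseteq> S \<longrightarrow> set_integrable lebesgue C (\<lambda>x. \<bar>f x\<bar> powr p))}"

definition weak_partial_deriv ::
  "(real^'n::finite) set \<Rightarrow> 'n \<Rightarrow> (real^'n \<Rightarrow> real) \<Rightarrow> (real^'n \<Rightarrow> real) \<Rightarrow> bool" where
  "weak_partial_deriv S i f g \<longleftrightarrow>
     f \<in> Lp_loc 1 S \<and> g \<in> Lp_loc 1 S \<and>
     (\<forall>\<phi> \<in> test_functions S.
        (LINT x|lebesgue_on S. f x * partial_deriv i \<phi> x) = - (LINT x|lebesgue_on S. g x * \<phi> x))"

text \<open>\<open>u\<close> belongs to \<open>W\<^sup>2\<^bsub>p,loc\<^esub>(S)\<close>, and \<open>Du\<close>, \<open>D2u\<close> are (arbitrary, almost everywhere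
  determined) versions of its weak gradient and Hessian.\<close>

definition has_W2_loc_derivs ::
  "real \<Rightarrow> (real^'n::finite) set \<Rightarrow> (real^'n \<Rightarrow> real) \<Rightarrow> (real^'n \<Rightarrow> real^'n) \<Rightarrow>
   (real^'n \<Rightarrow> real^'n^'n) \<Rightarrow> bool" where
  "has_W2_loc_derivs p S u Du D2u \<longleftrightarrow>
     u \<in> Lp_loc p S \<and>
     (\<forall>i. (\<lambda>x. Du x $ i) \<in> Lp_loc p S \<and> weak_partial_deriv S i u (\<lambda>x. Du x $ i)) \<and>
     (\<forall>i j. (\<lambda>x. D2u x $ i $ j) \<in> Lp_loc p S \<and>
            weak_partial_deriv S i (\<lambda>x. Du x $ j) (\<lambda>x. D2u x $ i $ j))"

definition nonneg_definite :: "real^'n^'n::finite \<Rightarrow> bool" where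
  "nonneg_definite A \<longleftrightarrow> (\<forall>v. 0 \<le> v \<bullet> (A *v v))"

definition smallest_eigenvalue :: "real^'n^'n::finite \<Rightarrow> real" where
  "smallest_eigenvalue A = Min {l. \<exists>v. v \<noteq> 0 \<and> A *v v = l *\<^sub>R v}"

definition diff_op ::
  "(real^'n \<Rightarrow> real^'n^'n) \<Rightarrow> (real^'n \<Rightarrow> real^'n) \<Rightarrow> (real^'n \<Rightarrow> real) \<Rightarrow>
   (real^'n \<Rightarrow> real) \<Rightarrow> (real^'n \<Rightarrow> real^'n) \<Rightarrow> (real^'n \<Rightarrow> real^'n^'n) \<Rightarrow> real^'n::finite \<Rightarrow> real" where
  "diff_op a b c u Du D2u x =
     (\<Sum>i\<in>UNIV. \<Sum>j\<in>UNIV. a x $ i $ j * D2u x $ i $ j) + (\<Sum>i\<in>UNIV. b x $ i * Du x $ i) - c x * u x"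

definition psi :: "real^'n::finite \<Rightarrow> real" where
  "psi x = 1 - (norm x)\<^sup>2"

definition pos_part :: "real \<Rightarrow> real" where
  "pos_part t = (\<bar>t\<bar> + t) / 2"

definition ennreal_root :: "nat \<Rightarrow> ennreal \<Rightarrow> ennreal" where
  "ennreal_root n t = (if t = \<infinity> then \<infinity> else ennreal (root n (enn2real t)))"

text \<open>The quotient is taken in \<^typ>\<open>ennreal\<close>, where \<open>0 / 0 = 0\<close> and \<open>t / 0 = \<infinity>\<close> for \<open>t > 0\<close>.\<close>

definition weighted_integral ::
  "real \<Rightarrow> (real^'n \<Rightarrow> real^'n^'n) \<Rightarrow> (real^'n::finite \<Rightarrow> real) \<Rightarrow> ennreal" where
  "weighted_integral \<alpha> a Lu =
     (\<integral>\<^sup>+x. ennreal (psi x powr \<alpha>) *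
           (ennreal (indicator {y. Lu y < 0} x * \<bar>Lu x\<bar> ^ CARD('n)) / ennreal (det (a x)))
      \<partial>lebesgue_on (ball 0 1))"

end

theory Submission
  imports Defs "HOL-Computational_Algebra.Polynomial"
begin

text \<open>The proof is an Aleksandrov contact argument carried out at a well chosen point \<open>e\<close> instead of
at \<open>x0\<close>. Let \<open>n\<close> be the dimension, \<open>\<beta> = (n + 1 - 2\<alpha>) / (2n)\<close>, and let \<open>s\<close> be the supremum
of the positive part of \<open>u\<close> on the sphere.

\<^emph>\<open>The point.\<close> If \<open>u x0 > s\<close>, the continuous function
\<open>F y = (u y - s) / (\<psi>(x0)^\<beta> + \<psi>(y)^\<beta>)\<close> on the closed ball has a positive maximum \<open>t\<close>, attained
at an interior point \<open>e\<close>. Since \<open>F x0 \<le> t\<close> means \<open>u x0 - s \<le> 2 t \<psi>(x0)^\<beta>\<close>, it suffices to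
bound \<open>t^n\<close> by a constant times the weighted integral. Put \<open>\<epsilon> = \<psi>(e)\<close> and
\<open>h = t (1 - 2^(-\<beta>)) \<epsilon>^\<beta>\<close>. Maximality gives \<open>u \<le> u e - h\<close> on the sphere \<open>\<psi> = \<epsilon>/2\<close>, while inside
this sphere the weight \<open>\<psi>^\<alpha>\<close> is at least \<open>(\<epsilon>/2)^\<alpha>\<close>.

\<^emph>\<open>Contact.\<close> Let \<open>P\<close> be the set of slopes \<open>p\<close> with \<open>|p| + p \<bullet> e \<le> \<eta>\<close>, where \<open>\<eta>\<close> is a small
multiple of \<open>h\<close>. Sliding a function of slope \<open>p\<close> at \<open>e\<close> down onto the graph of \<open>u\<close> produces a
contact point, and by the choice of \<open>h\<close> it lies where \<open>\<psi> > \<epsilon>/2\<close> and \<open>u > s\<close>. So \<open>P\<close> (up to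
the slope \<open>0\<close>) is covered by the image of contact points, and its volume is at most the integral
of a Jacobian. The set \<open>P\<close> contains an ellipsoid of volume \<open>\<kappa> \<eta>^n \<epsilon>^(-(n+1)/2)\<close>
(\<open>emeasure_slope_region_ge\<close>), where \<open>\<kappa>\<close> is the volume of the unit ball. Comparison gives
\<open>\<kappa> \<eta>^n \<epsilon>^(-(n+1)/2) \<le> C \<epsilon>^(-\<alpha>) I\<close> with the weighted integral \<open>I\<close>; as \<open>\<eta>^n\<close> is a multiple of
\<open>t^n \<epsilon>^(\<beta>n)\<close> and \<open>\<beta>n = (n+1)/2 - \<alpha>\<close>, all powers of \<open>\<epsilon>\<close> cancel. This cancellation is what
determines the exponent \<open>\<beta>\<close>.

\<^emph>\<open>Drift.\<close> Affine functions would leave a term \<open>b \<bullet> Du\<close> at the contact points. Instead the test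
functions are \<open>|p| (1 - exp (-K \<omega> \<bullet> (y - e))) / K\<close> with \<open>\<omega> = p / |p|\<close>. Their concavity in the
direction \<open>\<omega>\<close> absorbs the drift: at a contact point the matrix \<open>A = - D2u - K Du Du^T / |Du|\<close> is
nonnegative definite, \<open>p = exp (K \<omega> \<bullet> (y - e)) Du(y)\<close>, the Jacobian of this map is bounded by a
constant times \<open>det A\<close>, and \<open>tr (a A)\<close> is at most the negative part of \<open>Lu\<close> wherever \<open>u \<ge> 0\<close> and
\<open>A\<close> is nonnegative definite (\<open>psd_det_le_quotient\<close>). Since \<open>K\<close> has to be positive here, \<open>K + 1\<close>
takes its place in the end. The inequality \<open>det a det A \<le> (tr (a A) / n)^n\<close> then bounds \<open>det A\<close> by
the integrand of the theorem without its weight.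

\<^emph>\<open>Regularity.\<close> For smooth functions the contact argument is a change of variables
(\<open>slope_region_le_psd_det_integral\<close>). A function with weak derivatives is mollified; gradients and
Hessians converge almost everywhere and are dominated in the mean of order \<open>n\<close>
(\<open>W2_loc_smooth_approximation\<close>). The function that is \<open>det A\<close> on nonnegative definite symmetric
matrices and \<open>0\<close> elsewhere is upper semicontinuous, so the reverse Fatou lemma carries the volume
bound to the limit (\<open>slope_region_le_W2\<close>). The operator enters only after that, through a
pointwise inequality, so nothing has to be known about contact points of \<open>u\<close> itself.\<close>

section \<open>Symmetric matrices\<close>

text \<open>A linear term cannot be dominated by a quadratic one near \<open>t = 0\<close>. This is the first order condition
for a maximum of the Rayleigh quotient.\<close>

lemma rayleigh_quadratic_forces_zero:
  fixes a b :: real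
  assumes "\<And>t. 2 * t * a \<le> t\<^sup>2 * b"
  shows "a = 0"
proof (rule ccontr)
  assume a: "a \<noteq> 0"
  define B where "B = \<bar>b\<bar> + 1"
  have B: "B > 0" "b \<le> B" by (auto simp: B_def)
  have "2 * (a / B) * a \<le> (a / B)\<^sup>2 * b" by (rule assms)
  also have "\<dots> \<le> (a / B)\<^sup>2 * B" using B by (intro mult_left_mono) auto
  finally have "2 * (a / B) * a \<le> (a / B)\<^sup>2 * B" .
  moreover have "(a / B)\<^sup>2 * B = a\<^sup>2 / B" "2 * (a / B) * a = 2 * (a\<^sup>2 / B)"
    using B by (simp_all add: power2_eq_square)
  ultimately have "2 * (a\<^sup>2 / B) \<le> a\<^sup>2 / B" by linarith
  moreover have "a\<^sup>2 / B > 0" using a B by simp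
  ultimately show False by linarith
qed

lemma inner_transpose_matrix_vector:
  fixes A :: "real^'n::finite^'m::finite"
  shows "x \<bullet> (transpose A *v y) = (A *v x) \<bullet> y"
  by (simp add: transpose_matrix_vector inner_commute[of x] dot_lmul_matrix inner_commute[of y])

lemma symmetric_matrix_inner:
  fixes A :: "real^'n::finite^'n"
  assumes "transpose A = A"
  shows "(A *v x) \<bullet> y = x \<bullet> (A *v y)"
  using inner_transpose_matrix_vector[of x A y] assms by simp

text \<open>The eigenvector is a maximiser of the quadratic form on the unit sphere of the invariant subspace;
there the first variation \<open>A e - l e\<close> is orthogonal to the subspace and also lies in it.\<close>

lemma symmetric_eigenvector_in_subspace:
  fixes A :: "real^'n::finite^'n"
  assumes sym: "transpose A = A" and V: "subspace V" and inv: "\<And>x. x \<in> V \<Longrightarrow> A *v x \<in> V"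
    and ne: "V \<noteq> {0}"
  shows "\<exists>e\<in>V. \<exists>l. norm e = 1 \<and> A *v e = l *\<^sub>R e \<and> (\<forall>x\<in>V. x \<bullet> (A *v x) \<le> l * (norm x)\<^sup>2)"
proof -
  obtain x0 where x0: "x0 \<in> V" "x0 \<noteq> 0" using ne V subspace_0 by blast
  have cpt: "compact (sphere 0 1 \<inter> V)"
    by (intro compact_Int_closed compact_sphere closed_subspace V)
  have "x0 /\<^sub>R norm x0 \<in> sphere 0 1 \<inter> V" using x0 V by (auto simp: subspace_scale)
  hence "sphere 0 1 \<inter> V \<noteq> {}" by blast
  moreover have "continuous_on (sphere 0 1 \<inter> V) (\<lambda>x. x \<bullet> (A *v x))"
    by (intro continuous_intros linear_continuous_on_compose matrix_vector_mul_linear)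
  ultimately obtain e where e: "e \<in> sphere 0 1 \<inter> V"
    and emax: "\<And>x. x \<in> sphere 0 1 \<inter> V \<Longrightarrow> x \<bullet> (A *v x) \<le> e \<bullet> (A *v e)"
    using continuous_attains_sup[OF cpt] by blast
  define l where "l = e \<bullet> (A *v e)"
  have ne1: "norm e = 1" and eV: "e \<in> V" using e by auto
  have ray: "x \<bullet> (A *v x) \<le> l * (norm x)\<^sup>2" if "x \<in> V" for x
  proof (cases "x = 0")
    case False
    have "x /\<^sub>R norm x \<in> sphere 0 1 \<inter> V" using that False V by (auto simp: subspace_scale)
    from emax[OF this] have "(x \<bullet> (A *v x)) / (norm x)\<^sup>2 \<le> l"
      by (simp add: l_def matrix_vector_mult_scaleR power2_eq_square divide_inverse mult_ac)
    thus ?thesis using False by (simp add: field_simps)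
  qed simp
  define g where "g = A *v e - l *\<^sub>R e"
  have gV: "g \<in> V" unfolding g_def using inv[OF eV] eV V by (simp add: subspace_diff subspace_scale)
  have "w \<bullet> g = 0" if w: "w \<in> V" for w
  proof (rule rayleigh_quadratic_forces_zero)
    fix t :: real
    have "(e + t *\<^sub>R w) \<bullet> (A *v (e + t *\<^sub>R w)) \<le> l * (norm (e + t *\<^sub>R w))\<^sup>2"
      using w eV V by (intro ray) (simp add: subspace_add subspace_scale)
    moreover have "(e + t *\<^sub>R w) \<bullet> (A *v (e + t *\<^sub>R w)) = l + 2 * t * (w \<bullet> (A *v e)) + t\<^sup>2 * (w \<bullet> (A *v w))"
      using symmetric_matrix_inner[OF sym, of e w]
      by (simp add: l_def matrix_vector_right_distrib matrix_vector_mult_scaleR inner_add_left inner_add_right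
          inner_commute[of "A *v e" w] power2_eq_square algebra_simps)
    moreover have "(norm (e + t *\<^sub>R w))\<^sup>2 = 1 + 2 * t * (w \<bullet> e) + t\<^sup>2 * (w \<bullet> w)"
    proof -
      have "e \<bullet> e = 1" using ne1 by (simp add: norm_eq_1)
      thus ?thesis unfolding power2_norm_eq_inner
        by (simp add: inner_add_left inner_add_right inner_commute[of e w] power2_eq_square algebra_simps)
    qed
    ultimately have "l + 2 * t * (w \<bullet> (A *v e)) + t\<^sup>2 * (w \<bullet> (A *v w))
        \<le> l * (1 + 2 * t * (w \<bullet> e) + t\<^sup>2 * (w \<bullet> w))" by simp
    thus "2 * t * (w \<bullet> g) \<le> t\<^sup>2 * (l * (w \<bullet> w) - w \<bullet> (A *v w))"
      by (simp add: g_def inner_diff_right algebra_simps)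
  qed
  from this[OF gV] have "g = 0" by simp
  hence "A *v e = l *\<^sub>R e" by (simp add: g_def)
  thus ?thesis using ne1 eV ray by blast
qed

text \<open>A largest orthonormal set of eigenvectors spans: otherwise its orthogonal complement, which is
invariant under the symmetric matrix, would contain a further eigenvector.\<close>

lemma symmetric_orthonormal_eigenbasis:
  fixes A :: "real^'n::finite^'n"
  assumes sym: "transpose A = A"
  shows "\<exists>(e :: 'n \<Rightarrow> real^'n) l. (\<forall>i j. e i \<bullet> e j = (if i = j then 1 else 0)) \<and> (\<forall>i. A *v e i = l i *\<^sub>R e i)"
proof -
  define good where "good B \<longleftrightarrow> pairwise orthogonal B \<and> (\<forall>b\<in>B. norm b = 1 \<and> (\<exists>l. A *v b = l *\<^sub>R b))"
    for B :: "(real^'n) set"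
  have ind: "independent B" if "good B" for B
    using that unfolding good_def by (intro pairwise_orthogonal_independent) auto
  have fin: "finite B" "card B \<le> CARD('n)" if "good B" for B
    using independent_bound[OF ind[OF that]] by auto
  have "\<exists>B. good B \<and> (\<forall>B'. good B' \<longrightarrow> card B' \<le> card B)"
  proof -
    have "good {}" by (simp add: good_def)
    moreover have "\<forall>B. good B \<longrightarrow> card B < Suc (CARD('n))" using fin by fastforce
    ultimately show ?thesis
      using ex_has_greatest_nat[of good "{}" card] by blast
  qed
  then obtain B where B: "good B" and Bmax: "\<And>B'. good B' \<Longrightarrow> card B' \<le> card B" by blast
  define V where "V = {x. \<forall>b\<in>B. orthogonal b x}"
  have V: "subspace V" unfolding V_def by (rule subspace_orthogonal_to_vectors)
  have inv: "A *v x \<in> V" if "x \<in> V" for x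
    unfolding V_def
  proof (clarify)
    fix b assume b: "b \<in> B"
    obtain l where l: "A *v b = l *\<^sub>R b" using B b by (auto simp: good_def)
    have "b \<bullet> (A *v x) = (A *v b) \<bullet> x" by (simp add: symmetric_matrix_inner[OF sym])
    also have "\<dots> = 0" using that b by (simp add: l V_def orthogonal_def)
    finally show "orthogonal b (A *v x)" by (simp add: orthogonal_def)
  qed
  have "V = {0}"
  proof (rule ccontr)
    assume "V \<noteq> {0}"
    from symmetric_eigenvector_in_subspace[OF sym V inv this]
    obtain e l where e: "e \<in> V" "norm e = 1" "A *v e = l *\<^sub>R e" by blast
    have "good (insert e B)"
      using B e unfolding good_def V_def pairwise_insert by (auto simp: orthogonal_commute)
    moreover have "e \<notin> B" using e by (auto simp: V_def orthogonal_def norm_eq_1)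
    ultimately show False using Bmax[of "insert e B"] fin(1)[OF B] by simp
  qed
  have "span B = UNIV"
  proof (rule ccontr)
    assume "span B \<noteq> UNIV"
    then obtain a where a: "a \<noteq> 0" "\<And>x. x \<in> span B \<Longrightarrow> orthogonal a x"
      using orthogonal_to_subspace_exists_gen[of B UNIV] by auto
    have "a \<in> V" unfolding V_def using a(2) span_base by (auto simp: orthogonal_commute)
    thus False using a \<open>V = {0}\<close> by simp
  qed
  hence "card B = CARD('n)"
    using dim_eq_card[of B UNIV] ind[OF B] by (simp add: vec.dim_UNIV)
  then obtain e where e: "bij_betw e (UNIV::'n set) B"
    using fin(1)[OF B] by (metis finite finite_same_card_bij)
  have eB: "e i \<in> B" for i using e bij_betwE by blast
  have "e i \<bullet> e j = (if i = j then 1 else 0)" for i j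
  proof (cases "i = j")
    case True thus ?thesis using B eB[of i] by (simp add: good_def norm_eq_1)
  next
    case False
    hence "e i \<noteq> e j" using e by (auto simp: bij_betw_def inj_on_def)
    thus ?thesis using B eB[of i] eB[of j] False by (auto simp: good_def pairwise_def orthogonal_def)
  qed
  moreover obtain l where "\<And>i. A *v e i = l i *\<^sub>R e i"
  proof -
    have "\<forall>i. \<exists>l. A *v e i = l *\<^sub>R e i"
      using B eB unfolding good_def by blast
    from choice[OF this] obtain f where "\<forall>i. A *v e i = f i *\<^sub>R e i" ..
    thus ?thesis using that[of f] by blast
  qed
  ultimately show ?thesis by (intro exI[of _ e] exI[of _ l]) simp
qed

lemma symmetric_diagonalization:
  fixes A :: "real^'n::finite^'n"
  assumes sym: "transpose A = A"
  obtains R l where "orthogonal_matrix R" "A = transpose R ** (\<chi> i j. if i = j then l i else 0) ** R"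
    "\<And>i. A *v row i R = l i *\<^sub>R row i R" "\<And>i. norm (row i R) = 1"
proof -
  from symmetric_orthonormal_eigenbasis[OF sym] obtain e :: "'n \<Rightarrow> real^'n" and l
    where e: "\<And>i j. e i \<bullet> e j = (if i = j then 1 else 0)" and l: "\<And>i. A *v e i = l i *\<^sub>R e i" by blast
  define R :: "real^'n^'n" where "R = (\<chi> i. e i)"
  define D :: "real^'n^'n" where "D = (\<chi> i j. if i = j then l i else 0)"
  have row: "row i R = e i" for i by (simp add: R_def row_def vec_eq_iff)
  have RRt: "R ** transpose R = mat 1"
    by (simp add: vec_eq_iff matrix_matrix_mult_def transpose_def mat_def R_def e[unfolded inner_vec_def, simplified])
  hence orth: "orthogonal_matrix R"
    by (simp add: orthogonal_matrix_def matrix_left_right_inverse)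
  have "A ** transpose R = transpose R ** D"
  proof -
    have "(A ** transpose R) $ i $ j = (transpose R ** D) $ i $ j" for i j
    proof -
      have "(A ** transpose R) $ i $ j = (A *v e j) $ i"
        by (simp add: matrix_matrix_mult_def transpose_def R_def matrix_vector_mult_def)
      also have "\<dots> = l j * e j $ i" by (simp add: l)
      also have "\<dots> = (transpose R ** D) $ i $ j"
        by (simp add: matrix_matrix_mult_def transpose_def R_def D_def if_distrib[of "\<lambda>x. _ * x"] cong: if_cong)
      finally show ?thesis .
    qed
    thus ?thesis by (simp add: vec_eq_iff)
  qed
  hence "A ** (transpose R ** R) = transpose R ** D ** R" by (metis matrix_mul_assoc)
  hence "A = transpose R ** D ** R"
    using orth by (simp add: orthogonal_matrix_def)
  thus ?thesis using that[OF orth, of l] l by (auto simp: D_def row e norm_eq_1)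
qed

lemma det_diagonalized:
  fixes R :: "real^'n::finite^'n"
  assumes "orthogonal_matrix R"
  shows "det (transpose R ** (\<chi> i j. if i = j then l i else 0) ** R) = (\<Prod>i\<in>UNIV. l i)"
proof -
  have "det (transpose R) * det R = 1"
    using assms det_mul[of "transpose R" R] by (simp add: orthogonal_matrix_def)
  moreover have "det ((\<chi> i j. if i = j then l i else 0) :: real^'n^'n) = (\<Prod>i\<in>UNIV. l i)"
    by (subst det_diagonal) auto
  ultimately show ?thesis by (simp add: det_mul mult_ac)
qed

lemma trace_diagonalized:
  fixes R :: "real^'n::finite^'n"
  assumes "orthogonal_matrix R"
  shows "trace (transpose R ** (\<chi> i j. if i = j then l i else 0) ** R) = (\<Sum>i\<in>UNIV. l i)"
proof -
  have "trace (transpose R ** (\<chi> i j. if i = j then l i else 0) ** R) = trace ((\<chi> i j. if i = j then l i else 0) :: real^'n^'n)"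
  proof -
    have "R ** transpose R = mat 1" using assms by (simp add: orthogonal_matrix_def)
    thus ?thesis by (subst trace_mul_sym) (simp add: matrix_mul_assoc)
  qed
  thus ?thesis by (simp add: trace_def)
qed

text \<open>The arithmetic-geometric mean inequality for the eigenvalues.\<close>

lemma det_le_trace_power:
  fixes A :: "real^'n::finite^'n"
  assumes sym: "transpose A = A" and psd: "nonneg_definite A"
  shows "0 \<le> det A" "0 \<le> trace A" "det A \<le> (trace A / CARD('n)) ^ CARD('n)"
proof -
  obtain R l where R: "orthogonal_matrix R" "A = transpose R ** (\<chi> i j. if i = j then l i else 0) ** R"
    and eig: "\<And>i. A *v row i R = l i *\<^sub>R row i R" "\<And>i. norm (row i R) = 1"
    by (rule symmetric_diagonalization[OF sym], rule that, assumption+)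
  have l0: "l i \<ge> 0" for i
  proof -
    have "0 \<le> row i R \<bullet> (A *v row i R)" using psd by (auto simp: nonneg_definite_def)
    thus ?thesis using eig(2)[of i] by (simp add: eig(1) norm_eq_1)
  qed
  have d: "det A = (\<Prod>i\<in>UNIV. l i)" and t: "trace A = (\<Sum>i\<in>UNIV. l i)"
    unfolding R(2) using det_diagonalized[OF R(1)] trace_diagonalized[OF R(1)] by auto
  show d0: "0 \<le> det A" and "0 \<le> trace A" unfolding d t using l0 by (auto intro: prod_nonneg sum_nonneg)
  let ?n = "CARD('n)"
  have n: "?n > 0" by simp
  have "det A powr (1 / ?n) \<le> trace A / ?n"
    using arith_geom_mean[of UNIV l] l0 by (simp add: d t sum_divide_distrib)
  hence "(det A powr (1 / ?n)) ^ ?n \<le> (trace A / ?n) ^ ?n"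
    by (intro power_mono) auto
  moreover have "(det A powr (1 / ?n)) ^ ?n = det A"
  proof (cases "det A = 0")
    case False
    hence "det A > 0" using d0 by linarith
    thus ?thesis by (simp add: powr_power)
  qed simp
  ultimately show "det A \<le> (trace A / ?n) ^ ?n" by simp
qed

lemma congruence_psd:
  fixes A S :: "real^'n::finite^'n"
  assumes "transpose A = A" "nonneg_definite A"
  shows "transpose (transpose S ** A ** S) = transpose S ** A ** S" "nonneg_definite (transpose S ** A ** S)"
proof -
  show "transpose (transpose S ** A ** S) = transpose S ** A ** S"
    by (simp add: matrix_transpose_mul assms(1) matrix_mul_assoc)
  have "v \<bullet> ((transpose S ** A ** S) *v v) = (S *v v) \<bullet> (A *v (S *v v))" for v
    by (simp only: matrix_vector_mul_assoc[symmetric] inner_transpose_matrix_vector)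
  thus "nonneg_definite (transpose S ** A ** S)" using assms(2) by (simp add: nonneg_definite_def)
qed

text \<open>With \<open>A = S S\<^sup>T\<close> the matrix \<open>S\<^sup>T a S\<close> is nonnegative definite and has the trace of \<open>a A\<close> and the
determinant \<open>det a det A\<close>, so the case of a single matrix applies. The last part covers degenerate
\<open>a\<close>: a positive definite \<open>A\<close> would give \<open>tr (a A)\<close> at least the smallest eigenvalue of \<open>A\<close> times
\<open>tr a\<close>.\<close>

lemma det_mul_le_trace_mul_power:
  fixes a A :: "real^'n::finite^'n"
  assumes a: "transpose a = a" "nonneg_definite a" and A: "transpose A = A" "nonneg_definite A"
  shows "0 \<le> trace (a ** A)" "det a * det A \<le> (trace (a ** A) / CARD('n)) ^ CARD('n)"
    "trace a > 0 \<Longrightarrow> trace (a ** A) \<le> 0 \<Longrightarrow> det A = 0"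
proof -
  obtain R l where R: "orthogonal_matrix R" "A = transpose R ** (\<chi> i j. if i = j then l i else 0) ** R"
    and eig: "\<And>i. A *v row i R = l i *\<^sub>R row i R" "\<And>i. norm (row i R) = 1"
    by (rule symmetric_diagonalization[OF A(1)], rule that, assumption+)
  have l0: "l i \<ge> 0" for i
  proof -
    have "0 \<le> row i R \<bullet> (A *v row i R)" using A(2) by (auto simp: nonneg_definite_def)
    thus ?thesis using eig(2)[of i] by (simp add: eig(1) norm_eq_1)
  qed
  define D where "D = ((\<chi> i j. if i = j then sqrt (l i) else 0) :: real^'n^'n)"
  \<comment> \<open>a square root of \<open>A\<close> up to an orthogonal factor: \<open>S S\<^sup>T = A\<close>\<close>
  define S where "S = transpose R ** D"
  have DD: "D ** D = (\<chi> i j. if i = j then l i else 0)"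
  proof -
    have "(\<Sum>k\<in>UNIV. (if i = k then sqrt (l i) else 0) * (if k = j then sqrt (l k) else 0)) = (if i = j then l i else 0)" for i j
    proof -
      have "(\<Sum>k\<in>UNIV. (if i = k then sqrt (l i) else 0) * (if k = j then sqrt (l k) else 0))
        = (\<Sum>k\<in>UNIV. if k = i then (if i = j then sqrt (l i) * sqrt (l i) else 0) else 0)"
        by (intro sum.cong) auto
      thus ?thesis using l0 by simp
    qed
    thus ?thesis by (simp add: D_def matrix_matrix_mult_def vec_eq_iff)
  qed
  have Dt: "transpose D = D" by (auto simp: D_def transpose_def vec_eq_iff)
  have SS: "S ** transpose S = A"
    unfolding S_def R(2) DD[symmetric] by (simp add: matrix_transpose_mul Dt matrix_mul_assoc)
  let ?M = "transpose S ** a ** S"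
  note M = congruence_psd[OF a, of S]
  have tr: "trace ?M = trace (a ** A)"
    unfolding SS[symmetric] by (subst trace_mul_sym) (simp add: matrix_mul_assoc[symmetric] trace_mul_sym[of a])
  have dt: "det ?M = det a * det A"
    unfolding SS[symmetric] by (simp add: det_mul det_transpose)
  show "0 \<le> trace (a ** A)" "det a * det A \<le> (trace (a ** A) / CARD('n)) ^ CARD('n)"
    using det_le_trace_power[OF M] by (simp_all add: tr dt)
  show "det A = 0" if tra: "trace a > 0" and trA: "trace (a ** A) \<le> 0"
  proof (rule ccontr)
    assume nz: "det A \<noteq> 0"
    have d: "det A = (\<Prod>i\<in>UNIV. l i)" unfolding R(2) by (rule det_diagonalized[OF R(1)])
    have lpos: "l i > 0" for i using nz l0[of i] unfolding d by (auto simp: less_le)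
    define B where "B = R ** a ** transpose R"
    have B: "transpose B = B" "nonneg_definite B"
      using congruence_psd[OF a, of "transpose R"] by (simp_all add: B_def)
    have Bdiag: "B $ i $ i \<ge> 0" for i
    proof -
      have "0 \<le> axis i 1 \<bullet> (B *v axis i 1)" using B(2) by (simp add: nonneg_definite_def)
      thus ?thesis by (simp add: matrix_vector_mul_component inner_axis inner_commute[of "axis i 1"] inner_axis')
    qed
    have trB: "trace B = trace a" unfolding B_def
      using R(1) by (subst trace_mul_sym) (simp add: matrix_mul_assoc orthogonal_matrix_def)
    have "trace (a ** A) = trace (B ** (\<chi> i j. if i = j then l i else 0))"
      unfolding R(2) B_def matrix_mul_assoc by (subst trace_mul_sym) (simp add: matrix_mul_assoc)
    also have "\<dots> = (\<Sum>i\<in>UNIV. B $ i $ i * l i)"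
      by (simp add: trace_def matrix_matrix_mult_def if_distrib[of "\<lambda>x. _ * x"] cong: if_cong)
    finally have "(\<Sum>i\<in>UNIV. B $ i $ i * l i) \<le> 0" using trA by simp
    moreover have "(\<Sum>i\<in>UNIV. B $ i $ i * l i) \<ge> 0" using Bdiag l0 by (intro sum_nonneg) simp
    ultimately have "(\<Sum>i\<in>UNIV. B $ i $ i * l i) = 0" by linarith
    hence "\<forall>i. B $ i $ i * l i = 0" using Bdiag l0 by (subst (asm) sum_nonneg_eq_0_iff) auto
    hence "\<forall>i. B $ i $ i = 0" using lpos by (metis less_irrefl mult_eq_0_iff)
    hence "trace B = 0" by (simp add: trace_def)
    thus False using trB tra by simp
  qed
qed

text \<open>The set of eigenvalues is finite, being contained in the diagonal of a diagonalization, and the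
minimum of the Rayleigh quotient belongs to it.\<close>

lemma smallest_eigenvalue_le_rayleigh:
  fixes A :: "real^'n::finite^'n"
  assumes sym: "transpose A = A"
  shows "smallest_eigenvalue A * (norm v)\<^sup>2 \<le> v \<bullet> (A *v v)"
proof -
  let ?E = "{l. \<exists>v. v \<noteq> 0 \<and> A *v v = l *\<^sub>R v}"
  obtain R l where R: "orthogonal_matrix R" "A = transpose R ** (\<chi> i j. if i = j then l i else 0) ** R"
    by (rule symmetric_diagonalization[OF sym], rule that, assumption+)
  have fin: "finite ?E"
  proof (rule finite_subset)
    show "finite (range l)" by simp
    show "?E \<subseteq> range l"
    proof safe
      fix m v assume v: "v \<noteq> 0" "A *v v = m *\<^sub>R v"
      define w where "w = R *v v"
      have RtR: "transpose R ** R = mat 1" "R ** transpose R = mat 1"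
        using R(1) by (auto simp: orthogonal_matrix_def matrix_left_right_inverse)
      have "w \<noteq> 0"
      proof
        assume "w = 0"
        hence "transpose R *v (R *v v) = 0" by (simp add: w_def)
        thus False using v by (simp add: matrix_vector_mul_assoc RtR)
      qed
      then obtain i where i: "w $ i \<noteq> 0" by (auto simp: vec_eq_iff)
      have "R *v (A *v v) = (\<chi> i j. if i = j then l i else 0) *v w"
        unfolding R(2) w_def by (simp add: matrix_vector_mul_assoc matrix_mul_assoc RtR)
      hence "m *\<^sub>R w = (\<chi> i j. if i = j then l i else 0) *v w"
        by (simp add: v(2) w_def matrix_vector_mult_scaleR)
      hence "(m *\<^sub>R w) $ i = ((\<chi> i j. if i = j then l i else 0) *v w) $ i" by simp
      hence "m * w $ i = l i * w $ i"
        by (simp add: matrix_vector_mult_def if_distrib[of "\<lambda>x. x * _"] cong: if_cong)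
      thus "m \<in> range l" using i by simp
    qed
  qed
  have symm: "transpose (- A) = - A" using sym by (simp add: vec_eq_iff transpose_def)
  have "UNIV \<noteq> {0::real^'n}" using UNIV_not_singleton by blast
  then obtain e m where e: "norm e = 1" "(- A) *v e = m *\<^sub>R e" "\<And>x. x \<bullet> ((- A) *v x) \<le> m * (norm x)\<^sup>2"
    using symmetric_eigenvector_in_subspace[OF symm, of UNIV] by auto
  have neg: "(- A) *v x = - (A *v x)" for x by (simp add: vec_eq_iff matrix_vector_mult_def sum_negf)
  have "A *v e = (- m) *\<^sub>R e" using arg_cong[OF e(2), of uminus] by (simp add: neg)
  hence "- m \<in> ?E" using e(1) by (auto intro!: exI[of _ e])
  hence "smallest_eigenvalue A \<le> - m" unfolding smallest_eigenvalue_def using fin by (intro Min_le)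
  hence "smallest_eigenvalue A * (norm v)\<^sup>2 \<le> - m * (norm v)\<^sup>2" by (intro mult_right_mono) auto
  thus ?thesis using e(3)[of v] by (simp add: neg)
qed

section \<open>Change of variables over an arbitrary finite index type\<close>

text \<open>The volume of a linear image is computed by elimination, which processes the coordinates in some
order. A finite index type without an order is in bijection with the following well ordered copy of
it, and renaming coordinates preserves Lebesgue measure and Jacobians.\<close>

typedef (overloaded) 'n ordinal_index = "{..<CARD('n::finite)}" morphisms index_rank index_of_rank
  by (rule exI[of _ 0]) simp

instantiation ordinal_index :: (finite) linorder
begin
definition less_eq_ordinal_index :: "'a ordinal_index \<Rightarrow> 'a ordinal_index \<Rightarrow> bool"
  where "x \<le> y \<longleftrightarrow> index_rank x \<le> index_rank y"
definition less_ordinal_index :: "'a ordinal_index \<Rightarrow> 'a ordinal_index \<Rightarrow> bool"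
  where "x < y \<longleftrightarrow> index_rank x < index_rank y"
instance
  by standard (auto simp: less_eq_ordinal_index_def less_ordinal_index_def index_rank_inject)
end

instance ordinal_index :: (finite) wellorder
proof
  fix P :: "'a ordinal_index \<Rightarrow> bool" and a :: "'a ordinal_index"
  assume *: "\<And>x. (\<And>y. y < x \<Longrightarrow> P y) \<Longrightarrow> P x"
  show "P a"
    by (induction "index_rank a" arbitrary: a rule: less_induct) (use * in \<open>simp add: less_ordinal_index_def\<close>)
qed

instance ordinal_index :: (finite) finite
proof
  have "(UNIV :: 'a ordinal_index set) = index_of_rank ` {..<CARD('a)}"
    by (metis type_definition.Abs_image type_definition_ordinal_index)
  thus "finite (UNIV :: 'a ordinal_index set)" by (metis finite_imageI finite_lessThan)
qed

lemma card_ordinal_index: "CARD('n::finite ordinal_index) = CARD('n)"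
  using type_definition.card[OF type_definition_ordinal_index] by simp

text \<open>Conjugation with a bijection turns transpositions into transpositions.\<close>

lemma sign_conjugate:
  assumes \<sigma>: "bij (\<sigma> :: 'm::finite \<Rightarrow> 'n::finite)" and p: "p permutes (UNIV :: 'm set)"
  shows "sign (\<sigma> \<circ> p \<circ> inv \<sigma>) = sign p"
  using p finite
proof (induction rule: permutes_induct)
  case id
  have "\<sigma> \<circ> id \<circ> inv \<sigma> = id" using \<sigma> by (simp add: fun_eq_iff bij_is_surj surj_f_inv_f)
  thus ?case by (simp only:) simp
next
  case (swap a b p)
  have eq: "\<sigma> \<circ> (Transposition.transpose a b \<circ> p) \<circ> inv \<sigma>
      = Transposition.transpose (\<sigma> a) (\<sigma> b) \<circ> (\<sigma> \<circ> p \<circ> inv \<sigma>)"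
    using bij_is_inj[OF \<sigma>] by (auto simp: fun_eq_iff Transposition.transpose_def inj_eq)
  have perm: "permutation q" if "bij q" for q :: "'x::finite \<Rightarrow> 'x"
    using that by (simp add: permutation)
  have b: "bij (\<sigma> \<circ> p \<circ> inv \<sigma>)" using \<sigma> swap by (intro bij_comp bij_imp_bij_inv) (auto simp: permutes_bij)
  have "sign (\<sigma> \<circ> (Transposition.transpose a b \<circ> p) \<circ> inv \<sigma>) = - sign (\<sigma> \<circ> p \<circ> inv \<sigma>)"
    unfolding eq using perm[OF b] swap bij_is_inj[OF \<sigma>]
    by (subst sign_compose) (auto simp: permutation_swap_id sign_swap_id inj_eq)
  moreover have "sign (Transposition.transpose a b \<circ> p) = - sign p"
    using swap by (subst sign_compose) (auto simp: permutation_swap_id sign_swap_id permutation permutes_bij)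
  ultimately show ?case using swap by metis
qed

lemma det_reindex:
  fixes A :: "real^'n::finite^'n" and \<sigma> :: "'m::finite \<Rightarrow> 'n"
  assumes \<sigma>: "bij \<sigma>"
  shows "det (\<chi> k l. A $ \<sigma> k $ \<sigma> l) = det A"
proof -
  let ?g = "\<lambda>p x. \<sigma> (p (inv \<sigma> x))"
  have "bij_betw (\<lambda>p x. if x \<in> UNIV then \<sigma> (p (inv_into UNIV \<sigma> x)) else x)
      {p. p permutes (UNIV::'m set)} {p. p permutes (UNIV::'n set)}"
    by (rule bij_betw_permutations) (use \<sigma> in auto)
  hence b: "bij_betw ?g {p. p permutes (UNIV::'m set)} {p. p permutes (UNIV::'n set)}" by simp
  have "det A = (\<Sum>p | p permutes (UNIV::'m set). of_int (sign (?g p)) * (\<Prod>i\<in>UNIV. A $ i $ ?g p i))"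
    unfolding det_def by (rule sum.reindex_bij_betw[OF b, symmetric])
  also have "\<dots> = (\<Sum>p | p permutes (UNIV::'m set). of_int (sign p) * (\<Prod>k\<in>UNIV. A $ \<sigma> k $ \<sigma> (p k)))"
  proof (intro sum.cong refl)
    fix p assume "p \<in> {p. p permutes (UNIV::'m set)}"
    hence "sign (\<sigma> \<circ> p \<circ> inv \<sigma>) = sign p" by (intro sign_conjugate \<sigma>) simp
    moreover have "?g p = \<sigma> \<circ> p \<circ> inv \<sigma>" by (simp add: fun_eq_iff)
    moreover have "(\<Prod>i\<in>UNIV. A $ i $ ?g p i) = (\<Prod>k\<in>UNIV. A $ \<sigma> k $ ?g p (\<sigma> k))"
      using \<sigma> by (subst prod.reindex_bij_betw[of \<sigma> UNIV UNIV, symmetric]) auto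
    moreover have "inv \<sigma> (\<sigma> k) = k" for k using \<sigma> by (simp add: bij_is_inj)
    ultimately show "of_int (sign (?g p)) * (\<Prod>i\<in>UNIV. A $ i $ ?g p i)
        = of_int (sign p) * (\<Prod>k\<in>UNIV. A $ \<sigma> k $ \<sigma> (p k))" by simp
  qed
  also have "\<dots> = det (\<chi> k l. A $ \<sigma> k $ \<sigma> l)" by (simp add: det_def)
  finally show ?thesis by simp
qed

lemma distr_lborel_reindex:
  fixes \<sigma> :: "'m::finite \<Rightarrow> 'n::finite"
  assumes \<sigma>: "bij \<sigma>"
  shows "distr lborel borel (\<lambda>x :: real^'n. \<chi> k. x $ \<sigma> k) = (lborel :: (real^'m) measure)"
proof (rule lborel_eqI[symmetric])
  let ?T = "\<lambda>x :: real^'n. (\<chi> k. x $ \<sigma> k) :: real^'m"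
  have cont: "continuous_on UNIV ?T" by (intro continuous_intros)
  have [measurable]: "?T \<in> borel_measurable borel" by (rule borel_measurable_continuous_onI[OF cont])
  show "sets (distr lborel borel ?T) = sets borel" by simp
  have inv1: "inv \<sigma> (\<sigma> k) = k" and inv2: "\<sigma> (inv \<sigma> i) = i" for k i
    using \<sigma> by (simp_all add: bij_is_inj bij_is_surj surj_f_inv_f)
  have prod_Basis: "(\<Prod>b\<in>(Basis :: (real^'x::finite) set). v \<bullet> b) = (\<Prod>i\<in>UNIV. v $ i)" for v :: "real^'x"
  proof -
    have "bij_betw (\<lambda>i. axis i 1) (UNIV::'x set) (Basis :: (real^'x) set)"
      by (auto simp: bij_betw_def inj_on_def axis_eq_axis Basis_vec_def)
    from prod.reindex_bij_betw[OF this, of "\<lambda>b. v \<bullet> b"] show ?thesis by (simp add: inner_axis)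
  qed
  fix l u :: "real^'m"
  assume le: "\<And>b. b \<in> Basis \<Longrightarrow> l \<bullet> b \<le> u \<bullet> b"
  have "l $ k \<le> u $ k" for k using le[of "axis k 1"] by (simp add: inner_axis axis_in_Basis_iff)
  define l' u' :: "real^'n" where "l' = (\<chi> i. l $ inv \<sigma> i)" and "u' = (\<chi> i. u $ inv \<sigma> i)"
  have "?T -` box l u = box l' u'"
  proof -
    have "(\<forall>k. l $ k < x $ \<sigma> k \<and> x $ \<sigma> k < u $ k) \<longleftrightarrow> (\<forall>i. l $ inv \<sigma> i < x $ i \<and> x $ i < u $ inv \<sigma> i)"
      for x :: "real^'n"
      by (metis inv1 inv2)
    thus ?thesis by (auto simp: mem_box_cart l'_def u'_def)
  qed
  hence "emeasure (distr lborel borel ?T) (box l u) = emeasure lborel (box l' u')"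
    by (subst emeasure_distr) auto
  also have "\<dots> = ennreal (\<Prod>b\<in>Basis. (u' - l') \<bullet> b)"
  proof (rule emeasure_lborel_box)
    fix b :: "real^'n" assume "b \<in> Basis"
    then obtain i where "b = axis i 1" by (auto simp: Basis_vec_def)
    thus "l' \<bullet> b \<le> u' \<bullet> b" using \<open>\<And>k. l $ k \<le> u $ k\<close> by (simp add: inner_axis l'_def u'_def)
  qed
  also have "(\<Prod>b\<in>Basis. (u' - l') \<bullet> b) = (\<Prod>b\<in>Basis. (u - l) \<bullet> b)"
    unfolding prod_Basis using \<sigma> by (subst prod.reindex_bij_betw[of \<sigma> UNIV UNIV, symmetric]) (auto simp: l'_def u'_def inv1)
  finally show "emeasure (distr lborel borel ?T) (box l u) = ennreal (\<Prod>b\<in>Basis. (u - l) \<bullet> b)" .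
qed

text \<open>The map need not be injective, whence an inequality. Borel sets on both sides spare any discussion
of the measurability of the image when coordinates are permuted later.\<close>

lemma emeasure_le_nn_integral_jacobian_wellorder:
  fixes f :: "real^'n::{finite,wellorder} \<Rightarrow> real^'n::_"
  assumes S: "S \<in> sets borel" and P: "P \<in> sets borel" "P \<subseteq> f ` S"
    and deriv: "\<And>x. x \<in> S \<Longrightarrow> (f has_derivative (\<lambda>v. M x *v v)) (at x)"
    and meas: "(\<lambda>x. indicator S x * \<bar>det (M x)\<bar>) \<in> borel_measurable borel"
  shows "emeasure lborel P \<le> (\<integral>\<^sup>+x. ennreal (indicator S x * \<bar>det (M x)\<bar>) \<partial>lborel)"
proof (cases "(\<integral>\<^sup>+x. ennreal (indicator S x * \<bar>det (M x)\<bar>) \<partial>lborel) = \<infinity>")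
  case False
  hence int: "integrable lborel (\<lambda>x. indicator S x * \<bar>det (M x)\<bar>)"
    using meas by (intro integrableI_nonneg) (auto simp: less_top)
  hence sint: "set_integrable lborel S (\<lambda>x. \<bar>det (M x)\<bar>)" by (simp add: set_integrable_def)
  have iS: "(\<lambda>x. \<bar>det (matrix ((*v) (M x)))\<bar>) integrable_on S"
    using set_borel_integral_eq_integral(1)[OF sint] by simp
  have d: "(f has_derivative ((*v) (M x))) (at x within S)" if "x \<in> S" for x
    using deriv[OF that] by (rule has_derivative_at_withinI)
  have Sl: "S \<in> sets lebesgue" using S by auto
  note m = measurable_differentiable_image[OF Sl d iS] measure_differentiable_image[OF Sl d iS]
  have "emeasure lborel P = emeasure lebesgue P" using P by simp
  also have "\<dots> \<le> emeasure lebesgue (f ` S)" using P m(1) by (intro emeasure_mono) (auto simp: fmeasurable_def)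
  also have "\<dots> = ennreal (measure lebesgue (f ` S))" using m(1) by (simp add: emeasure_eq_measure2)
  also have "\<dots> \<le> ennreal (integral S (\<lambda>x. \<bar>det (M x)\<bar>))" using m(2) by (intro ennreal_leI) simp
  also have "integral S (\<lambda>x. \<bar>det (M x)\<bar>) = (\<integral>x. indicator S x * \<bar>det (M x)\<bar> \<partial>lborel)"
    using set_borel_integral_eq_integral(2)[OF sint] by (simp add: set_lebesgue_integral_def)
  also have "ennreal \<dots> = (\<integral>\<^sup>+x. ennreal (indicator S x * \<bar>det (M x)\<bar>) \<partial>lborel)"
    by (rule nn_integral_eq_integral[OF int, symmetric]) simp
  finally show ?thesis .
qed simp

proposition emeasure_le_nn_integral_jacobian:
  fixes f :: "real^'n::finite \<Rightarrow> real^'n"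
  assumes S: "S \<in> sets borel" and P: "P \<in> sets borel" "P \<subseteq> f ` S"
    and deriv: "\<And>x. x \<in> S \<Longrightarrow> (f has_derivative (\<lambda>v. M x *v v)) (at x)"
    and meas: "(\<lambda>x. indicator S x * \<bar>det (M x)\<bar>) \<in> borel_measurable borel"
  shows "emeasure lborel P \<le> (\<integral>\<^sup>+x. ennreal (indicator S x * \<bar>det (M x)\<bar>) \<partial>lborel)"
proof -
  obtain \<sigma> :: "'n ordinal_index \<Rightarrow> 'n" where \<sigma>: "bij \<sigma>"
    using finite_same_card_bij[of "UNIV :: 'n ordinal_index set" "UNIV :: 'n set"] card_ordinal_index by auto
  have inv1: "inv \<sigma> (\<sigma> k) = k" and inv2: "\<sigma> (inv \<sigma> i) = i" for k i
    using \<sigma> by (simp_all add: bij_is_inj bij_is_surj surj_f_inv_f)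
  define T :: "real^'n \<Rightarrow> real^'n ordinal_index" where "T = (\<lambda>x. \<chi> k. x $ \<sigma> k)"
  define U :: "real^'n ordinal_index \<Rightarrow> real^'n" where "U = (\<lambda>y. \<chi> i. y $ inv \<sigma> i)"
  have UT: "U (T x) = x" and TU: "T (U y) = y" for x y
    by (simp_all add: U_def T_def inv1 inv2)
  have linT: "linear T" and linU: "linear U"
    by (auto intro!: linearI simp: T_def U_def vec_eq_iff)
  have [measurable]: "T \<in> borel_measurable borel" "U \<in> borel_measurable borel"
    using linear_continuous_on[OF linT[unfolded linear_conv_bounded_linear]]
      linear_continuous_on[OF linU[unfolded linear_conv_bounded_linear]]
    by (auto intro: borel_measurable_continuous_onI)
  have dT: "(lborel :: (real^'n ordinal_index) measure) = distr lborel borel T"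
    unfolding T_def by (rule distr_lborel_reindex[OF \<sigma>, symmetric])
  have [measurable]: "S \<in> sets borel" "P \<in> sets borel"
    "(\<lambda>x. indicator S x * \<bar>det (M x)\<bar>) \<in> borel_measurable borel" by fact+
  define N where "N y = (\<chi> k l. M (U y) $ \<sigma> k $ \<sigma> l)" for y
  have detN: "det (N y) = det (M (U y))" for y unfolding N_def by (rule det_reindex[OF \<sigma>])
  have mN: "N y *v v = T (M (U y) *v U v)" for y v
  proof -
    have "(\<Sum>l\<in>UNIV. M (U y) $ \<sigma> k $ \<sigma> l * v $ l) = (\<Sum>j\<in>UNIV. M (U y) $ \<sigma> k $ j * v $ inv \<sigma> j)" for k
      using \<sigma> by (subst sum.reindex_bij_betw[of \<sigma> UNIV UNIV, symmetric]) (auto simp: inv1)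
    thus ?thesis by (simp add: N_def T_def U_def matrix_vector_mult_def vec_eq_iff)
  qed
  have "emeasure lborel P = emeasure lborel (U -` P)"
    by (subst dT, subst emeasure_distr) (auto simp: UT vimage_def)
  also have "\<dots> \<le> (\<integral>\<^sup>+y. ennreal (indicator (U -` S) y * \<bar>det (N y)\<bar>) \<partial>lborel)"
  proof (rule emeasure_le_nn_integral_jacobian_wellorder[where f = "\<lambda>y. T (f (U y))"])
    show "U -` S \<in> sets borel" "U -` P \<in> sets borel"
      using measurable_sets[OF \<open>U \<in> borel_measurable borel\<close>] S P by (simp_all add: vimage_def)
    show "U -` P \<subseteq> (\<lambda>y. T (f (U y))) ` (U -` S)"
    proof
      fix y assume "y \<in> U -` P"
      then obtain x where "x \<in> S" "U y = f x" using P by auto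
      thus "y \<in> (\<lambda>y. T (f (U y))) ` (U -` S)"
        by (intro image_eqI[of _ _ "T x"]) (auto simp: UT, metis TU)
    qed
    fix y assume "y \<in> U -` S"
    hence "(f has_derivative (\<lambda>v. M (U y) *v v)) (at (U y))" by (auto intro: deriv)
    hence "((T \<circ> (f \<circ> U)) has_derivative (T \<circ> ((\<lambda>v. M (U y) *v v) \<circ> U))) (at y)"
      by (intro diff_chain_at linear_imp_has_derivative linT linU)
    thus "((\<lambda>y. T (f (U y))) has_derivative (\<lambda>v. N y *v v)) (at y)"
      by (simp add: o_def mN)
  next
    have "(\<lambda>y. (\<lambda>x. indicator S x * \<bar>det (M x)\<bar>) (U y)) \<in> borel_measurable borel" by measurable
    moreover have "indicat_real (U -` S) y = indicator S (U y)" for y by (simp add: indicator_def)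
    ultimately show "(\<lambda>y. indicator (U -` S) y * \<bar>det (N y)\<bar>) \<in> borel_measurable borel" by (simp add: detN)
  qed
  also have "\<dots> = (\<integral>\<^sup>+y. ennreal ((\<lambda>x. indicator S x * \<bar>det (M x)\<bar>) (U y)) \<partial>distr lborel borel T)"
    unfolding dT[symmetric] by (intro nn_integral_cong) (simp add: detN indicator_def)
  also have "\<dots> = (\<integral>\<^sup>+x. ennreal (indicator S x * \<bar>det (M x)\<bar>) \<partial>lborel)"
    by (subst nn_integral_distr) (auto simp: UT)
  finally show ?thesis .
qed


section \<open>The volume of a region of slopes\<close>

text \<open>The crude bound from the expansion of the determinant: only the dependence on the size of the
entries matters here.\<close>

lemma abs_det_le_entry_bound:
  fixes A :: "real^'n::finite^'n"
  assumes "\<And>i j. \<bar>A $ i $ j\<bar> \<le> m"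
  shows "\<bar>det A\<bar> \<le> fact CARD('n) * m ^ CARD('n)"
proof -
  have "\<bar>det A\<bar> \<le> (\<Sum>p | p permutes (UNIV::'n set). \<bar>of_int (sign p) * (\<Prod>i\<in>UNIV. A $ i $ p i)\<bar>)"
    unfolding det_def by (rule sum_abs)
  also have "\<dots> \<le> (\<Sum>p | p permutes (UNIV::'n set). m ^ CARD('n))"
  proof (rule sum_mono)
    fix p :: "'n \<Rightarrow> 'n"
    have "\<bar>of_int (sign p) * (\<Prod>i\<in>UNIV. A $ i $ p i)\<bar> = (\<Prod>i\<in>UNIV. \<bar>A $ i $ p i\<bar>)"
      by (simp add: abs_mult abs_prod sign_def)
    also have "\<dots> \<le> (\<Prod>i\<in>(UNIV::'n set). m)" using assms by (intro prod_mono) auto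
    finally show "\<bar>of_int (sign p) * (\<Prod>i\<in>UNIV. A $ i $ p i)\<bar> \<le> m ^ CARD('n)" by simp
  qed
  also have "\<dots> = fact CARD('n) * m ^ CARD('n)" by (simp add: card_permutations)
  finally show ?thesis .
qed

lemma identity_plus_rank_one_mult:
  fixes e :: "real^'n::finite"
  shows "(\<chi> i j. (if i = j then 1 else 0) + c * (e $ i * e $ j)) *v v = v + (c * (e \<bullet> v)) *\<^sub>R e"
proof -
  have "(\<Sum>j\<in>UNIV. ((if i = j then 1 else 0) + c * (e $ i * e $ j)) * v $ j) = v $ i + c * (e \<bullet> v) * e $ i" for i
  proof -
    have "(\<Sum>j\<in>UNIV. ((if i = j then 1 else 0) + c * (e $ i * e $ j)) * v $ j)
        = (\<Sum>j\<in>UNIV. (if i = j then v $ j else 0) + (c * e $ i) * (e $ j * v $ j))"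
      by (intro sum.cong) (auto simp: algebra_simps)
    also have "\<dots> = v $ i + (c * e $ i) * (e \<bullet> v)"
      by (simp add: sum.distrib sum_distrib_left inner_vec_def)
    finally show ?thesis by simp
  qed
  thus ?thesis by (simp add: matrix_vector_mult_def vec_eq_iff)
qed

text \<open>A rotation carries \<open>e\<close> to a coordinate axis and makes the matrix diagonal.\<close>

lemma det_identity_plus_rank_one:
  fixes e :: "real^'n::finite"
  shows "det (\<chi> i j. (if i = j then 1 else 0) + c * (e $ i * e $ j)) = 1 + c * (norm e)\<^sup>2"
proof -
  fix k :: 'n
  have ne: "norm e = norm (norm e *\<^sub>R axis k 1 :: real^'n)" by simp
  obtain g :: "real^'n \<Rightarrow> real^'n" where g: "orthogonal_transformation g" "g e = norm e *\<^sub>R axis k 1"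
  proof -
    show ?thesis by (rule orthogonal_transformation_exists[OF ne]) (erule (1) that)
  qed
  define R where "R = matrix g"
  have R: "orthogonal_matrix R" unfolding R_def using g(1) by (simp add: orthogonal_transformation_matrix)
  have Rv: "R *v v = g v" for v
    unfolding R_def using g(1) by (simp add: orthogonal_transformation_linear matrix_works)
  let ?N = "(\<chi> i j. (if i = j then 1 else 0) + c * (e $ i * e $ j)) :: real^'n^'n"
  let ?D = "(\<chi> i j. if i = j then (if i = k then 1 + c * (norm e)\<^sup>2 else 1) else 0) :: real^'n^'n"
  have Nv: "?N *v v = v + (c * (e \<bullet> v)) *\<^sub>R e" for v
    by (rule identity_plus_rank_one_mult)
  have Dv: "?D *v v = v + (c * (norm e)\<^sup>2 * v $ k) *\<^sub>R axis k 1" for v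
  proof -
    have "(?D *v v) $ i = (v + (c * (norm e)\<^sup>2 * v $ k) *\<^sub>R axis k 1) $ i" for i
    proof -
      have "(?D *v v) $ i = (\<Sum>j\<in>UNIV. if i = j then (if i = k then 1 + c * (norm e)\<^sup>2 else 1) * v $ j else 0)"
        unfolding matrix_vector_mult_def by (subst vec_lambda_beta, rule sum.cong[OF refl]) simp
      also have "\<dots> = (v + (c * (norm e)\<^sup>2 * v $ k) *\<^sub>R axis k 1) $ i"
        by (simp add: axis_def algebra_simps)
      finally show ?thesis .
    qed
    thus ?thesis unfolding vec_eq_iff by blast
  qed
  have "R *v (?N *v v) = ?D *v (R *v v)" for v
  proof -
    have "e \<bullet> v = g e \<bullet> g v" using g(1) by (simp add: orthogonal_transformation_def)
    also have "\<dots> = norm e * (R *v v) $ k" by (simp add: g(2) Rv inner_axis' )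
    finally have ev: "e \<bullet> v = norm e * (R *v v) $ k" .
    have "R *v (?N *v v) = R *v v + (c * (e \<bullet> v)) *\<^sub>R (R *v e)"
      by (simp add: Nv matrix_vector_right_distrib matrix_vector_mult_scaleR)
    also have "\<dots> = ?D *v (R *v v)"
      by (simp add: Dv Rv[of e] g(2) ev power2_eq_square mult_ac)
    finally show ?thesis .
  qed
  hence "(R ** ?N) = (?D ** R)"
    by (simp add: matrix_eq matrix_vector_mul_assoc)
  hence "det (R ** ?N) = det (?D ** R)" by (rule arg_cong)
  hence "det R * det ?N = det ?D * det R" by (simp only: det_mul)
  moreover have "det R \<noteq> 0" using det_orthogonal_matrix[OF R] by auto
  moreover have "det ?D = 1 + c * (norm e)\<^sup>2"
    by (subst det_diagonal) (auto simp: prod.If_cases)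
  ultimately show ?thesis by simp
qed

text \<open>The condition \<open>|p| \<le> \<eta> - p \<bullet> e\<close> is, after squaring, the quadratic inequality of an ellipsoid with
matrix \<open>I - e e\<^sup>T\<close> and centre \<open>- \<eta> e / \<epsilon>\<close>, where \<open>\<epsilon> = 1 - |e|\<^sup>2\<close>. Its semiaxis in the direction of
\<open>e\<close> is \<open>\<eta> / \<epsilon>\<close>, the others are \<open>\<eta>\<close> divided by the square root of \<open>\<epsilon>\<close>. Its image under the affine map
\<open>f\<close> covers the unit ball, so the inequality for images bounds its volume from below.\<close>

lemma emeasure_slope_region_ge:
  fixes e :: "real^'n::finite"
  assumes e: "norm e < 1" and \<eta>: "\<eta> > 0"
  shows "emeasure lborel (cball (0::real^'n) 1) * ennreal (\<eta> ^ CARD('n))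
    \<le> emeasure lborel {p. norm p + p \<bullet> e \<le> \<eta>} * ennreal ((1 - (norm e)\<^sup>2) powr ((real CARD('n) + 1) / 2))"
proof -
  let ?n = "CARD('n)"
  define \<epsilon> where "\<epsilon> = 1 - (norm e)\<^sup>2"
  have "(norm e)\<^sup>2 < 1" using e by (simp add: power_less_one_iff abs_square_less_1)
  hence \<epsilon>: "\<epsilon> > 0" by (simp add: \<epsilon>_def)
  define r where "r = sqrt \<epsilon>"
  have r: "r > 0" "r * r = \<epsilon>" using \<epsilon> by (simp_all add: r_def)
  have ee: "e \<bullet> e = 1 - r * r" by (simp add: r \<epsilon>_def power2_norm_eq_inner)
  \<comment> \<open>\<open>t\<close> and \<open>k\<close> are the coefficients of \<open>e e\<^sup>T\<close> in the square roots of \<open>I - e e\<^sup>T\<close> and of its inverse\<close>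
  define t where "t = 1 / (1 + r)"
  define k where "k = 1 / (r * (1 + r))"
  let ?P = "{p. norm p + p \<bullet> e \<le> \<eta>}"
  define N :: "real^'n^'n" where "N = (\<chi> i j. (if i = j then 1 else 0) + (- t) * (e $ i * e $ j))"
  define f where "f p = (r / \<eta>) *\<^sub>R (N *v (p + (\<eta> / \<epsilon>) *\<^sub>R e))" for p
  have Nv: "N *v v = v - (t * (e \<bullet> v)) *\<^sub>R e" for v
    unfolding N_def identity_plus_rank_one_mult by simp
  have detN: "det N = r"
  proof -
    have "det N = 1 + (- t) * (norm e)\<^sup>2" unfolding N_def by (rule det_identity_plus_rank_one)
    also have "(norm e)\<^sup>2 = (1 - r) * (1 + r)" using ee by (simp add: power2_norm_eq_inner algebra_simps)
    finally show ?thesis using r by (simp add: t_def)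
  qed
  have cover: "cball 0 1 \<subseteq> f ` ?P"
  proof
    fix w :: "real^'n" assume "w \<in> cball 0 1"
    hence w: "norm w \<le> 1" by simp
    define s where "s = e \<bullet> w"
    have s1: "s \<le> 1" using Cauchy_Schwarz_ineq2[of e w] w e mult_mono[of "norm e" 1 "norm w" 1] by (auto simp: s_def)
    define q where "q = w + (k * s) *\<^sub>R e"
    \<comment> \<open>the preimage of \<open>w\<close> under \<open>f\<close>\<close>
    define p where "p = (\<eta> / r) *\<^sub>R q - (\<eta> / \<epsilon>) *\<^sub>R e"
    have k1: "1 + k * (1 - r * r) = 1 / r"
    proof -
      have "1 - r * r = (1 - r) * (1 + r)" by (simp add: algebra_simps)
      hence "k * (1 - r * r) = (1 - r) / r" using r(1) by (simp add: k_def)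
      thus ?thesis using r(1) by (simp add: field_simps)
    qed
    have eq: "e \<bullet> q = s / r"
    proof -
      have "e \<bullet> q = s * (1 + k * (1 - r * r))" by (simp add: q_def inner_add_right ee algebra_simps flip: s_def)
      thus ?thesis by (simp add: k1)
    qed
    have qq: "q \<bullet> q = (norm w)\<^sup>2 + s\<^sup>2 / \<epsilon>"
    proof -
      have "q \<bullet> q = w \<bullet> w + s\<^sup>2 * (2 * k + k * k * (1 - r * r))"
        by (simp add: q_def inner_add_left inner_add_right ee inner_commute[of w e] power2_eq_square algebra_simps
            flip: s_def)
      also have "2 * k + k * k * (1 - r * r) = 1 / \<epsilon>"
      proof -
        have "2 * k + k * k * (1 - r * r) = k * (1 + (1 + k * (1 - r * r)))" by (simp add: algebra_simps)
        also have "\<dots> = k * (1 + 1 / r)" by (simp only: k1)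
        also have "1 + 1 / r = (1 + r) / r" using r(1) by (simp add: field_simps)
        also have "k * ((1 + r) / r) = 1 / \<epsilon>" using r(1) by (simp add: k_def flip: r(2))
        finally show ?thesis .
      qed
      finally show ?thesis by (simp add: power2_norm_eq_inner)
    qed
    have pe: "\<eta> - p \<bullet> e = (\<eta> / \<epsilon>) * (1 - s)"
    proof -
      have "p \<bullet> e = (\<eta> / r) * (s / r) - (\<eta> / \<epsilon>) * (1 - \<epsilon>)"
        using eq by (simp add: p_def inner_diff_left ee r inner_commute[of q])
      also have "(\<eta> / r) * (s / r) = (\<eta> / \<epsilon>) * s" by (simp add: r(2)[symmetric])
      finally show ?thesis using \<epsilon> by (simp add: field_simps)
    qed
    have "(norm p)\<^sup>2 = (\<eta> / r)\<^sup>2 * (q \<bullet> q) - 2 * (\<eta> / r) * (\<eta> / \<epsilon>) * (s / r) + (\<eta> / \<epsilon>)\<^sup>2 * (1 - \<epsilon>)"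
    proof -
      have "(norm (a *\<^sub>R q - b *\<^sub>R e))\<^sup>2 = a\<^sup>2 * (q \<bullet> q) - 2 * a * b * (e \<bullet> q) + b\<^sup>2 * (e \<bullet> e)" for a b
        unfolding power2_norm_eq_inner
        by (simp add: inner_diff_left inner_diff_right inner_commute[of q e] power2_eq_square algebra_simps)
      thus ?thesis unfolding p_def by (simp only: eq ee r(2))
    qed
    also have "\<dots> = (\<eta> / \<epsilon>)\<^sup>2 * (1 - s)\<^sup>2 - \<eta>\<^sup>2 / \<epsilon> * (1 - (norm w)\<^sup>2)"
    proof -
      have a: "(\<eta> / r)\<^sup>2 = \<eta>\<^sup>2 / \<epsilon>" "(\<eta> / r) * (\<eta> / \<epsilon>) * (s / r) = (\<eta> / \<epsilon>)\<^sup>2 * s"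
        using r(1) by (simp_all add: power2_eq_square r(2)[symmetric])
      have b: "\<eta>\<^sup>2 / \<epsilon> = (\<eta> / \<epsilon>)\<^sup>2 * \<epsilon>" "\<epsilon> * ((norm w)\<^sup>2 + s\<^sup>2 / \<epsilon>) = \<epsilon> * (norm w)\<^sup>2 + s\<^sup>2"
        using \<epsilon> by (simp_all add: field_simps power2_eq_square)
      have "(\<eta> / r)\<^sup>2 * (q \<bullet> q) = (\<eta> / \<epsilon>)\<^sup>2 * (\<epsilon> * (norm w)\<^sup>2 + s\<^sup>2)"
        by (simp only: qq a(1) b(1) b(2)[symmetric] mult.assoc)
      moreover have "2 * (\<eta> / r) * (\<eta> / \<epsilon>) * (s / r) = 2 * ((\<eta> / \<epsilon>)\<^sup>2 * s)"
        unfolding a(2)[symmetric] by simp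
      ultimately show ?thesis unfolding b(1) by (simp add: algebra_simps power2_eq_square[of "1 - s"] power2_eq_square[of s])
    qed
    also have "\<dots> \<le> (\<eta> / \<epsilon>)\<^sup>2 * (1 - s)\<^sup>2"
      using w \<epsilon> by (simp add: power_le_one)
    finally have "(norm p)\<^sup>2 \<le> (\<eta> - p \<bullet> e)\<^sup>2" unfolding pe by (simp only: power_mult_distrib)
    moreover have "\<eta> - p \<bullet> e \<ge> 0" unfolding pe using s1 \<eta> \<epsilon> by simp
    ultimately have "norm p \<le> \<eta> - p \<bullet> e" using power2_le_imp_le by blast
    hence pP: "p \<in> ?P" by simp
    have "f p = (r / \<eta>) *\<^sub>R (N *v ((\<eta> / r) *\<^sub>R q))" by (simp add: f_def p_def)
    also have "\<dots> = q - (t * (e \<bullet> q)) *\<^sub>R e"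
      using r \<eta> by (simp add: matrix_vector_mult_scaleR Nv)
    also have "\<dots> = w + (k * s - t * (s / r)) *\<^sub>R e" unfolding eq by (simp add: q_def algebra_simps)
    also have "k * s - t * (s / r) = 0" using r by (simp add: k_def t_def)
    finally show "w \<in> f ` ?P" using pP by (intro image_eqI[of _ _ p]) auto
  qed
  have clP: "closed ?P" by (intro closed_Collect_le continuous_intros)
  hence Pm: "?P \<in> sets borel" by simp
  have detM: "\<bar>det ((r / \<eta>) *\<^sub>R N)\<bar> = (r / \<eta>) ^ ?n * r"
  proof -
    have "(r / \<eta>) *\<^sub>R N = (\<chi> i. (r / \<eta>) *s N $ i)" by (simp add: vec_eq_iff)
    hence "det ((r / \<eta>) *\<^sub>R N) = (r / \<eta>) ^ ?n * r"
      using det_rows_mul[of "\<lambda>i. r / \<eta>" "\<lambda>i. N $ i"] by (simp add: detN)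
    thus ?thesis using r \<eta> by simp
  qed
  have "emeasure lborel (cball (0::real^'n) 1) \<le> (\<integral>\<^sup>+p. ennreal (indicator ?P p * \<bar>det ((r / \<eta>) *\<^sub>R N)\<bar>) \<partial>lborel)"
  proof (rule emeasure_le_nn_integral_jacobian[OF Pm _ cover])
    fix p
    have "((\<lambda>p. N *v (p + (\<eta> / \<epsilon>) *\<^sub>R e)) has_derivative (\<lambda>v. N *v (v + 0))) (at p)"
      by (rule bounded_linear.has_derivative[OF matrix_vector_mul_bounded_linear]) (auto intro!: derivative_eq_intros)
    hence "(f has_derivative (\<lambda>v. (r / \<eta>) *\<^sub>R (N *v v))) (at p)"
      unfolding f_def by (auto intro!: derivative_eq_intros)
    thus "(f has_derivative ((*v) ((r / \<eta>) *\<^sub>R N))) (at p)" by (simp add: scaleR_matrix_vector_assoc)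
  qed (use Pm in auto)
  also have "\<dots> = ennreal ((r / \<eta>) ^ ?n * r) * emeasure lborel ?P"
    unfolding detM using Pm r \<eta>
    by (subst nn_integral_cmult_indicator[symmetric]) (auto intro!: nn_integral_cong split: split_indicator)
  finally have "emeasure lborel (cball (0::real^'n) 1) * ennreal (\<eta> ^ ?n)
      \<le> ennreal ((r / \<eta>) ^ ?n * r) * emeasure lborel ?P * ennreal (\<eta> ^ ?n)"
    by (rule mult_right_mono) simp
  also have "\<dots> = emeasure lborel ?P * ennreal ((r / \<eta>) ^ ?n * r * \<eta> ^ ?n)"
    using r \<eta> by (subst ennreal_mult) (auto simp: mult_ac)
  also have "(r / \<eta>) ^ ?n * r * \<eta> ^ ?n = r ^ (?n + 1)" using \<eta> by (simp add: power_divide)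
  also have "r ^ (?n + 1) = \<epsilon> powr ((real ?n + 1) / 2)"
  proof -
    have "r ^ (?n + 1) = (\<epsilon> powr (1/2)) powr (real (?n + 1))"
      using \<epsilon> r by (subst powr_realpow) (auto simp: r_def powr_half_sqrt)
    also have "\<dots> = \<epsilon> powr ((real ?n + 1) / 2)" by (simp add: powr_powr add.commute)
    finally show ?thesis .
  qed
  finally show ?thesis by (simp add: \<epsilon>_def)
qed

section \<open>Contact with exponential profiles\<close>

text \<open>The determinant cut off outside the closed cone of nonnegative definite symmetric matrices. On the
cone it is continuous and nonnegative, outside it is \<open>0\<close>, so it is upper semicontinuous.\<close>

definition psd_det :: "real^'n::finite^'n \<Rightarrow> real" where
  "psd_det A = (if transpose A = A \<and> nonneg_definite A then det A else 0)"

text \<open>The negative Hessian at a point of contact with an exponential profile of rate \<open>K\<close>: the Hessian of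
the profile there is \<open>- K q q\<^sup>T / |q|\<close>. For \<open>q = 0\<close> the correction is \<open>0\<close> by division by zero, which
is also its limit.\<close>

definition drift_hessian :: "real \<Rightarrow> real^'n::finite \<Rightarrow> real^'n^'n \<Rightarrow> real^'n^'n" where
  "drift_hessian K q H = (\<chi> i j. - H $ i $ j - K * (q $ i * q $ j) / norm q)"

lemma drift_hessian_mult:
  fixes q w :: "real^'n::finite"
  shows "drift_hessian K q H *v w = - (H *v w) - (K * (q \<bullet> w) / norm q) *\<^sub>R q"
proof -
  have "(\<Sum>j\<in>UNIV. (- H $ i $ j - K * (q $ i * q $ j) / norm q) * w $ j)
      = - (\<Sum>j\<in>UNIV. H $ i $ j * w $ j) - (K * (q \<bullet> w) / norm q) * q $ i" for i
  proof -
    have "(\<Sum>j\<in>UNIV. (- H $ i $ j - K * (q $ i * q $ j) / norm q) * w $ j)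
        = (\<Sum>j\<in>UNIV. - (H $ i $ j * w $ j) - (K * q $ i / norm q) * (q $ j * w $ j))"
      by (intro sum.cong) (auto simp: algebra_simps)
    also have "\<dots> = - (\<Sum>j\<in>UNIV. H $ i $ j * w $ j) - (K * q $ i / norm q) * (q \<bullet> w)"
      by (simp add: sum_subtractf sum_negf sum_distrib_left inner_vec_def)
    finally show ?thesis by simp
  qed
  thus ?thesis by (simp add: drift_hessian_def matrix_vector_mult_def vec_eq_iff)
qed

lemma psd_det_nonneg: "0 \<le> psd_det A"
  using det_le_trace_power(1)[of A] by (simp add: psd_det_def)

lemma closed_psd: "closed {A :: real^'n::finite^'n. transpose A = A \<and> nonneg_definite A}"
proof -
  have "{A :: real^'n^'n. transpose A = A \<and> nonneg_definite A}
     = (\<Inter>i. \<Inter>j. {A. A $ j $ i = A $ i $ j}) \<inter> (\<Inter>v. {A. 0 \<le> v \<bullet> (A *v v)})"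
    by (auto simp: nonneg_definite_def transpose_def vec_eq_iff)
  also have "closed \<dots>"
    unfolding matrix_vector_mult_def
    by (intro closed_Int closed_INT ballI closed_Collect_eq closed_Collect_le continuous_intros)
  finally show ?thesis .
qed

lemma local_max_second_order:
  fixes \<phi> \<phi>1 :: "real \<Rightarrow> real"
  assumes \<delta>: "\<delta> > 0" and d1: "\<And>t. \<bar>t\<bar> < \<delta> \<Longrightarrow> (\<phi> has_real_derivative \<phi>1 t) (at t)"
    and d2: "(\<phi>1 has_real_derivative c) (at 0)"
    and max: "\<And>t. \<bar>t\<bar> < \<delta> \<Longrightarrow> \<phi> t \<le> \<phi> 0"
  shows "\<phi>1 0 = 0" "c \<le> 0"
proof -
  show z: "\<phi>1 0 = 0"
    by (rule DERIV_local_max[of \<phi> _ 0 \<delta>]) (use d1[of 0] \<delta> max in auto)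
  show "c \<le> 0"
  proof (rule ccontr)
    assume "\<not> c \<le> 0"
    then obtain d where d: "d > 0" "\<And>h. 0 < h \<Longrightarrow> h < d \<Longrightarrow> \<phi>1 0 < \<phi>1 (0 + h)"
      using DERIV_pos_inc_right[OF d2] by auto
    define t where "t = min d \<delta> / 2"
    have t: "0 < t" "t < d" "t < \<delta>" using d \<delta> by (auto simp: t_def)
    obtain \<xi> where \<xi>: "0 < \<xi>" "\<xi> < t" "\<phi> t - \<phi> 0 = (t - 0) * \<phi>1 \<xi>"
      using MVT2[of 0 t \<phi> \<phi>1] t d1 by auto
    have "\<phi>1 \<xi> > 0" using d(2)[of \<xi>] \<xi> t z by auto
    hence "\<phi> t > \<phi> 0" using \<xi> t by (metis diff_0_right diff_gt_0_iff_gt mult_pos_pos)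
    thus False using max[of t] t by auto
  qed
qed

text \<open>The profile stays above \<open>exp (2 K)\<close> times its tangent at \<open>0\<close> on the negative side, since its derivative on
\<open>[-2, 0]\<close> is at most \<open>exp (2 K)\<close>. The interval is that of the possible values of
\<open>\<omega> \<bullet> (y - e)\<close> in the unit ball.\<close>

lemma exponential_slope_lower_bound:
  fixes K t c :: real
  assumes "K > 0" "c \<ge> 0" "t \<ge> -2"
  shows "c * (1 - exp (- K * t)) / K \<ge> min 0 (c * t * exp (2 * K))"
proof (cases "t \<ge> 0")
  case True
  hence "c * (1 - exp (- K * t)) / K \<ge> 0" using assms by simp
  thus ?thesis by linarith
next
  case False
  define x where "x = - K * t"
  have "K * (- t) \<le> K * 2" using assms by (intro mult_left_mono) auto
  hence x: "0 \<le> x" "x \<le> 2 * K" using assms False by (auto simp: x_def mult_nonneg_nonpos)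
  have "1 - exp (- x) \<le> x" using exp_ge_add_one_self[of "- x"] by simp
  hence "exp x * (1 - exp (- x)) \<le> exp x * x" by (intro mult_left_mono) auto
  also have "\<dots> \<le> exp (2 * K) * x" using x by (intro mult_right_mono) auto
  finally have "exp x - 1 \<le> exp (2 * K) * x" by (simp add: right_diff_distrib exp_minus_inverse)
  hence "c * (1 - exp x) \<ge> c * (- (exp (2 * K) * x))" using assms by (intro mult_left_mono) auto
  hence "c * (1 - exp x) / K \<ge> c * (- (exp (2 * K) * x)) / K" using assms by (intro divide_right_mono) auto
  moreover have "c * (- (exp (2 * K) * x)) / K = c * t * exp (2 * K)" using assms by (simp add: x_def)
  ultimately show ?thesis by (simp add: x_def)
qed

text \<open>The profile \<open>l\<close> vanishes at \<open>e\<close> and is at least \<open>- h/2\<close> on the ball, by the size restriction on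
\<open>p\<close>. Hence \<open>v - l\<close> cannot attain its maximum on the sphere of radius \<open>r\<close>, where \<open>u\<close> is lower than
\<open>u e\<close> by \<open>h\<close>; the remaining tolerance pays for replacing \<open>u\<close> by the smooth \<open>v\<close>. At an interior
maximum the first order condition recovers \<open>p\<close> from the gradient, and the second order condition is
the sign of the corrected Hessian.\<close>

lemma contact_point_exists:
  fixes u v :: "real^'n::finite \<Rightarrow> real"
  assumes K: "K > 0" and r: "r < 1" and e: "e \<in> ball 0 r" and h: "h > 0"
    and dv: "\<And>y. y \<in> ball 0 r \<Longrightarrow> (v has_derivative (\<lambda>w. q y \<bullet> w)) (at y)"
    and dq: "\<And>y. y \<in> ball 0 r \<Longrightarrow> (q has_derivative (\<lambda>w. H y *v w)) (at y)"
    and cv: "continuous_on (cball 0 r) v"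
    and close: "\<And>y. y \<in> cball 0 r \<Longrightarrow> \<bar>v y - u y\<bar> \<le> h / 16"
    and bdry: "\<And>y. y \<in> sphere 0 r \<Longrightarrow> u y \<le> u e - h"
    and s: "s \<le> u e - h"
    and p: "p \<noteq> 0" "norm p + p \<bullet> e \<le> exp (- 2 * K) * (h / 2)"
  obtains y where "y \<in> ball 0 r" "q y \<noteq> 0" "u y > s" "nonneg_definite (drift_hessian K (q y) (H y))"
    "exp (K * ((q y \<bullet> (y - e)) / norm (q y))) *\<^sub>R q y = p"
proof -
  define \<omega> where "\<omega> = p /\<^sub>R norm p"
  have \<omega>: "norm \<omega> = 1" "p = norm p *\<^sub>R \<omega>" using p by (auto simp: \<omega>_def)
  define E where "E y = exp (- K * (\<omega> \<bullet> (y - e)))" for y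
  \<comment> \<open>the profile with slope \<open>p\<close> at \<open>e\<close>; its gradient at \<open>y\<close> is \<open>E y *\<^sub>R p\<close>\<close>
  define l where "l y = norm p * (1 - E y) / K" for y
  have le: "l e = 0" by (simp add: l_def E_def)
  have low: "l y \<ge> - (h / 2)" if "y \<in> cball 0 r" for y
  proof -
    have y: "norm y \<le> 1" using that r by simp
    have "\<bar>\<omega> \<bullet> (y - e)\<bar> \<le> norm \<omega> * norm (y - e)" by (rule Cauchy_Schwarz_ineq2)
    also have "\<dots> \<le> 2" using \<omega> y e r norm_triangle_ineq4[of y e] by auto
    finally have "\<omega> \<bullet> (y - e) \<ge> -2" by linarith
    from exponential_slope_lower_bound[OF K norm_ge_zero[of p] this]
    have "l y \<ge> min 0 (norm p * (\<omega> \<bullet> (y - e)) * exp (2 * K))" by (simp add: l_def E_def)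
    moreover have "norm p * (\<omega> \<bullet> (y - e)) = p \<bullet> y - p \<bullet> e"
      by (subst (2 3) \<omega>(2)) (simp add: inner_diff_right right_diff_distrib)
    moreover have "p \<bullet> y \<ge> - norm p"
      using Cauchy_Schwarz_ineq2[of p y] y mult_left_mono[of "norm y" 1 "norm p"] by auto
    ultimately have "l y \<ge> min 0 ((p \<bullet> y - p \<bullet> e) * exp (2 * K))"
      "p \<bullet> y - p \<bullet> e \<ge> - (exp (- 2 * K) * (h / 2))" using p by auto
    moreover have "(p \<bullet> y - p \<bullet> e) * exp (2 * K) \<ge> - (exp (- 2 * K) * (h / 2)) * exp (2 * K)"
      using calculation(2) by (intro mult_right_mono) auto
    moreover have "- (exp (- 2 * K) * (h / 2)) * exp (2 * K) = - (h / 2)"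
      by (simp add: exp_minus)
    ultimately show ?thesis using h by linarith
  qed
  have cl: "continuous_on A l" for A unfolding l_def E_def by (intro continuous_intros) (use K in auto)
  have "cball (0::real^'n) r \<noteq> {}" "compact (cball (0::real^'n) r)"
    using e norm_ge_zero[of e] by (auto simp del: norm_ge_zero intro: order.trans less_imp_le)
  from continuous_attains_sup[OF this(2,1) continuous_on_diff[OF cv cl]] obtain y where
    y: "y \<in> cball 0 r" and ymax: "\<And>z. z \<in> cball 0 r \<Longrightarrow> v z - l z \<le> v y - l y"
    by blast
  have ec: "e \<in> cball 0 r" using e by auto
  have ye: "v y - l y \<ge> v e" using ymax[OF ec] le by simp
  have ve: "v e \<ge> u e - h / 16" using close[OF ec] by linarith
  have vy: "v y \<le> u y + h / 16" using close[OF y] by linarith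
  have yb: "y \<in> ball 0 r"
  proof (rule ccontr)
    assume "y \<notin> ball 0 r"
    hence "y \<in> sphere 0 r" using y by auto
    from bdry[OF this] show False using ye ve vy low[OF y] h by linarith
  qed
  have us: "u y > s" using ye ve vy low[OF y] h s by linarith
  obtain \<delta> where \<delta>: "\<delta> > 0" "ball y \<delta> \<subseteq> ball 0 r" using yb openE open_ball by blast
  have dE: "(E has_derivative (\<lambda>w. - K * E z * (\<omega> \<bullet> w))) (at z)" for z
    unfolding E_def by (auto intro!: derivative_eq_intros)
  have dl: "(l has_derivative (\<lambda>w. E z * (p \<bullet> w))) (at z)" for z
  proof -
    have "((\<lambda>y. (norm p / K) * (1 - E y)) has_derivative (\<lambda>w. (norm p / K) * (0 - (- K * E z * (\<omega> \<bullet> w))))) (at z)"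
      by (intro has_derivative_mult_right has_derivative_diff dE has_derivative_const)
    hence "(l has_derivative (\<lambda>w. (norm p / K) * (0 - (- K * E z * (\<omega> \<bullet> w))))) (at z)"
      by (simp add: l_def[abs_def])
    moreover have "((norm p / K) * (0 - (- K * E z * (\<omega> \<bullet> w)))) = E z * (p \<bullet> w)" for w
      using K by (subst (2) \<omega>(2)) simp
    ultimately show ?thesis by simp
  qed
  have so: "q y \<bullet> w = E y * (p \<bullet> w) \<and> (H y *v w) \<bullet> w + K * (\<omega> \<bullet> w) * E y * (p \<bullet> w) \<le> 0" if w: "w \<noteq> 0" for w
  proof -
    define \<delta>' where "\<delta>' = \<delta> / norm w"
    have \<delta>': "\<delta>' > 0" using \<delta> w by (simp add: \<delta>'_def)
    have inb: "y + t *\<^sub>R w \<in> ball 0 r" if "\<bar>t\<bar> < \<delta>'" for t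
    proof -
      have "y + t *\<^sub>R w \<in> ball y \<delta>" using that w by (simp add: dist_norm \<delta>'_def field_simps)
      thus ?thesis using \<delta> by blast
    qed
    let ?\<phi> = "\<lambda>t. v (y + t *\<^sub>R w) - l (y + t *\<^sub>R w)"
    let ?\<phi>1 = "\<lambda>t. q (y + t *\<^sub>R w) \<bullet> w - E (y + t *\<^sub>R w) * (p \<bullet> w)"
    have line: "((\<lambda>t. y + t *\<^sub>R w) has_derivative (\<lambda>t. t *\<^sub>R w)) (at t)" for t
      by (auto intro!: derivative_eq_intros)
    have d1: "(?\<phi> has_real_derivative ?\<phi>1 t) (at t)" if t: "\<bar>t\<bar> < \<delta>'" for t
    proof -
      have "(?\<phi> has_derivative (\<lambda>a. q (y + t *\<^sub>R w) \<bullet> (a *\<^sub>R w) - E (y + t *\<^sub>R w) * (p \<bullet> (a *\<^sub>R w)))) (at t)"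
        by (intro has_derivative_diff has_derivative_compose[OF line dv[OF inb[OF t]]] has_derivative_compose[OF line dl])
      thus ?thesis by (rule has_derivative_imp_has_field_derivative) (simp add: algebra_simps)
    qed
    have d2: "(?\<phi>1 has_real_derivative ((H y *v w) \<bullet> w + K * (\<omega> \<bullet> w) * E y * (p \<bullet> w))) (at 0)"
    proof -
      have "((\<lambda>t. q (y + t *\<^sub>R w)) has_derivative (\<lambda>a. H (y + 0 *\<^sub>R w) *v (a *\<^sub>R w))) (at 0)"
        by (rule has_derivative_compose[OF line dq]) (rule inb, use \<delta>' in simp)
      moreover have "((\<lambda>t. E (y + t *\<^sub>R w)) has_derivative (\<lambda>a. - K * E (y + 0 *\<^sub>R w) * (\<omega> \<bullet> (a *\<^sub>R w)))) (at 0)"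
        by (rule has_derivative_compose[OF line dE])
      ultimately have "(?\<phi>1 has_derivative (\<lambda>a. (H (y + 0 *\<^sub>R w) *v (a *\<^sub>R w)) \<bullet> w
          - (- K * E (y + 0 *\<^sub>R w) * (\<omega> \<bullet> (a *\<^sub>R w))) * (p \<bullet> w))) (at 0)"
        by (intro has_derivative_diff has_derivative_inner_left has_derivative_mult_left)
      thus ?thesis
        by (rule has_derivative_imp_has_field_derivative) (simp add: matrix_vector_mult_scaleR algebra_simps)
    qed
    have mx: "?\<phi> t \<le> ?\<phi> 0" if "\<bar>t\<bar> < \<delta>'" for t
      using ymax[of "y + t *\<^sub>R w"] inb[OF that] by (auto simp: less_imp_le)
    from local_max_second_order[OF \<delta>' d1 d2 mx] show ?thesis by simp
  qed
  have qy: "q y = E y *\<^sub>R p"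
  proof -
    have "(q y - E y *\<^sub>R p) \<bullet> w = 0" for w using so[of w] by (cases "w = 0") (auto simp: inner_diff_left)
    from this[of "q y - E y *\<^sub>R p"] show ?thesis by simp
  qed
  have E0: "E z > 0" for z by (simp add: E_def)
  have nq: "norm (q y) = E y * norm p" using qy E0[of y] by simp
  have q0: "q y \<noteq> 0" using qy E0[of y] p by simp
  have qw: "q y = norm (q y) *\<^sub>R \<omega>" unfolding nq using qy \<omega>(2) by (simp flip: scaleR_scaleR)
  have "0 \<le> w \<bullet> (drift_hessian K (q y) (H y) *v w)" for w
  proof (cases "w = 0")
    case False
    have "K * (q y \<bullet> w) / norm (q y) * (q y \<bullet> w) = K * (\<omega> \<bullet> w) * E y * (p \<bullet> w)"
    proof -
      have "(q y \<bullet> w) / norm (q y) = \<omega> \<bullet> w"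
        using q0 arg_cong[OF qw, of "\<lambda>x. x \<bullet> w"] by (simp add: field_simps)
      hence "K * (q y \<bullet> w) / norm (q y) = K * (\<omega> \<bullet> w)" by (metis times_divide_eq_right)
      thus ?thesis by (simp add: qy)
    qed
    thus ?thesis using so[OF False]
      by (simp add: drift_hessian_mult inner_diff_right inner_commute[of w])
  qed (simp add: matrix_vector_mult_0_right)
  hence psd: "nonneg_definite (drift_hessian K (q y) (H y))" by (simp add: nonneg_definite_def)
  have "(q y \<bullet> (y - e)) / norm (q y) = \<omega> \<bullet> (y - e)"
    using q0 arg_cong[OF qw, of "\<lambda>x. x \<bullet> (y - e)"] by (simp add: field_simps)
  hence "exp (K * ((q y \<bullet> (y - e)) / norm (q y))) *\<^sub>R q y = (exp (K * (\<omega> \<bullet> (y - e))) * E y) *\<^sub>R p"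
    by (simp add: qy)
  also have "exp (K * (\<omega> \<bullet> (y - e))) * E y = 1" by (simp add: E_def exp_minus)
  finally show ?thesis using that[OF yb q0 us psd] by simp
qed


text \<open>The matrix \<open>I + K q z\<^sup>T / |q|\<close>, where \<open>z\<close> is the component of \<open>x\<close> orthogonal to \<open>q\<close>. It is the factor
by which the derivative of the exponential gradient map differs from a multiple of the corrected
Hessian.\<close>

definition jacobian_factor :: "real \<Rightarrow> real^'n::finite \<Rightarrow> real^'n \<Rightarrow> real^'n^'n" where
  "jacobian_factor K q x = (\<chi> i j. (if i = j then 1 else 0) + K / norm q * (q $ i * (x - ((q \<bullet> x) / (norm q)\<^sup>2) *\<^sub>R q) $ j))"

lemma jacobian_factor_mult:
  fixes q x w :: "real^'n::finite"
  assumes "q \<noteq> 0"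
  shows "jacobian_factor K q x *v w = w + (K / norm q * (x \<bullet> w - (q \<bullet> x) * (q \<bullet> w) / (norm q)\<^sup>2)) *\<^sub>R q"
proof -
  define z where "z = x - ((q \<bullet> x) / (norm q)\<^sup>2) *\<^sub>R q"
  have zw: "z \<bullet> w = x \<bullet> w - (q \<bullet> x) * (q \<bullet> w) / (norm q)\<^sup>2" by (simp add: z_def inner_diff_left)
  have "(\<Sum>j\<in>UNIV. ((if i = j then 1 else 0) + K / norm q * (q $ i * z $ j)) * w $ j) = w $ i + K / norm q * (z \<bullet> w) * q $ i" for i
  proof -
    have "(\<Sum>j\<in>UNIV. ((if i = j then 1 else 0) + K / norm q * (q $ i * z $ j)) * w $ j)
        = (\<Sum>j\<in>UNIV. (if i = j then w $ j else 0) + (K / norm q * q $ i) * (z $ j * w $ j))"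
      by (intro sum.cong) (auto simp: algebra_simps)
    also have "\<dots> = w $ i + (K / norm q * q $ i) * (z \<bullet> w)"
      by (simp add: sum.distrib sum_distrib_left inner_vec_def)
    finally show ?thesis by simp
  qed
  thus ?thesis by (simp add: jacobian_factor_def matrix_vector_mult_def vec_eq_iff zw flip: z_def)
qed

lemma abs_det_jacobian_factor_le:
  fixes q x :: "real^'n::finite"
  assumes "q \<noteq> 0" "norm x \<le> 2" "K \<ge> 0"
  shows "\<bar>det (jacobian_factor K q x)\<bar> \<le> fact CARD('n) * (1 + 2 * K) ^ CARD('n)"
proof (rule abs_det_le_entry_bound)
  fix i j :: 'n
  define z where "z = x - ((q \<bullet> x) / (norm q)\<^sup>2) *\<^sub>R q"
  have "z \<bullet> z = x \<bullet> x - (q \<bullet> x)\<^sup>2 / (norm q)\<^sup>2"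
    using assms(1) by (simp add: z_def inner_diff_left inner_diff_right inner_commute[of x q] power2_norm_eq_inner
        power2_eq_square[of "q \<bullet> x"])
  hence "(norm z)\<^sup>2 \<le> (norm x)\<^sup>2" by (simp add: power2_norm_eq_inner[of z] power2_norm_eq_inner[of x])
  hence "norm z \<le> norm x" by (rule power2_le_imp_le) simp
  hence z: "norm z \<le> 2" using assms by linarith
  have "\<bar>K / norm q * (q $ i * z $ j)\<bar> = K * (\<bar>q $ i\<bar> / norm q) * \<bar>z $ j\<bar>"
    using assms by (simp add: abs_mult)
  also have "\<dots> \<le> K * 1 * 2"
    using assms z component_le_norm_cart[of q i] component_le_norm_cart[of z j]
    by (intro mult_mono) (auto simp: divide_le_eq_1)
  finally have "\<bar>K / norm q * (q $ i * z $ j)\<bar> \<le> 2 * K" by simp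
  moreover have "\<bar>(if i = j then 1 else 0) + t\<bar> \<le> 1 + 2 * K" if "\<bar>t\<bar> \<le> 2 * K" for t
    using that assms(3) by auto
  ultimately have "\<bar>(if i = j then 1 else 0) + K / norm q * (q $ i * z $ j)\<bar> \<le> 1 + 2 * K" by blast
  thus "\<bar>jacobian_factor K q x $ i $ j\<bar> \<le> 1 + 2 * K"
    by (simp add: jacobian_factor_def z_def)
qed

text \<open>Up to the exponential factor, the derivative of \<open>exp (K \<omega> \<bullet> (y - e)) q\<close> with \<open>\<omega> = q / |q|\<close> in the
direction \<open>w\<close> is \<open>H w + K (\<omega> \<bullet> w) q\<close> plus a multiple of \<open>q\<close> that depends only on the component of
\<open>H w\<close> orthogonal to \<open>q\<close>. The first two terms are \<open>(H + K q q\<^sup>T / |q|) w\<close>, which has the same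
orthogonal component. This is why the derivative factors through the corrected Hessian.\<close>

lemma exponential_gradient_map_derivative:
  fixes q :: "real^'n::finite \<Rightarrow> real^'n"
  assumes dq: "(q has_derivative (\<lambda>w. H *v w)) (at y)" and q0: "q y \<noteq> 0"
  shows "((\<lambda>y. exp (K * ((q y \<bullet> (y - e)) / norm (q y))) *\<^sub>R q y) has_derivative
    (\<lambda>w. (exp (K * ((q y \<bullet> (y - e)) / norm (q y))) *\<^sub>R (jacobian_factor K (q y) (y - e) ** (- drift_hessian K (q y) H))) *v w)) (at y)"
proof -
  define n where "n = norm (q y)"
  define E where "E = exp (K * ((q y \<bullet> (y - e)) / n))"
  have n0: "n \<noteq> 0" using q0 by (simp add: n_def)
  have dn: "((\<lambda>y. norm (q y)) has_derivative (\<lambda>w. (H *v w) \<bullet> sgn (q y))) (at y)"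
    by (rule has_derivative_compose[OF dq has_derivative_norm[OF q0]])
  have di: "((\<lambda>y. q y \<bullet> (y - e)) has_derivative (\<lambda>w. q y \<bullet> w + (H *v w) \<bullet> (y - e))) (at y)"
    by (rule derivative_eq_intros dq refl | simp)+
  define D where "D w = ((q y \<bullet> w + (H *v w) \<bullet> (y - e)) * n - (q y \<bullet> (y - e)) * ((H *v w) \<bullet> sgn (q y))) / (n * n)" for w
  have dd: "((\<lambda>y. (q y \<bullet> (y - e)) / norm (q y)) has_derivative D) (at y)"
    using has_derivative_divide'[OF di dn n0[unfolded n_def]] unfolding D_def[abs_def] n_def .
  have "((\<lambda>y. exp (K * ((q y \<bullet> (y - e)) / norm (q y)))) has_derivative (\<lambda>w. E * (K * D w))) (at y)"
    unfolding E_def n_def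
    using has_derivative_exp[OF has_derivative_mult_right[OF dd, of K]] by (simp add: mult_ac)
  from has_derivative_scaleR[OF this dq]
  have "((\<lambda>y. exp (K * ((q y \<bullet> (y - e)) / norm (q y))) *\<^sub>R q y) has_derivative
    (\<lambda>w. E *\<^sub>R (H *v w) + (E * (K * D w)) *\<^sub>R q y)) (at y)" by (simp add: E_def n_def)
  moreover have "E *\<^sub>R (H *v w) + (E * (K * D w)) *\<^sub>R q y
     = (E *\<^sub>R (jacobian_factor K (q y) (y - e) ** (- drift_hessian K (q y) H))) *v w" for w
  proof -
    define g where "g = H *v w + (K * (q y \<bullet> w) / n) *\<^sub>R q y"
    have "- drift_hessian K (q y) H *v w = - (drift_hessian K (q y) H *v w)"
      by (simp add: matrix_vector_mult_def vec_eq_iff sum_negf)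
    hence g: "- drift_hessian K (q y) H *v w = g" by (simp add: drift_hessian_mult g_def n_def)
    have qq: "q y \<bullet> q y = n * n" by (simp add: n_def power2_norm_eq_inner[symmetric] power2_eq_square)
    have sg: "a \<bullet> sgn (q y) = (q y \<bullet> a) / n" for a
      by (simp add: sgn_div_norm n_def inner_commute[of a] divide_inverse mult.commute)
    have "(E *\<^sub>R (jacobian_factor K (q y) (y - e) ** (- drift_hessian K (q y) H))) *v w
        = E *\<^sub>R (jacobian_factor K (q y) (y - e) *v g)"
      by (simp add: scaleR_matrix_vector_assoc[symmetric] matrix_vector_mul_assoc[symmetric] g)
    also have "\<dots> = E *\<^sub>R (g + (K / n * ((y - e) \<bullet> g - (q y \<bullet> (y - e)) * (q y \<bullet> g) / (n * n))) *\<^sub>R q y)"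
      by (simp add: jacobian_factor_mult[OF q0] n_def power2_eq_square)
    also have "(y - e) \<bullet> g - (q y \<bullet> (y - e)) * (q y \<bullet> g) / (n * n)
        = (H *v w) \<bullet> (y - e) - (q y \<bullet> (y - e)) * (q y \<bullet> (H *v w)) / (n * n)"
      using n0 by (simp add: g_def inner_add_right qq inner_commute[of "y - e"] field_simps)
    also have "g + (K / n * ((H *v w) \<bullet> (y - e) - (q y \<bullet> (y - e)) * (q y \<bullet> (H *v w)) / (n * n))) *\<^sub>R q y
        = H *v w + (K * D w) *\<^sub>R q y"
    proof -
      have "K * (q y \<bullet> w) / n + K / n * ((H *v w) \<bullet> (y - e) - (q y \<bullet> (y - e)) * (q y \<bullet> (H *v w)) / (n * n)) = K * D w"
        using n0 by (simp add: D_def sg field_simps)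
      thus ?thesis by (simp add: g_def add.assoc scaleR_add_left[symmetric])
    qed
    finally show ?thesis by (simp add: scaleR_add_right)
  qed
  ultimately show ?thesis by (simp add: E_def n_def)
qed


text \<open>The factor \<open>exp (2 K) ^ n\<close> bounds the exponential in the gradient map, the rest bounds the
determinant of \<open>jacobian_factor\<close>.\<close>

definition contact_const :: "real \<Rightarrow> nat \<Rightarrow> real" where
  "contact_const K n = exp (2 * K) ^ n * (fact n * (1 + 2 * K) ^ n)"

text \<open>Every slope \<open>p \<noteq> 0\<close> of the region is the image of a contact point under the exponential gradient
map, whose Jacobian is controlled by the determinant of the corrected Hessian. The set \<open>\<Gamma>\<close> of all
points with nonzero gradient, value above \<open>s\<close> and nonnegative definite corrected Hessian contains the
contact points and, unlike their set, is evidently Borel.\<close>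

proposition slope_region_le_psd_det_integral:
  fixes u v :: "real^'n::finite \<Rightarrow> real"
  assumes K: "K > 0" and r: "r < 1" and e: "e \<in> ball 0 r" and h: "h > 0"
    and dv: "\<And>y. y \<in> ball 0 r \<Longrightarrow> (v has_derivative (\<lambda>w. q y \<bullet> w)) (at y)"
    and dq: "\<And>y. y \<in> ball 0 r \<Longrightarrow> (q has_derivative (\<lambda>w. H y *v w)) (at y)"
    and sym: "\<And>y. y \<in> ball 0 r \<Longrightarrow> transpose (H y) = H y"
    and cH: "continuous_on (ball 0 r) H"
    and cu: "continuous_on (cball 0 r) u" and cv: "continuous_on (cball 0 r) v"
    and close: "\<And>y. y \<in> cball 0 r \<Longrightarrow> \<bar>v y - u y\<bar> \<le> h / 16"
    and bdry: "\<And>y. y \<in> sphere 0 r \<Longrightarrow> u y \<le> u e - h"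
    and s: "s \<le> u e - h"
  shows "emeasure lborel {p. norm p + p \<bullet> e \<le> exp (- 2 * K) * (h / 2)}
    \<le> (\<integral>\<^sup>+y. ennreal (contact_const K CARD('n)) * (indicator {y \<in> ball 0 r. s < u y} y
          * ennreal (psd_det (drift_hessian K (q y) (H y)))) \<partial>lborel)"
proof -
  let ?n = "CARD('n)"
  let ?P = "{p. norm p + p \<bullet> e \<le> exp (- 2 * K) * (h / 2)}"
  define psd where "psd = {A :: real^'n^'n. transpose A = A \<and> nonneg_definite A}"
  define A where "A y = drift_hessian K (q y) (H y)" for y
  define U where "U = {y \<in> ball 0 r. q y \<noteq> 0 \<and> s < u y}"
  define \<Gamma> where "\<Gamma> = U \<inter> A -` psd"
  define E where "E y = exp (K * ((q y \<bullet> (y - e)) / norm (q y)))" for y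
  define M where "M y = E y *\<^sub>R (jacobian_factor K (q y) (y - e) ** (- A y))" for y
  have cq: "continuous_on (ball 0 r) q"
    using dq by (intro continuous_at_imp_continuous_on) (blast intro: has_derivative_continuous)
  have oU: "open U"
  proof -
    have "open (ball 0 r \<inter> q -` (- {0}))" by (rule continuous_open_preimage[OF cq]) auto
    moreover have "open (ball 0 r \<inter> u -` {s<..})"
      by (rule continuous_open_preimage[OF continuous_on_subset[OF cu]]) auto
    ultimately have "open ((ball 0 r \<inter> q -` (- {0})) \<inter> (ball 0 r \<inter> u -` {s<..}))" by (rule open_Int)
    also have "(ball 0 r \<inter> q -` (- {0})) \<inter> (ball 0 r \<inter> u -` {s<..}) = U" by (auto simp: U_def)
    finally show ?thesis .
  qed
  have UB: "U \<subseteq> ball 0 r" by (auto simp: U_def)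
  have cqU: "continuous_on U q" and cHU: "continuous_on U H" using cq cH UB by (auto intro: continuous_on_subset)
  have q0: "q y \<noteq> 0" if "y \<in> U" for y using that by (simp add: U_def)
  have cA: "continuous_on U A"
    unfolding A_def drift_hessian_def by (intro continuous_intros cqU cHU) (use q0 in auto)
  have "closedin (top_of_set U) (U \<inter> A -` psd)"
    by (rule continuous_closedin_preimage[OF cA]) (simp add: psd_def closed_psd)
  then obtain T where "closed T" "U \<inter> A -` psd = U \<inter> T" by (auto simp: closedin_closed)
  hence \<Gamma>m: "\<Gamma> \<in> sets borel" unfolding \<Gamma>_def using oU by (auto intro: borel_closed)
  have \<Gamma>U: "\<Gamma> \<subseteq> U" by (auto simp: \<Gamma>_def)
  have cdet: "continuous_on U (\<lambda>y. \<bar>det (M y)\<bar>)"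
    unfolding M_def E_def jacobian_factor_def det_def matrix_matrix_mult_def
    by (intro continuous_intros cqU cA) (use q0 in \<open>auto intro!: cA\<close>)
  have meas: "(\<lambda>x. indicator \<Gamma> x * \<bar>det (M x)\<bar>) \<in> borel_measurable borel"
    using borel_measurable_continuous_on_indicator[OF \<Gamma>m continuous_on_subset[OF cdet \<Gamma>U]] by simp
  have P: "?P \<in> sets borel" by (intro borel_closed closed_Collect_le continuous_intros)
  hence P0: "?P - {0} \<in> sets borel" by auto
  \<comment> \<open>the gradient map is not differentiable where \<open>q\<close> vanishes; such points have image \<open>0\<close>\<close>
  have "emeasure lborel ?P = emeasure lborel (?P - {0})"
  proof (rule emeasure_eq_AE)
    have "AE x in lborel. x \<noteq> (0::real^'n)" by (rule AE_lborel_singleton)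
    thus "AE x in lborel. x \<in> ?P \<longleftrightarrow> x \<in> ?P - {0}" by (rule AE_mp) auto
  qed (use P P0 in auto)
  also have "\<dots> \<le> (\<integral>\<^sup>+x. ennreal (indicator \<Gamma> x * \<bar>det (M x)\<bar>) \<partial>lborel)"
  proof (rule emeasure_le_nn_integral_jacobian[OF \<Gamma>m P0 _ _ meas])
    show "?P - {0} \<subseteq> (\<lambda>y. E y *\<^sub>R q y) ` \<Gamma>"
    proof
      fix p assume p: "p \<in> ?P - {0}"
      hence p': "p \<noteq> 0" "norm p + p \<bullet> e \<le> exp (- 2 * K) * (h / 2)" by auto
      obtain y where y: "y \<in> ball 0 r" "q y \<noteq> 0" "u y > s" "nonneg_definite (A y)" "E y *\<^sub>R q y = p"
        unfolding A_def E_def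
        by (rule contact_point_exists[OF K r e h dv dq cv close bdry s p'])
      have "transpose (A y) = A y"
        using sym[OF y(1)] by (simp add: A_def drift_hessian_def transpose_def vec_eq_iff mult.commute)
      hence "y \<in> \<Gamma>" using y by (auto simp: \<Gamma>_def U_def psd_def)
      thus "p \<in> (\<lambda>y. E y *\<^sub>R q y) ` \<Gamma>" using y(5) by blast
    qed
    fix y assume "y \<in> \<Gamma>"
    hence "y \<in> ball 0 r" "q y \<noteq> 0" using \<Gamma>U UB q0 by auto
    from exponential_gradient_map_derivative[OF dq[OF this(1)] this(2)]
    show "((\<lambda>y. E y *\<^sub>R q y) has_derivative (*v) (M y)) (at y)" by (simp add: E_def M_def A_def)
  qed
  also have "\<dots> \<le> (\<integral>\<^sup>+y. ennreal (contact_const K ?n) * (indicator {y \<in> ball 0 r. s < u y} y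
          * ennreal (psd_det (A y))) \<partial>lborel)"
  proof (rule nn_integral_mono)
    fix y :: "real^'n"
    show "ennreal (indicator \<Gamma> y * \<bar>det (M y)\<bar>) \<le> ennreal (contact_const K ?n) * (indicator {y \<in> ball 0 r. s < u y} y
          * ennreal (psd_det (A y)))"
    proof (cases "y \<in> \<Gamma>")
      case True
      hence y: "y \<in> ball 0 r" "q y \<noteq> 0" "s < u y" "A y \<in> psd" by (auto simp: \<Gamma>_def U_def)
      have d: "psd_det (A y) = det (A y)" "det (A y) \<ge> 0"
        using y(4) psd_det_nonneg[of "A y"] by (auto simp: psd_def psd_det_def)
      have n2: "norm (y - e) \<le> 2" using norm_triangle_ineq4[of y e] y(1) e r by auto
      have "\<bar>q y \<bullet> (y - e)\<bar> \<le> norm (q y) * 2"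
        using Cauchy_Schwarz_ineq2[of "q y" "y - e"] mult_left_mono[OF n2, of "norm (q y)"] by auto
      hence "(q y \<bullet> (y - e)) / norm (q y) \<le> 2" using y(2) by (auto simp: divide_le_eq)
      hence "K * ((q y \<bullet> (y - e)) / norm (q y)) \<le> K * 2" using K by (intro mult_left_mono) auto
      hence "E y \<le> exp (2 * K)" by (simp add: E_def mult.commute)
      hence E: "E y ^ ?n \<le> exp (2 * K) ^ ?n" by (intro power_mono) (auto simp: E_def)
      have dneg: "\<bar>det (- A y)\<bar> = det (A y)"
      proof -
        have "- A y = (\<chi> i. (- 1) *s A y $ i)" by (simp add: vec_eq_iff)
        hence "det (- A y) = (- 1) ^ ?n * det (A y)"
          using det_rows_mul[of "\<lambda>i. - 1" "\<lambda>i. A y $ i"] by simp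
        thus ?thesis using d by (simp add: abs_mult power_abs)
      qed
      have "M y = (\<chi> i. E y *s (jacobian_factor K (q y) (y - e) ** (- A y)) $ i)"
        by (simp add: M_def vec_eq_iff)
      hence "det (M y) = E y ^ ?n * (det (jacobian_factor K (q y) (y - e)) * det (- A y))"
        using det_rows_mul[of "\<lambda>i. E y" "\<lambda>i. (jacobian_factor K (q y) (y - e) ** (- A y)) $ i"]
        by (simp add: det_mul)
      hence "\<bar>det (M y)\<bar> = E y ^ ?n * (\<bar>det (jacobian_factor K (q y) (y - e))\<bar> * det (A y))"
        by (simp add: abs_mult dneg E_def)
      also have "\<dots> \<le> exp (2 * K) ^ ?n * ((fact ?n * (1 + 2 * K) ^ ?n) * det (A y))"
        using abs_det_jacobian_factor_le[OF y(2) n2, of K] K d E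
        by (intro mult_mono mult_right_mono) auto
      finally have "\<bar>det (M y)\<bar> \<le> contact_const K ?n * psd_det (A y)" by (simp add: contact_const_def d)
      hence "ennreal \<bar>det (M y)\<bar> \<le> ennreal (contact_const K ?n * psd_det (A y))" by (rule ennreal_leI)
      also have "\<dots> = ennreal (contact_const K ?n) * ennreal (psd_det (A y))"
        using K by (intro ennreal_mult psd_det_nonneg) (simp add: contact_const_def)
      finally show ?thesis using True y by simp
    qed simp
  qed
  finally show ?thesis unfolding A_def .
qed

section \<open>Mollifiers\<close>

text \<open>The functions \<open>P(1/t) exp(-1/t)\<close>, continued by \<open>0\<close> to the left, form a class that is closed under
differentiation; \<open>flat_exp_step\<close> gives the polynomial of the derivative.\<close>

definition flat_exp :: "real poly \<Rightarrow> real \<Rightarrow> real" where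
  "flat_exp P t = (if t > 0 then poly P (1 / t) * exp (- (1 / t)) else 0)"

definition flat_exp_step :: "real poly \<Rightarrow> real poly" where
  "flat_exp_step P = [:0, 0, 1:] * (P - pderiv P)"

lemma poly_times_exp_decay: "((\<lambda>s::real. poly P s * exp (- s)) \<longlongrightarrow> 0) at_top"
proof -
  have "((\<lambda>s. \<Sum>i\<le>degree P. coeff P i * (s ^ i / exp s)) \<longlongrightarrow> (\<Sum>i\<le>degree P. coeff P i * 0)) at_top"
    by (intro tendsto_sum tendsto_mult tendsto_const tendsto_power_div_exp_0)
  moreover have "poly P s * exp (- s) = (\<Sum>i\<le>degree P. coeff P i * (s ^ i / exp s))" for s
    by (simp add: poly_altdef sum_distrib_right exp_minus divide_inverse mult.assoc)
  ultimately show ?thesis by simp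
qed

lemma flat_exp_derivative:
  "(flat_exp P has_real_derivative flat_exp (flat_exp_step P) t) (at t)"
proof -
  consider "t > 0" | "t < 0" | "t = 0" by linarith
  thus ?thesis
  proof cases
    case 1
    have "((\<lambda>t. poly P (1 / t) * exp (- (1 / t))) has_real_derivative flat_exp (flat_exp_step P) t) (at t)"
      using 1 by (auto intro!: derivative_eq_intros
          simp: flat_exp_def flat_exp_step_def power2_eq_square field_simps)
    moreover have "\<forall>\<^sub>F s in nhds t. flat_exp P s = poly P (1 / s) * exp (- (1 / s))"
      using eventually_nhds_in_open[of "{0<..}" t] 1 by (auto elim!: eventually_mono simp: flat_exp_def)
    ultimately show ?thesis by (subst DERIV_cong_ev[OF refl _ refl])
  next
    case 2
    have "\<forall>\<^sub>F s in nhds t. flat_exp P s = 0"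
      using eventually_nhds_in_open[of "{..<0}" t] 2 by (auto elim!: eventually_mono simp: flat_exp_def)
    moreover have "((\<lambda>s. 0) has_real_derivative flat_exp (flat_exp_step P) t) (at t)"
      using 2 by (simp add: flat_exp_def)
    ultimately show ?thesis by (subst DERIV_cong_ev[OF refl _ refl])
  next
    case 3
    have "((\<lambda>h. flat_exp P h / h) \<longlongrightarrow> 0) (at_right 0)"
    proof -
      have "((\<lambda>h. poly (pCons 0 P) (inverse h) * exp (- inverse h)) \<longlongrightarrow> 0) (at_right 0)"
        by (rule filterlim_compose[OF poly_times_exp_decay filterlim_inverse_at_top_right])
      moreover have "\<forall>\<^sub>F h in at_right 0. poly (pCons 0 P) (inverse h) * exp (- inverse h) = flat_exp P h / h"
        unfolding eventually_at_right_field
        by (intro exI[of _ 1]) (auto simp: flat_exp_def divide_inverse)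
      ultimately show ?thesis by (rule Lim_transform_eventually)
    qed
    moreover have "((\<lambda>h. flat_exp P h / h) \<longlongrightarrow> 0) (at_left 0)"
    proof (rule Lim_transform_eventually[OF tendsto_const])
      show "\<forall>\<^sub>F h in at_left 0. 0 = flat_exp P h / h"
        unfolding eventually_at_left_field by (intro exI[of _ "-1"]) (auto simp: flat_exp_def)
    qed
    ultimately have "((\<lambda>h. flat_exp P h / h) \<longlongrightarrow> 0) (at 0)"
      by (rule filterlim_split_at[rotated])
    thus ?thesis using 3 by (simp add: DERIV_def flat_exp_def)
  qed
qed

text \<open>Closed under differentiation by the product rule. All members vanish outside the interval from \<open>-c\<close> to
\<open>c\<close>, because one of the two factors does.\<close>

inductive_set bump_span :: "real \<Rightarrow> (real \<Rightarrow> real) set" for c where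
  base: "(\<lambda>t. a * (flat_exp P (c + t) * flat_exp Q (c - t))) \<in> bump_span c"
| add: "f \<in> bump_span c \<Longrightarrow> g \<in> bump_span c \<Longrightarrow> (\<lambda>t. f t + g t) \<in> bump_span c"

lemma bump_span_derivative:
  assumes "f \<in> bump_span c"
  shows "\<exists>g\<in>bump_span c. \<forall>t. (f has_real_derivative g t) (at t)"
  using assms
proof induction
  case (base a P Q)
  let ?g = "\<lambda>t. a * (flat_exp (flat_exp_step P) (c + t) * flat_exp Q (c - t))
     + (- a) * (flat_exp P (c + t) * flat_exp (flat_exp_step Q) (c - t))"
  have "?g \<in> bump_span c" by (intro bump_span.intros)
  moreover have "((\<lambda>t. a * (flat_exp P (c + t) * flat_exp Q (c - t))) has_real_derivative ?g t) (at t)" for t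
    by (rule derivative_eq_intros DERIV_chain2[OF flat_exp_derivative] refl | simp add: algebra_simps)+
  ultimately show ?case by (intro bexI[of _ ?g] allI)
next
  case (add f g)
  then obtain f' g' where fg: "f' \<in> bump_span c" "\<And>t. (f has_real_derivative f' t) (at t)"
    "g' \<in> bump_span c" "\<And>t. (g has_real_derivative g' t) (at t)" by blast
  have "((\<lambda>t. f t + g t) has_real_derivative f' t + g' t) (at t)" for t
    by (intro DERIV_add fg)
  thus ?case using bump_span.add[OF fg(1,3)] by (intro bexI[of _ "\<lambda>t. f' t + g' t"] allI)
qed

lemma smooth_bump_real:
  fixes c :: real
  assumes c: "c > 0"
  obtains F :: "nat \<Rightarrow> real \<Rightarrow> real" where "\<And>k t. (F k has_real_derivative F (Suc k) t) (at t)"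
    "\<And>t. F 0 t \<ge> 0" "\<And>t. \<bar>t\<bar> \<ge> c \<Longrightarrow> F 0 t = 0" "F 0 0 > 0"
proof -
  define D where "D f = (SOME g. g \<in> bump_span c \<and> (\<forall>t. (f has_real_derivative g t) (at t)))" for f
  have D: "D f \<in> bump_span c" "(f has_real_derivative D f t) (at t)" if "f \<in> bump_span c" for f t
    using someI_ex[of "\<lambda>g. g \<in> bump_span c \<and> (\<forall>t. (f has_real_derivative g t) (at t))"]
      bump_span_derivative[OF that] unfolding D_def by blast+
  define G where "G t = 1 * (flat_exp 1 (c + t) * flat_exp 1 (c - t))" for t
  have G: "G \<in> bump_span c" unfolding G_def by (rule bump_span.base)
  have Fk: "(D ^^ k) G \<in> bump_span c" for k by (induction k) (auto simp: G intro: D)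
  have deriv: "((D ^^ k) G has_real_derivative (D ^^ Suc k) G t) (at t)" for k t
    using D(2)[OF Fk] by simp
  show ?thesis
  proof (rule that[of "\<lambda>k. (D ^^ k) G"])
    show "((D ^^ 0) G) t \<ge> 0" for t by (simp add: G_def flat_exp_def)
    show "((D ^^ 0) G) t = 0" if "\<bar>t\<bar> \<ge> c" for t using that by (auto simp: G_def flat_exp_def)
    show "((D ^^ 0) G) 0 > 0" using c by (simp add: G_def flat_exp_def)
  qed (rule deriv)
qed

lemma partial_derivI:
  assumes "(f has_derivative D) (at x)"
  shows "partial_deriv i f x = D (axis i 1)"
  using frechet_derivative_at[OF assms] by (simp add: partial_deriv_def)

text \<open>In a product of functions of single coordinates a partial derivative only raises one index. This
gives smoothness by induction and makes mixed partial derivatives commute.\<close>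

lemma product_bump_family:
  fixes F :: "nat \<Rightarrow> real \<Rightarrow> real" and a :: real
  assumes F: "\<And>k t. (F k has_real_derivative F (Suc k) t) (at t)"
  defines "B \<equiv> \<lambda>(m :: 'n::finite \<Rightarrow> nat) (x :: real^'n). a * (\<Prod>i\<in>UNIV. F (m i) (x $ i))"
  shows "B m differentiable (at x)" "partial_deriv j (B m) = B (m(j := Suc (m j)))" "Ck k (B m)"
proof -
  have d: "(B m has_derivative (\<lambda>v. a * (\<Sum>i\<in>UNIV. F (Suc (m i)) (x $ i) * v $ i * (\<Prod>l\<in>UNIV - {i}. F (m l) (x $ l))))) (at x)" for m x
    unfolding B_def
  proof (intro has_derivative_mult_right has_derivative_prod)
    fix i :: 'n
    have "((\<lambda>x :: real^'n. x $ i) has_derivative (\<lambda>v. v $ i)) (at x)"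
      by (rule bounded_linear_imp_has_derivative) (rule bounded_linear_vec_nth)
    from has_derivative_compose[OF this F[unfolded has_field_derivative_def]]
    show "((\<lambda>x. F (m i) (x $ i)) has_derivative (\<lambda>v. F (Suc (m i)) (x $ i) * v $ i)) (at x)" .
  qed
  show diff: "B m differentiable (at x)" for m x using d unfolding differentiable_def by blast
  show pd: "partial_deriv j (B m) = B (m(j := Suc (m j)))" for j m
  proof
    fix x
    have "partial_deriv j (B m) x = a * (\<Sum>i\<in>UNIV. if i = j then F (Suc (m i)) (x $ i) * (\<Prod>l\<in>UNIV - {i}. F (m l) (x $ l)) else 0)"
      unfolding partial_derivI[OF d]
      by (intro arg_cong[of _ _ "\<lambda>z. a * z"] sum.cong) (auto simp: axis_def)
    also have "\<dots> = a * (F (Suc (m j)) (x $ j) * (\<Prod>l\<in>UNIV - {j}. F (m l) (x $ l)))" by simp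
    also have "\<dots> = B (m(j := Suc (m j))) x"
    proof -
      have "(\<Prod>i\<in>UNIV. F ((m(j := Suc (m j))) i) (x $ i))
          = F (Suc (m j)) (x $ j) * (\<Prod>i\<in>UNIV - {j}. F ((m(j := Suc (m j))) i) (x $ i))"
        by (subst prod.remove[of UNIV j]) auto
      also have "(\<Prod>i\<in>UNIV - {j}. F ((m(j := Suc (m j))) i) (x $ i)) = (\<Prod>l\<in>UNIV - {j}. F (m l) (x $ l))"
        by (intro prod.cong) auto
      finally show ?thesis by (simp add: B_def)
    qed
    finally show "partial_deriv j (B m) x = B (m(j := Suc (m j))) x" .
  qed
  show "Ck k (B m)"
  proof (induction k arbitrary: m)
    case 0
    have "continuous_on UNIV (B m)"
      by (intro continuous_at_imp_continuous_on ballI) (blast intro: has_derivative_continuous d)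
    thus ?case by simp
  next
    case (Suc k)
    thus ?case by (simp add: pd diff)
  qed
qed

text \<open>Commuting mixed derivatives are recorded because they are the source of the symmetry of the Hessians
of mollifications.\<close>

definition mollifier :: "real \<Rightarrow> (real^'n::finite \<Rightarrow> real) \<Rightarrow> bool" where
  "mollifier \<delta> \<eta> \<longleftrightarrow> \<eta> \<in> test_functions UNIV \<and> (\<forall>x. 0 \<le> \<eta> x) \<and> (\<forall>x. norm x \<ge> \<delta> \<longrightarrow> \<eta> x = 0) \<and>
     (\<integral>\<^sup>+x. ennreal (\<eta> x) \<partial>lborel) = 1 \<and>
     (\<forall>i j. partial_deriv i (partial_deriv j \<eta>) = partial_deriv j (partial_deriv i \<eta>))"

lemma mollifier_exists:
  assumes \<delta>: "\<delta> > 0"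
  shows "\<exists>\<eta> :: real^'n::finite \<Rightarrow> real. mollifier \<delta> \<eta>"
proof -
  define c where "c = \<delta> / CARD('n)"
  have c: "c > 0" using \<delta> by (simp add: c_def)
  obtain F :: "nat \<Rightarrow> real \<Rightarrow> real" where F: "\<And>k t. (F k has_real_derivative F (Suc k) t) (at t)"
    "\<And>t. F 0 t \<ge> 0" "\<And>t. \<bar>t\<bar> \<ge> c \<Longrightarrow> F 0 t = 0" "F 0 0 > 0"
    using smooth_bump_real[OF c] by metis
  define B where "B a m x = a * (\<Prod>i\<in>UNIV. F (m i) (x $ i))" for a and m :: "'n \<Rightarrow> nat" and x :: "real^'n"
  note B = product_bump_family[of F, OF F(1), where ?'n = 'n, folded B_def]
  define \<theta> where "\<theta> = B 1 (\<lambda>_. 0)"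
  have \<theta>0: "\<theta> x \<ge> 0" for x by (auto simp: \<theta>_def B_def intro!: prod_nonneg F)
  have \<theta>supp: "\<theta> x = 0" if "norm x \<ge> \<delta>" for x
  proof -
    have "\<exists>i. \<bar>x $ i\<bar> \<ge> c"
    proof (rule ccontr)
      assume "\<nexists>i. \<bar>x $ i\<bar> \<ge> c"
      hence "(\<Sum>i\<in>UNIV. \<bar>x $ i\<bar>) < (\<Sum>i\<in>(UNIV::'n set). c)" by (intro sum_strict_mono) (auto simp: not_le)
      hence "norm x < \<delta>" using norm_le_l1_cart[of x] by (simp add: c_def)
      thus False using that by simp
    qed
    then obtain i where "\<bar>x $ i\<bar> \<ge> c" ..
    hence "F 0 (x $ i) = 0" by (rule F(3))
    thus ?thesis by (auto simp: \<theta>_def B_def intro!: prod_zero)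
  qed
  have cont: "continuous_on UNIV \<theta>" using B(3)[of 0 1 "\<lambda>_. 0"] by (simp add: \<theta>_def)
  have supp_ball: "{x. \<theta> x \<noteq> 0} \<subseteq> cball 0 \<delta>" using \<theta>supp by (force simp: not_le[symmetric])
  have [measurable]: "\<theta> \<in> borel_measurable borel" using cont by (rule borel_measurable_continuous_onI)
  define I where "I = (\<integral>\<^sup>+x. ennreal (\<theta> x) \<partial>lborel)"
  have "\<exists>M. \<forall>x\<in>cball 0 \<delta>. \<theta> x \<le> M"
    using compact_continuous_image[OF continuous_on_subset[OF cont subset_UNIV] compact_cball, of 0 \<delta>]
    by (meson bounded_imp_bdd_above bdd_above.E compact_imp_bounded imageI)
  then obtain M where M: "\<And>x. x \<in> cball 0 \<delta> \<Longrightarrow> \<theta> x \<le> M" by blast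
  have "I \<le> (\<integral>\<^sup>+x. ennreal M * indicator (cball (0::real^'n) \<delta>) x \<partial>lborel)"
    unfolding I_def
  proof (rule nn_integral_mono)
    fix x :: "real^'n"
    show "ennreal (\<theta> x) \<le> ennreal M * indicator (cball 0 \<delta>) x"
      using M[of x] \<theta>supp[of x] by (cases "x \<in> cball 0 \<delta>") (auto intro: ennreal_leI)
  qed
  also have "\<dots> < \<infinity>" using emeasure_bounded_finite[of "cball (0::real^'n) \<delta>"]
    by (simp add: nn_integral_cmult_indicator ennreal_mult_less_top)
  finally have Ifin: "I < \<infinity>" .
  have "I \<noteq> 0"
  proof
    assume "I = 0"
    hence "AE x in lborel. \<theta> x = 0" using \<theta>0 unfolding I_def by (subst (asm) nn_integral_0_iff_AE) (auto simp: ennreal_eq_0_iff antisym)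
    moreover have "open (\<theta> -` {0<..})" using cont by (intro open_vimage) auto
    moreover have "\<theta> 0 > 0" using F(4) by (simp add: \<theta>_def B_def)
    moreover have "{x. \<not> \<theta> x = 0} = \<theta> -` {0<..}" using \<theta>0 by (auto simp: less_le)
    ultimately have "\<theta> -` {0<..} \<in> null_sets lborel"
      by (subst (asm) AE_iff_null) (auto simp: space_borel)
    moreover have "emeasure lborel (\<theta> -` {0<..}) \<noteq> 0"
    proof
      assume z: "emeasure lborel (\<theta> -` {0<..}) = 0"
      have "negligible (\<theta> -` {0<..})" using calculation by (simp add: negligible_iff_null_sets null_sets_completionI)
      with \<open>open (\<theta> -` {0<..})\<close> \<open>\<theta> 0 > 0\<close> show False
        using open_not_negligible[of "\<theta> -` {0<..}"] by auto
    qed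
    ultimately show False by auto
  qed
  define a where "a = 1 / enn2real I"
  have Ir: "enn2real I > 0" using Ifin \<open>I \<noteq> 0\<close> by (simp add: enn2real_positive_iff zero_less_iff_neq_zero)
  hence a: "a > 0" by (simp add: a_def)
  define \<eta> where "\<eta> = B a (\<lambda>_. 0)"
  have \<eta>: "\<eta> x = a * \<theta> x" for x by (simp add: \<eta>_def \<theta>_def B_def)
  have sub: "closure {x. \<eta> x \<noteq> 0} \<subseteq> cball 0 \<delta>"
    using supp_ball a by (intro closure_minimal) (auto simp: \<eta>)
  have "compact (closure {x. \<eta> x \<noteq> 0})"
    using sub by (meson bounded_cball bounded_subset closed_closure compact_eq_bounded_closed)
  hence "\<eta> \<in> test_functions UNIV" using B(3) by (auto simp: test_functions_def \<eta>_def)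
  moreover have "(\<integral>\<^sup>+x. ennreal (\<eta> x) \<partial>lborel) = 1"
  proof -
    have "(\<integral>\<^sup>+x. ennreal (\<eta> x) \<partial>lborel) = ennreal a * I"
      using a \<theta>0 unfolding \<eta> I_def by (subst nn_integral_cmult[symmetric]) (auto simp: ennreal_mult)
    also have "I = ennreal (enn2real I)" using Ifin by simp
    also have "ennreal a * ennreal (enn2real I) = 1"
      using a Ir by (subst ennreal_mult[symmetric]) (auto simp: a_def)
    finally show ?thesis .
  qed
  moreover have "partial_deriv i (partial_deriv j \<eta>) = partial_deriv j (partial_deriv i \<eta>)" for i j
    unfolding \<eta>_def B(2) by (cases "i = j") (auto simp: fun_upd_twist)
  ultimately have "mollifier \<delta> \<eta>" using \<theta>0 \<theta>supp a by (auto simp: mollifier_def \<eta>)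
  thus ?thesis by blast
qed

lemma partial_deriv_zero_outside:
  fixes \<eta> :: "real^'n::finite \<Rightarrow> real"
  assumes z: "\<And>z. norm z > R \<Longrightarrow> \<eta> z = 0" and x: "norm x > R"
  shows "partial_deriv i \<eta> x = 0"
proof -
  have "\<forall>\<^sub>F z in nhds x. \<eta> z = 0"
    using eventually_nhds_in_open[OF open_Compl[OF closed_cball[of 0 R]], of x] x z
    by (auto elim!: eventually_mono simp: not_le)
  hence "(\<eta> has_derivative (\<lambda>_. 0)) (at x)"
    using has_derivative_transform_eventually[of "\<lambda>_. 0" "\<lambda>_. 0" x UNIV \<eta>]
    by (auto simp: eventually_nhds_conv_at elim: eventually_mono)
  thus ?thesis by (simp add: partial_derivI)
qed

section \<open>Convolution with test functions\<close>

lemma test_function_props: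
  assumes "\<eta> \<in> test_functions UNIV"
  shows test_function_continuous: "continuous_on UNIV \<eta>"
    and test_function_has_derivative: "(\<eta> has_derivative (\<lambda>v. \<Sum>i\<in>UNIV. v $ i * partial_deriv i \<eta> x)) (at x)"
    and test_function_support: "\<exists>R. \<forall>x. norm x > R \<longrightarrow> \<eta> x = 0"
    and test_function_partial_deriv: "partial_deriv i \<eta> \<in> test_functions UNIV"
proof -
  have ck: "\<And>k. Ck k \<eta>" and cpt: "compact (closure {x. \<eta> x \<noteq> 0})" using assms by (auto simp: test_functions_def)
  show "continuous_on UNIV \<eta>" using ck[of 0] by simp
  have "\<eta> differentiable (at x)" using ck[of 1] by simp
  hence d: "(\<eta> has_derivative frechet_derivative \<eta> (at x)) (at x)" by (simp add: frechet_derivative_works)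
  have lin: "linear (frechet_derivative \<eta> (at x))" using d has_derivative_linear by blast
  have "frechet_derivative \<eta> (at x) v = (\<Sum>i\<in>UNIV. v $ i * partial_deriv i \<eta> x)" for v
  proof -
    have "frechet_derivative \<eta> (at x) v = frechet_derivative \<eta> (at x) (\<Sum>i\<in>UNIV. v $ i *\<^sub>R axis i 1)"
      using basis_expansion[of v] by (simp add: scalar_mult_eq_scaleR)
    also have "\<dots> = (\<Sum>i\<in>UNIV. v $ i * partial_deriv i \<eta> x)"
      by (simp add: linear_sum[OF lin] linear_cmul[OF lin] partial_deriv_def)
    finally show ?thesis .
  qed
  thus "(\<eta> has_derivative (\<lambda>v. \<Sum>i\<in>UNIV. v $ i * partial_deriv i \<eta> x)) (at x)" using d by (metis (no_types, lifting) ext)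
  obtain R where R: "closure {x. \<eta> x \<noteq> 0} \<subseteq> cball 0 R"
    using compact_imp_bounded[OF cpt] unfolding bounded_iff by (meson mem_cball_0 subsetI)
  have sR: "\<eta> x = 0" if "norm x > R" for x
    using R closure_subset[of "{x. \<eta> x \<noteq> 0}"] that by force
  thus "\<exists>R. \<forall>x. norm x > R \<longrightarrow> \<eta> x = 0" by blast
  have "partial_deriv i \<eta> x = 0" if "norm x > R" for x
    by (rule partial_deriv_zero_outside[OF sR that])
  hence sub: "closure {x. partial_deriv i \<eta> x \<noteq> 0} \<subseteq> cball 0 R"
    by (intro closure_minimal) (auto simp: not_less[symmetric])
  hence "compact (closure {x. partial_deriv i \<eta> x \<noteq> 0})"
    by (meson bounded_cball bounded_subset closed_closure compact_eq_bounded_closed)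
  moreover have "Ck k (partial_deriv i \<eta>)" for k using ck[of "Suc k"] by simp
  ultimately show "partial_deriv i \<eta> \<in> test_functions UNIV"
    by (simp add: test_functions_def)
qed

text \<open>Close points either both lie in a slightly larger compact ball or both lie outside the support.\<close>

lemma compact_support_uniformly_continuous:
  fixes g :: "'a::euclidean_space \<Rightarrow> real"
  assumes c: "continuous_on UNIV g" and s: "\<And>x. norm x > R \<Longrightarrow> g x = 0" and e: "\<epsilon> > 0"
  shows "\<exists>\<delta>>0. \<forall>x y. norm (x - y) < \<delta> \<longrightarrow> \<bar>g x - g y\<bar> < \<epsilon>"
proof -
  have "uniformly_continuous_on (cball 0 (R + 1)) g"
    by (intro compact_uniformly_continuous continuous_on_subset[OF c]) auto
  then obtain d where d: "d > 0" "\<And>x y. x \<in> cball 0 (R + 1) \<Longrightarrow> y \<in> cball 0 (R + 1) \<Longrightarrow> dist x y < d \<Longrightarrow> dist (g x) (g y) < \<epsilon>"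
    using e by (fastforce simp: uniformly_continuous_on_def)
  have "\<bar>g x - g y\<bar> < \<epsilon>" if xy: "norm (x - y) < min d 1" for x y
  proof (cases "norm x \<le> R \<or> norm y \<le> R")
    case True
    hence "norm x \<le> R + 1" "norm y \<le> R + 1"
      using xy norm_triangle_ineq3[of x y] by (auto simp: abs_le_iff)
    thus ?thesis using d(2)[of x y] xy by (auto simp: dist_norm)
  next
    case False
    thus ?thesis using s e by simp
  qed
  thus ?thesis using d(1) by (intro exI[of _ "min d 1"]) auto
qed

lemma compact_support_bounded:
  fixes g :: "'a::euclidean_space \<Rightarrow> real"
  assumes c: "continuous_on UNIV g" and s: "\<And>x. norm x > R \<Longrightarrow> g x = 0"
  shows "\<exists>M\<ge>0. \<forall>x. \<bar>g x\<bar> \<le> M"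
proof -
  have "bounded (g ` cball 0 R)"
    by (intro compact_imp_bounded compact_continuous_image continuous_on_subset[OF c]) auto
  then obtain M where M: "\<forall>x\<in>cball 0 R. \<bar>g x\<bar> \<le> M" by (auto simp: bounded_iff)
  have "\<bar>g x\<bar> \<le> max M 0" for x using M s[of x] by (cases "norm x \<le> R") (auto simp: le_max_iff_disj)
  thus ?thesis by (intro exI[of _ "max M 0"]) auto
qed

lemma test_function_bounded:
  assumes "\<eta> \<in> test_functions UNIV"
  shows "\<exists>M\<ge>0. \<forall>x. \<bar>\<eta> x\<bar> \<le> M"
proof -
  obtain R where "\<forall>x. norm x > R \<longrightarrow> \<eta> x = 0" using test_function_support[OF assms] by blast
  thus ?thesis by (intro compact_support_bounded[OF test_function_continuous[OF assms], of R]) auto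
qed

definition conv :: "(real^'n::finite \<Rightarrow> real) \<Rightarrow> (real^'n \<Rightarrow> real) \<Rightarrow> real^'n \<Rightarrow> real" where
  "conv f \<eta> x = (\<integral>y. f y * \<eta> (x - y) \<partial>lborel)"

lemma conv_integrable:
  assumes f: "integrable lborel f" and \<eta>: "\<eta> \<in> test_functions UNIV"
  shows "integrable lborel (\<lambda>y. f y * \<eta> (x - y))"
proof -
  obtain M where M: "M \<ge> 0" "\<And>x. \<bar>\<eta> x\<bar> \<le> M" using test_function_bounded[OF \<eta>] by blast
  have [measurable]: "\<eta> \<in> borel_measurable borel"
    by (rule borel_measurable_continuous_onI[OF test_function_continuous[OF \<eta>]])
  have [measurable]: "f \<in> borel_measurable borel" using f by (simp add: integrable_iff_bounded)
  show ?thesis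
  proof (rule Bochner_Integration.integrable_bound)
    show "integrable lborel (\<lambda>y. M * f y)" using f by simp
    show "AE y in lborel. norm (f y * \<eta> (x - y)) \<le> norm (M * f y)"
      using M by (intro AE_I2) (auto simp: abs_mult mult.commute[of M] intro!: mult_left_mono)
  qed measurable
qed

lemma test_function_uniform_derivative:
  fixes \<eta> :: "real^'n::finite \<Rightarrow> real"
  assumes \<eta>: "\<eta> \<in> test_functions UNIV" and e: "\<epsilon> > 0"
  shows "\<exists>\<delta>>0. \<forall>z v. norm v < \<delta> \<longrightarrow>
    \<bar>\<eta> (z + v) - \<eta> z - (\<Sum>i\<in>UNIV. v $ i * partial_deriv i \<eta> z)\<bar> \<le> \<epsilon> * norm v"
proof -
  define \<epsilon>' where "\<epsilon>' = \<epsilon> / CARD('n)"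
  have e': "\<epsilon>' > 0" using e by (simp add: \<epsilon>'_def)
  have "\<forall>i. \<exists>\<delta>>0. \<forall>x y. norm (x - y) < \<delta> \<longrightarrow> \<bar>partial_deriv i \<eta> x - partial_deriv i \<eta> y\<bar> < \<epsilon>'"
  proof
    fix i
    note t = test_function_partial_deriv[OF \<eta>, of i]
    obtain R where "\<forall>x. norm x > R \<longrightarrow> partial_deriv i \<eta> x = 0" using test_function_support[OF t] by blast
    thus "\<exists>\<delta>>0. \<forall>x y. norm (x - y) < \<delta> \<longrightarrow> \<bar>partial_deriv i \<eta> x - partial_deriv i \<eta> y\<bar> < \<epsilon>'"
      by (intro compact_support_uniformly_continuous[OF test_function_continuous[OF t] _ e', of R]) auto
  qed
  then obtain \<delta> where \<delta>: "\<And>i. \<delta> i > 0"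
    "\<And>i x y. norm (x - y) < \<delta> i \<Longrightarrow> \<bar>partial_deriv i \<eta> x - partial_deriv i \<eta> y\<bar> < \<epsilon>'" by metis
  define d where "d = Min (range \<delta>)"
  have d: "d > 0" "\<And>i. d \<le> \<delta> i" using \<delta>(1) by (auto simp: d_def)
  have "\<bar>\<eta> (z + v) - \<eta> z - (\<Sum>i\<in>UNIV. v $ i * partial_deriv i \<eta> z)\<bar> \<le> \<epsilon> * norm v" if v: "norm v < d" for z v
  proof -
    have "((\<lambda>t. \<eta> (z + t *\<^sub>R v)) has_real_derivative (\<Sum>i\<in>UNIV. v $ i * partial_deriv i \<eta> (z + t *\<^sub>R v))) (at t)" for t
    proof -
      have "((\<lambda>t. z + t *\<^sub>R v) has_derivative (\<lambda>t. t *\<^sub>R v)) (at t)" by (auto intro!: derivative_eq_intros)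
      from has_derivative_compose[OF this test_function_has_derivative[OF \<eta>]]
      show ?thesis
        by (rule has_derivative_imp_has_field_derivative) (simp add: sum_distrib_left mult_ac)
    qed
    from MVT2[of 0 1 "\<lambda>t. \<eta> (z + t *\<^sub>R v)", OF _ this] obtain \<xi> :: real where \<xi>: "0 < \<xi>" "\<xi> < 1"
      "\<eta> (z + v) - \<eta> z = (\<Sum>i\<in>UNIV. v $ i * partial_deriv i \<eta> (z + \<xi> *\<^sub>R v))" by auto
    have "\<bar>\<eta> (z + v) - \<eta> z - (\<Sum>i\<in>UNIV. v $ i * partial_deriv i \<eta> z)\<bar>
      = \<bar>\<Sum>i\<in>UNIV. v $ i * (partial_deriv i \<eta> (z + \<xi> *\<^sub>R v) - partial_deriv i \<eta> z)\<bar>"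
      unfolding \<xi>(3) by (simp add: sum_subtractf right_diff_distrib)
    also have "\<dots> \<le> (\<Sum>i\<in>UNIV. \<bar>v $ i\<bar> * \<bar>partial_deriv i \<eta> (z + \<xi> *\<^sub>R v) - partial_deriv i \<eta> z\<bar>)"
      using sum_abs[of "\<lambda>i. v $ i * (partial_deriv i \<eta> (z + \<xi> *\<^sub>R v) - partial_deriv i \<eta> z)" UNIV] by (simp add: abs_mult)
    also have "\<dots> \<le> (\<Sum>i\<in>(UNIV::'n set). norm v * \<epsilon>')"
    proof (intro sum_mono mult_mono)
      fix i
      have "norm (\<xi> *\<^sub>R v) \<le> norm v" using \<xi> by (simp add: mult_left_le_one_le)
      hence "norm (z + \<xi> *\<^sub>R v - z) < \<delta> i" using v d(2)[of i] by simp
      thus "\<bar>partial_deriv i \<eta> (z + \<xi> *\<^sub>R v) - partial_deriv i \<eta> z\<bar> \<le> \<epsilon>'" by (intro less_imp_le \<delta>(2))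
    qed (auto simp: component_le_norm_cart)
    also have "\<dots> = \<epsilon> * norm v" by (simp add: \<epsilon>'_def)
    finally show ?thesis .
  qed
  thus ?thesis using d(1) by blast
qed

text \<open>The first order remainder of \<open>\<eta>\<close> is small relative to the increment, uniformly in the base point, so
it can be integrated against an integrable function.\<close>

proposition conv_has_derivative:
  fixes \<eta> :: "real^'n::finite \<Rightarrow> real"
  assumes f: "integrable lborel f" and \<eta>: "\<eta> \<in> test_functions UNIV"
  shows "(conv f \<eta> has_derivative (\<lambda>v. \<Sum>i\<in>UNIV. v $ i * conv f (partial_deriv i \<eta>) x)) (at x)"
  unfolding has_derivative_at_alt
proof (intro conjI allI impI)
  let ?L = "\<lambda>v. \<Sum>i\<in>UNIV. v $ i * conv f (partial_deriv i \<eta>) x"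
  show "bounded_linear ?L"
    by (intro bounded_linear_sum bounded_linear_compose[OF bounded_linear_mult_left bounded_linear_vec_nth])
  fix e :: real assume e: "e > 0"
  define I where "I = (\<integral>y. \<bar>f y\<bar> \<partial>lborel)"
  have I: "I \<ge> 0" by (simp add: I_def)
  define \<epsilon> where "\<epsilon> = e / (I + 1)"
  have \<epsilon>: "\<epsilon> > 0" using e I by (simp add: \<epsilon>_def)
  obtain \<delta> where \<delta>: "\<delta> > 0" "\<And>z v. norm v < \<delta> \<Longrightarrow>
    \<bar>\<eta> (z + v) - \<eta> z - (\<Sum>i\<in>UNIV. v $ i * partial_deriv i \<eta> z)\<bar> \<le> \<epsilon> * norm v"
    using test_function_uniform_derivative[OF \<eta> \<epsilon>] by blast
  note ci = conv_integrable[OF f \<eta>] conv_integrable[OF f test_function_partial_deriv[OF \<eta>]]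
  show "\<exists>d>0. \<forall>y. norm (y - x) < d \<longrightarrow> norm (conv f \<eta> y - conv f \<eta> x - ?L (y - x)) \<le> e * norm (y - x)"
  proof (intro exI[of _ \<delta>] conjI allI impI \<delta>(1))
    fix y assume y: "norm (y - x) < \<delta>"
    define v where "v = y - x"
    let ?D = "\<lambda>w. f w * (\<eta> (x - w + v) - \<eta> (x - w) - (\<Sum>i\<in>UNIV. v $ i * partial_deriv i \<eta> (x - w)))"
    have eq: "?D w = f w * \<eta> (y - w) - f w * \<eta> (x - w) - (\<Sum>i\<in>UNIV. v $ i * (f w * partial_deriv i \<eta> (x - w)))" for w
    proof -
      have "x - w + v = y - w" by (simp add: v_def)
      show ?thesis unfolding \<open>x - w + v = y - w\<close> by (simp add: right_diff_distrib sum_distrib_left mult_ac)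
    qed
    have intD: "integrable lborel ?D" unfolding eq
      by (intro Bochner_Integration.integrable_diff Bochner_Integration.integrable_sum integrable_mult_right ci)
    have "(\<integral>w. ?D w \<partial>lborel) = conv f \<eta> y - conv f \<eta> x - ?L v"
      unfolding eq conv_def
      by (subst Bochner_Integration.integral_diff Bochner_Integration.integral_sum |
          intro Bochner_Integration.integrable_diff Bochner_Integration.integrable_sum integrable_mult_right ci |
          simp)+
    hence "norm (conv f \<eta> y - conv f \<eta> x - ?L (y - x)) = norm (\<integral>w. ?D w \<partial>lborel)" by (simp add: v_def)
    also have "\<dots> \<le> (\<integral>w. \<bar>?D w\<bar> \<partial>lborel)" using integral_norm_bound[of lborel ?D] by simp
    also have "\<dots> \<le> (\<integral>w. \<bar>f w\<bar> * (\<epsilon> * norm v) \<partial>lborel)"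
    proof (intro integral_mono)
      show "integrable lborel (\<lambda>w. \<bar>?D w\<bar>)" using intD by simp
      show "integrable lborel (\<lambda>w. \<bar>f w\<bar> * (\<epsilon> * norm v))" using f by simp
      show "\<bar>?D w\<bar> \<le> \<bar>f w\<bar> * (\<epsilon> * norm v)" for w
        unfolding abs_mult using y by (intro mult_left_mono \<delta>(2)) (auto simp: v_def)
    qed
    also have "\<dots> = (I * \<epsilon>) * norm v" by (simp add: I_def)
    also have "\<dots> \<le> e * norm v"
      using e I by (intro mult_right_mono) (auto simp: \<epsilon>_def field_simps)
    finally show "norm (conv f \<eta> y - conv f \<eta> x - ?L (y - x)) \<le> e * norm (y - x)" by (simp add: v_def)
  qed
qed

section \<open>Convergence of mollifications in the mean of order n\<close>

lemma nn_integral_lborel_reflect: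
  fixes g :: "'a::euclidean_space \<Rightarrow> ennreal"
  assumes [measurable]: "g \<in> borel_measurable borel"
  shows "(\<integral>\<^sup>+y. g (x - y) \<partial>lborel) = (\<integral>\<^sup>+y. g y \<partial>lborel)"
proof -
  have "(lborel :: 'a measure) = distr lborel borel (\<lambda>y. x + (- 1) *\<^sub>R y)"
    using lborel_affine[of "-1" x] by (simp add: density_1)
  hence "(\<integral>\<^sup>+y. g y \<partial>lborel) = (\<integral>\<^sup>+y. g y \<partial>distr lborel borel (\<lambda>y. x + (- 1) *\<^sub>R y))" by simp
  also have "\<dots> = (\<integral>\<^sup>+y. g (x - y) \<partial>lborel)" by (subst nn_integral_distr) auto
  finally show ?thesis by simp
qed

lemma nn_integral_lborel_translate:
  fixes g :: "'a::euclidean_space \<Rightarrow> ennreal"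
  assumes [measurable]: "g \<in> borel_measurable borel"
  shows "(\<integral>\<^sup>+x. g (x - y) \<partial>lborel) = (\<integral>\<^sup>+x. g x \<partial>lborel)"
proof -
  have "(\<integral>\<^sup>+x. g x \<partial>lborel) = (\<integral>\<^sup>+x. g x \<partial>distr lborel borel ((+) (- y)))"
    by (subst lborel_distr_plus) simp
  also have "\<dots> = (\<integral>\<^sup>+x. g (x - y) \<partial>lborel)" by (subst nn_integral_distr) auto
  finally show ?thesis by simp
qed

lemma mollifier_props:
  fixes \<eta> :: "real^'n::finite \<Rightarrow> real"
  assumes m: "mollifier \<delta> \<eta>"
  shows "\<eta> \<in> test_functions UNIV" "0 \<le> \<eta> x" "norm x \<ge> \<delta> \<Longrightarrow> \<eta> x = 0" "\<eta> \<in> borel_measurable borel"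
    "integrable lborel (\<lambda>y. \<eta> (x - y))" "(\<integral>y. \<eta> (x - y) \<partial>lborel) = 1"
proof -
  show t: "\<eta> \<in> test_functions UNIV" and pos: "0 \<le> \<eta> x" and "norm x \<ge> \<delta> \<Longrightarrow> \<eta> x = 0" for x
    using m by (auto simp: mollifier_def)
  show [measurable]: "\<eta> \<in> borel_measurable borel"
    by (rule borel_measurable_continuous_onI[OF test_function_continuous[OF t]])
  have "(\<integral>\<^sup>+y. ennreal (\<eta> (x - y)) \<partial>lborel) = 1"
    using nn_integral_lborel_reflect[of "\<lambda>y. ennreal (\<eta> y)" x] m by (simp add: mollifier_def)
  thus "integrable lborel (\<lambda>y. \<eta> (x - y))" "(\<integral>y. \<eta> (x - y) \<partial>lborel) = 1"
    using pos by (auto intro!: integrableI_nonneg simp: integral_eq_nn_integral)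
qed

text \<open>The value of a mollification is an average of the function over a small ball.\<close>

lemma conv_close_to_const:
  fixes \<eta> :: "real^'n::finite \<Rightarrow> real"
  assumes m: "mollifier \<delta> \<eta>" and f: "integrable lborel f"
    and ae: "AE y in lborel. norm (x - y) < \<delta> \<longrightarrow> \<bar>f y - c\<bar> \<le> \<epsilon>"
  shows "\<bar>conv f \<eta> x - c\<bar> \<le> \<epsilon>"
proof -
  note M = mollifier_props[OF m]
  have i: "integrable lborel (\<lambda>y. f y * \<eta> (x - y))" by (rule conv_integrable[OF f M(1)])
  have "conv f \<eta> x - c = (\<integral>y. f y * \<eta> (x - y) - c * \<eta> (x - y) \<partial>lborel)"
    using i M(5,6)[of x] by (subst Bochner_Integration.integral_diff) (auto simp: conv_def)
  hence "\<bar>conv f \<eta> x - c\<bar> \<le> (\<integral>y. \<bar>f y * \<eta> (x - y) - c * \<eta> (x - y)\<bar> \<partial>lborel)"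
    using integral_norm_bound[of lborel "\<lambda>y. f y * \<eta> (x - y) - c * \<eta> (x - y)"] by simp
  also have "\<dots> \<le> (\<integral>y. \<epsilon> * \<eta> (x - y) \<partial>lborel)"
  proof (rule integral_mono_AE)
    show "integrable lborel (\<lambda>y. \<bar>f y * \<eta> (x - y) - c * \<eta> (x - y)\<bar>)"
      using i M(5)[of x] by (intro integrable_abs Bochner_Integration.integrable_diff) auto
    show "integrable lborel (\<lambda>y. \<epsilon> * \<eta> (x - y))" using M(5)[of x] by simp
    show "AE y in lborel. \<bar>f y * \<eta> (x - y) - c * \<eta> (x - y)\<bar> \<le> \<epsilon> * \<eta> (x - y)"
      using ae
    proof eventually_elim
      case (elim y)
      have "\<bar>f y * \<eta> (x - y) - c * \<eta> (x - y)\<bar> = \<bar>f y - c\<bar> * \<eta> (x - y)"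
        using M(2)[of "x - y"] by (simp add: abs_mult flip: left_diff_distrib)
      also have "\<dots> \<le> \<epsilon> * \<eta> (x - y)"
        using elim M(2)[of "x - y"] M(3)[of "x - y"]
        by (cases "norm (x - y) < \<delta>") (auto intro: mult_right_mono simp: not_less)
      finally show ?case .
    qed
  qed
  also have "\<dots> = \<epsilon>" using M(6)[of x] by simp
  finally show ?thesis .
qed

text \<open>Convexity of the power, in the form used to derive Jensen's inequality by integration.\<close>

lemma power_tangent_line:
  fixes s m :: real
  assumes "s \<ge> 0" "m \<ge> 0"
  shows "m ^ n + of_nat n * m ^ (n - 1) * (s - m) \<le> s ^ n"
proof (induction n)
  case (Suc n)
  have "m ^ Suc n + of_nat (Suc n) * m ^ n * (s - m) \<le> s * (m ^ n + of_nat n * m ^ (n - 1) * (s - m))"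
  proof (cases n)
    case (Suc k)
    have "s * (m ^ n + of_nat n * m ^ (n - 1) * (s - m)) - (m ^ Suc n + of_nat (Suc n) * m ^ n * (s - m))
      = of_nat n * m ^ k * (s - m)\<^sup>2"
      by (simp add: Suc algebra_simps power2_eq_square)
    moreover have "\<dots> \<ge> 0" using assms by simp
    ultimately show ?thesis by linarith
  qed (simp add: algebra_simps)
  also have "\<dots> \<le> s * s ^ n" using Suc assms by (intro mult_left_mono)
  finally show ?case by simp
qed simp

text \<open>Jensen's inequality for the probability density \<open>y \<mapsto> \<eta> (x - y)\<close>.\<close>

lemma conv_power_le:
  fixes \<eta> :: "real^'n::finite \<Rightarrow> real"
  assumes m: "mollifier \<delta> \<eta>" and f: "integrable lborel f" and fn: "integrable lborel (\<lambda>y. \<bar>f y\<bar> ^ n)"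
  shows "ennreal (\<bar>conv f \<eta> x\<bar> ^ n) \<le> (\<integral>\<^sup>+y. ennreal (\<bar>f y\<bar> ^ n * \<eta> (x - y)) \<partial>lborel)"
proof -
  note M = mollifier_props[OF m]
  define I where "I = (\<integral>y. \<bar>f y\<bar> * \<eta> (x - y) \<partial>lborel)"
  have i1: "integrable lborel (\<lambda>y. \<bar>f y\<bar> * \<eta> (x - y))" using f by (intro conv_integrable M) simp
  have i2: "integrable lborel (\<lambda>y. \<bar>f y\<bar> ^ n * \<eta> (x - y))" using fn by (intro conv_integrable M)
  have I0: "I \<ge> 0" using M(2) by (simp add: I_def)
  have "\<bar>conv f \<eta> x\<bar> \<le> I"
    using integral_norm_bound[of lborel "\<lambda>y. f y * \<eta> (x - y)"] M(2) by (simp add: conv_def I_def abs_mult)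
  hence "\<bar>conv f \<eta> x\<bar> ^ n \<le> I ^ n" by (intro power_mono) auto
  also have "I ^ n = (\<integral>y. I ^ n * \<eta> (x - y) + of_nat n * I ^ (n - 1) * (\<bar>f y\<bar> * \<eta> (x - y) - I * \<eta> (x - y)) \<partial>lborel)"
    using i1 M(5,6)[of x]
    by (subst Bochner_Integration.integral_add | subst Bochner_Integration.integral_diff | simp add: I_def[symmetric])+
  also have "\<dots> \<le> (\<integral>y. \<bar>f y\<bar> ^ n * \<eta> (x - y) \<partial>lborel)"
  proof (rule integral_mono[OF _ i2])
    show "integrable lborel (\<lambda>y. I ^ n * \<eta> (x - y) + of_nat n * I ^ (n - 1) * (\<bar>f y\<bar> * \<eta> (x - y) - I * \<eta> (x - y)))"
      using i1 M(5)[of x] by (intro Bochner_Integration.integrable_add integrable_mult_right Bochner_Integration.integrable_diff) auto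
    fix y
    have "(I ^ n + of_nat n * I ^ (n - 1) * (\<bar>f y\<bar> - I)) * \<eta> (x - y) \<le> \<bar>f y\<bar> ^ n * \<eta> (x - y)"
      using I0 M(2) by (intro mult_right_mono power_tangent_line) auto
    thus "I ^ n * \<eta> (x - y) + of_nat n * I ^ (n - 1) * (\<bar>f y\<bar> * \<eta> (x - y) - I * \<eta> (x - y)) \<le> \<bar>f y\<bar> ^ n * \<eta> (x - y)"
      by (simp add: algebra_simps)
  qed
  finally have "ennreal (\<bar>conv f \<eta> x\<bar> ^ n) \<le> ennreal (\<integral>y. \<bar>f y\<bar> ^ n * \<eta> (x - y) \<partial>lborel)" by (rule ennreal_leI)
  also have "\<dots> = (\<integral>\<^sup>+y. ennreal (\<bar>f y\<bar> ^ n * \<eta> (x - y)) \<partial>lborel)"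
    by (rule nn_integral_eq_integral[OF i2, symmetric]) (simp add: M(2))
  finally show ?thesis .
qed

lemma conv_measurable:
  assumes "integrable lborel f" "\<eta> \<in> test_functions UNIV"
  shows "conv f \<eta> \<in> borel_measurable borel" "continuous_on A (conv f \<eta>)"
proof -
  have "continuous_on UNIV (conv f \<eta>)"
    by (intro continuous_at_imp_continuous_on ballI) (blast intro: has_derivative_continuous conv_has_derivative[OF assms])
  thus "conv f \<eta> \<in> borel_measurable borel" "continuous_on A (conv f \<eta>)"
    by (auto intro: borel_measurable_continuous_onI continuous_on_subset)
qed

text \<open>Jensen's inequality integrated over \<open>x\<close>, with the order of integration exchanged.\<close>

lemma conv_Lp_contraction:
  fixes \<eta> :: "real^'n::finite \<Rightarrow> real"
  assumes m: "mollifier \<delta> \<eta>" and f: "integrable lborel f" and fn: "integrable lborel (\<lambda>y. \<bar>f y\<bar> ^ n)"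
  shows "(\<integral>\<^sup>+x. ennreal (\<bar>conv f \<eta> x\<bar> ^ n) \<partial>lborel) \<le> (\<integral>\<^sup>+x. ennreal (\<bar>f x\<bar> ^ n) \<partial>lborel)"
proof -
  note M = mollifier_props[OF m]
  have [measurable]: "\<eta> \<in> borel_measurable borel" by (rule M)
  have [measurable]: "f \<in> borel_measurable borel" using f by (simp add: integrable_iff_bounded)
  have "(\<integral>\<^sup>+x. ennreal (\<bar>conv f \<eta> x\<bar> ^ n) \<partial>lborel) \<le> (\<integral>\<^sup>+x. \<integral>\<^sup>+y. ennreal (\<bar>f y\<bar> ^ n * \<eta> (x - y)) \<partial>lborel \<partial>lborel)"
    by (intro nn_integral_mono conv_power_le[OF m f fn])
  also have "\<dots> = (\<integral>\<^sup>+y. \<integral>\<^sup>+x. ennreal (\<bar>f y\<bar> ^ n * \<eta> (x - y)) \<partial>lborel \<partial>lborel)"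
    by (rule lborel_pair.Fubini'[symmetric]) measurable
  also have "\<dots> = (\<integral>\<^sup>+y. ennreal (\<bar>f y\<bar> ^ n) \<partial>lborel)"
  proof (rule nn_integral_cong)
    fix y
    have "(\<integral>\<^sup>+x. ennreal (\<bar>f y\<bar> ^ n * \<eta> (x - y)) \<partial>lborel) = ennreal (\<bar>f y\<bar> ^ n) * (\<integral>\<^sup>+x. ennreal (\<eta> (x - y)) \<partial>lborel)"
      by (subst nn_integral_cmult[symmetric]) (auto simp: ennreal_mult M)
    also have "(\<integral>\<^sup>+x. ennreal (\<eta> (x - y)) \<partial>lborel) = 1"
      using m by (subst nn_integral_lborel_translate[of "\<lambda>x. ennreal (\<eta> x)"]) (auto simp: mollifier_def)
    finally show "(\<integral>\<^sup>+x. ennreal (\<bar>f y\<bar> ^ n * \<eta> (x - y)) \<partial>lborel) = ennreal (\<bar>f y\<bar> ^ n)" by simp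
  qed
  finally show ?thesis .
qed

lemma power_add_le:
  fixes a b :: real
  assumes "a \<ge> 0" "b \<ge> 0"
  shows "(a + b) ^ n \<le> 2 ^ n * (a ^ n + b ^ n)"
proof -
  have "(a + b) ^ n \<le> (2 * max a b) ^ n" using assms by (intro power_mono) auto
  also have "\<dots> = 2 ^ n * max a b ^ n" by (rule power_mult_distrib)
  also have "\<dots> \<le> 2 ^ n * (a ^ n + b ^ n)" using assms by (intro mult_left_mono) (auto simp: max_def)
  finally show ?thesis .
qed

lemma integrable_of_power_integrable:
  fixes g :: "'a::euclidean_space \<Rightarrow> real"
  assumes [measurable]: "g \<in> borel_measurable borel" and s: "\<And>x. norm x > R \<Longrightarrow> g x = 0"
    and n: "n \<ge> 1" and gn: "integrable lborel (\<lambda>x. \<bar>g x\<bar> ^ n)"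
  shows "integrable lborel g"
proof (rule Bochner_Integration.integrable_bound)
  have "integrable lborel (indicat_real (cball (0::'a) R))"
    using emeasure_bounded_finite[of "cball (0::'a) R"] by (intro integrable_real_indicator) auto
  thus "integrable lborel (\<lambda>x. indicat_real (cball 0 R) x + \<bar>g x\<bar> ^ n)"
    using gn by (rule Bochner_Integration.integrable_add)
  show "AE x in lborel. norm (g x) \<le> norm (indicat_real (cball 0 R) x + \<bar>g x\<bar> ^ n)"
  proof (rule AE_I2)
    fix x
    have "\<bar>g x\<bar> \<le> indicat_real (cball 0 R) x + \<bar>g x\<bar> ^ n"
    proof (cases "norm x > R")
      case False
      have "\<bar>g x\<bar> \<le> 1 + \<bar>g x\<bar> ^ n"
      proof (cases "\<bar>g x\<bar> \<le> 1")
        case False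
        hence "\<bar>g x\<bar> ^ 1 \<le> \<bar>g x\<bar> ^ n" using n by (intro power_increasing) auto
        thus ?thesis by simp
      qed (simp add: add_increasing2)
      thus ?thesis using False by simp
    qed (simp add: s)
    thus "norm (g x) \<le> norm (indicat_real (cball 0 R) x + \<bar>g x\<bar> ^ n)" by simp
  qed
qed simp

lemma nn_integral_small_eventually:
  fixes u :: "nat \<Rightarrow> 'a \<Rightarrow> real"
  assumes [measurable]: "\<And>k. u k \<in> borel_measurable M" "w \<in> borel_measurable M"
    and b: "\<And>k. AE x in M. \<bar>u k x\<bar> \<le> w x" and w: "(\<integral>\<^sup>+x. ennreal (w x ^ n) \<partial>M) < \<infinity>"
    and lim: "AE x in M. (\<lambda>k. u k x) \<longlonglongrightarrow> 0" and n: "n \<ge> 1" and \<epsilon>: "\<epsilon> > 0"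
  shows "\<exists>k::nat. k \<ge> 1 \<and> (\<integral>\<^sup>+x. ennreal (\<bar>u k x\<bar> ^ n) \<partial>M) \<le> ennreal \<epsilon>"
proof -
  have "(\<lambda>k. \<integral>\<^sup>+x. ennreal (\<bar>u k x\<bar> ^ n) \<partial>M) \<longlonglongrightarrow> (\<integral>\<^sup>+x. 0 \<partial>M)"
  proof (rule nn_integral_dominated_convergence[where w = "\<lambda>x. ennreal (w x ^ n)"])
    show "AE x in M. ennreal (\<bar>u k x\<bar> ^ n) \<le> ennreal (w x ^ n)" for k
      using b[of k] by eventually_elim (auto intro!: ennreal_leI power_mono)
    show "AE x in M. (\<lambda>k. ennreal (\<bar>u k x\<bar> ^ n)) \<longlonglongrightarrow> 0"
      using lim
    proof eventually_elim
      case (elim x)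
      have "(\<lambda>k. \<bar>u k x\<bar> ^ n) \<longlonglongrightarrow> \<bar>0\<bar> ^ n" by (intro tendsto_intros elim)
      hence "(\<lambda>k. ennreal (\<bar>u k x\<bar> ^ n)) \<longlonglongrightarrow> ennreal (\<bar>0\<bar> ^ n)" by (rule tendsto_ennrealI)
      thus ?case using n by (simp add: power_0_left)
    qed
  qed (use w in auto)
  hence "\<forall>\<^sub>F k in sequentially. (\<integral>\<^sup>+x. ennreal (\<bar>u k x\<bar> ^ n) \<partial>M) < ennreal \<epsilon>"
    using \<epsilon> by (intro order_tendstoD(2)) auto
  from eventually_conj[OF this eventually_ge_at_top[of "1::nat"]] show ?thesis
    using eventually_sequentially by (metis (no_types, lifting) less_imp_le order_refl)
qed

lemma nn_integral_power_diff_triangle: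
  fixes f g k :: "'a::euclidean_space \<Rightarrow> real"
  assumes [measurable]: "f \<in> borel_measurable borel" "g \<in> borel_measurable borel" "k \<in> borel_measurable borel"
  shows "(\<integral>\<^sup>+x. ennreal (\<bar>f x - g x\<bar> ^ n) \<partial>lborel)
    \<le> ennreal (2 ^ n) * ((\<integral>\<^sup>+x. ennreal (\<bar>f x - k x\<bar> ^ n) \<partial>lborel) + (\<integral>\<^sup>+x. ennreal (\<bar>k x - g x\<bar> ^ n) \<partial>lborel))"
proof -
  have "(\<integral>\<^sup>+x. ennreal (\<bar>f x - g x\<bar> ^ n) \<partial>lborel)
    \<le> (\<integral>\<^sup>+x. ennreal (2 ^ n) * (ennreal (\<bar>f x - k x\<bar> ^ n) + ennreal (\<bar>k x - g x\<bar> ^ n)) \<partial>lborel)"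
  proof (rule nn_integral_mono)
    fix x
    have "\<bar>f x - g x\<bar> ^ n \<le> (\<bar>f x - k x\<bar> + \<bar>k x - g x\<bar>) ^ n" by (intro power_mono) auto
    also have "\<dots> \<le> 2 ^ n * (\<bar>f x - k x\<bar> ^ n + \<bar>k x - g x\<bar> ^ n)" by (intro power_add_le) auto
    finally have "ennreal (\<bar>f x - g x\<bar> ^ n) \<le> ennreal (2 ^ n * (\<bar>f x - k x\<bar> ^ n + \<bar>k x - g x\<bar> ^ n))" by (rule ennreal_leI)
    thus "ennreal (\<bar>f x - g x\<bar> ^ n) \<le> ennreal (2 ^ n) * (ennreal (\<bar>f x - k x\<bar> ^ n) + ennreal (\<bar>k x - g x\<bar> ^ n))"
      by (simp add: ennreal_mult)
  qed
  also have "\<dots> = ennreal (2 ^ n) * ((\<integral>\<^sup>+x. ennreal (\<bar>f x - k x\<bar> ^ n) \<partial>lborel) + (\<integral>\<^sup>+x. ennreal (\<bar>k x - g x\<bar> ^ n) \<partial>lborel))"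
    by (subst nn_integral_cmult, measurable) (subst nn_integral_add, auto)
  finally show ?thesis .
qed

text \<open>The function is first truncated to bounded values. A bounded measurable function is an almost
everywhere limit of continuous functions, which may be truncated to the same bounds and multiplied
by a cutoff, and then dominated convergence applies.\<close>

lemma Lp_continuous_dense:
  fixes g :: "'a::euclidean_space \<Rightarrow> real"
  assumes gm[measurable]: "g \<in> borel_measurable borel" and s: "\<And>x. norm x > R \<Longrightarrow> g x = 0"
    and n: "n \<ge> 1" and gn: "(\<integral>\<^sup>+x. ennreal (\<bar>g x\<bar> ^ n) \<partial>lborel) < \<infinity>" and \<epsilon>: "\<epsilon> > 0"
  shows "\<exists>k. continuous_on UNIV k \<and> (\<forall>x. norm x > R + 1 \<longrightarrow> k x = 0) \<and>
    (\<integral>\<^sup>+x. ennreal (\<bar>g x - k x\<bar> ^ n) \<partial>lborel) \<le> ennreal \<epsilon>"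
proof -
  \<comment> \<open>truncation to the interval from \<open>-m\<close> to \<open>m\<close>\<close>
  define cl where "cl m t = max (- m) (min m t)" for m t :: real
  define \<epsilon>' where "\<epsilon>' = \<epsilon> / (2 ^ n * 2)"
  have e': "\<epsilon>' > 0" using \<epsilon> by (simp add: \<epsilon>'_def)
  have [measurable]: "(\<lambda>x. cl m (g x)) \<in> borel_measurable borel" for m unfolding cl_def by measurable
  have "\<exists>k::nat. k \<ge> 1 \<and> (\<integral>\<^sup>+x. ennreal (\<bar>g x - cl (real k) (g x)\<bar> ^ n) \<partial>lborel) \<le> ennreal \<epsilon>'"
  proof (rule nn_integral_small_eventually[where w = "\<lambda>x. \<bar>g x\<bar>"])
    show "AE x in lborel. \<bar>g x - cl (real k) (g x)\<bar> \<le> \<bar>g x\<bar>" for k by (intro AE_I2) (auto simp: cl_def)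
    show "AE x in lborel. (\<lambda>k. g x - cl (real k) (g x)) \<longlonglongrightarrow> 0"
    proof (rule AE_I2)
      fix x
      obtain N where N: "\<bar>g x\<bar> \<le> real N" using real_arch_simple by blast
      have "\<forall>\<^sub>F k in sequentially. 0 = g x - cl (real k) (g x)"
        using eventually_ge_at_top[of N] by eventually_elim (use N in \<open>auto simp: cl_def max_def min_def\<close>)
      thus "(\<lambda>k. g x - cl (real k) (g x)) \<longlonglongrightarrow> 0" by (rule Lim_transform_eventually[OF tendsto_const])
    qed
  qed (use gn n e' in auto)
  then obtain m0 :: nat where m0: "m0 \<ge> 1" "(\<integral>\<^sup>+x. ennreal (\<bar>g x - cl (real m0) (g x)\<bar> ^ n) \<partial>lborel) \<le> ennreal \<epsilon>'" by blast
  define m where "m = real m0"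
  have m: "m > 0" using m0 by (simp add: m_def)
  have "g measurable_on UNIV"
    using gm by (intro lebesgue_measurable_imp_measurable_on measurable_completion) simp_all
  then obtain N k where N: "negligible N" "\<And>j. continuous_on UNIV (k j)"
    "\<And>x. x \<notin> N \<Longrightarrow> (\<lambda>j. k j x) \<longlonglongrightarrow> g x" unfolding measurable_on_def by auto
  define \<theta> where "\<theta> x = max 0 (min 1 (R + 1 - norm x))" for x :: 'a
  define k' where "k' j x = \<theta> x * cl m (k j x)" for j x
  have ck': "continuous_on UNIV (k' j)" for j
    unfolding k'_def \<theta>_def cl_def by (intro continuous_intros N(2))
  have [measurable]: "k' j \<in> borel_measurable borel" for j by (rule borel_measurable_continuous_onI[OF ck'])
  have \<theta>: "0 \<le> \<theta> x" "\<theta> x \<le> 1" "norm x > R + 1 \<Longrightarrow> \<theta> x = 0" "norm x \<le> R \<Longrightarrow> \<theta> x = 1" for x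
    by (auto simp: \<theta>_def)
  have cl_le: "\<bar>cl m t\<bar> \<le> m" for t using m by (auto simp: cl_def)
  have gchi: "cl m (g x) = \<theta> x * cl m (g x)" for x
    using \<theta>(4)[of x] s[of x] m by (cases "norm x \<le> R") (auto simp: cl_def)
  have "\<exists>j::nat. j \<ge> 1 \<and> (\<integral>\<^sup>+x. ennreal (\<bar>cl m (g x) - k' j x\<bar> ^ n) \<partial>lborel) \<le> ennreal \<epsilon>'"
  proof (rule nn_integral_small_eventually[where w = "\<lambda>x. 2 * m * indicator (cball 0 (R + 1)) x"])
    show "AE x in lborel. \<bar>cl m (g x) - k' j x\<bar> \<le> 2 * m * indicator (cball 0 (R + 1)) x" for j
    proof (rule AE_I2)
      fix x
      have eq: "cl m (g x) - k' j x = \<theta> x * (cl m (g x) - cl m (k j x))"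
        by (subst gchi) (simp add: k'_def right_diff_distrib)
      show "\<bar>cl m (g x) - k' j x\<bar> \<le> 2 * m * indicator (cball 0 (R + 1)) x"
      proof (cases "norm x > R + 1")
        case False
        have "\<bar>\<theta> x * (cl m (g x) - cl m (k j x))\<bar> \<le> 1 * (2 * m)"
          unfolding abs_mult using \<theta>[of x] cl_le[of "g x"] cl_le[of "k j x"] by (intro mult_mono) (auto simp: abs_le_iff)
        thus ?thesis using False by (simp add: eq)
      qed (simp add: eq \<theta>)
    qed
    have "(\<integral>\<^sup>+x. ennreal ((2 * m * indicator (cball (0::'a) (R + 1)) x) ^ n) \<partial>lborel)
        = (\<integral>\<^sup>+x. ennreal ((2 * m) ^ n) * indicator (cball (0::'a) (R + 1)) x \<partial>lborel)"
      using n by (intro nn_integral_cong) (auto simp: indicator_def power_0_left)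
    also have "\<dots> < \<infinity>" using emeasure_bounded_finite[of "cball (0::'a) (R + 1)"]
      by (simp add: nn_integral_cmult_indicator ennreal_mult_less_top)
    finally show "(\<integral>\<^sup>+x. ennreal ((2 * m * indicator (cball (0::'a) (R + 1)) x) ^ n) \<partial>lborel) < \<infinity>" .
    have "AE x in lebesgue. x \<notin> N" using N(1) by (simp add: negligible_iff_null_sets AE_not_in)
    hence "AE x in lborel. x \<notin> N" by (simp add: AE_completion_iff)
    thus "AE x in lborel. (\<lambda>j. cl m (g x) - k' j x) \<longlonglongrightarrow> 0"
    proof eventually_elim
      case (elim x)
      have "(\<lambda>j. \<theta> x * cl m (g x) - \<theta> x * cl m (k j x)) \<longlonglongrightarrow> \<theta> x * cl m (g x) - \<theta> x * cl m (g x)"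
        unfolding cl_def by (intro tendsto_intros N(3) elim)
      thus ?case by (simp add: k'_def flip: gchi)
    qed
  qed (use n e' in \<open>auto intro!: borel_measurable_times borel_measurable_const borel_measurable_indicator borel_closed\<close>)
  then obtain j where j: "(\<integral>\<^sup>+x. ennreal (\<bar>cl m (g x) - k' j x\<bar> ^ n) \<partial>lborel) \<le> ennreal \<epsilon>'" by blast
  have "(\<integral>\<^sup>+x. ennreal (\<bar>g x - k' j x\<bar> ^ n) \<partial>lborel) \<le> ennreal (2 ^ n) * (ennreal \<epsilon>' + ennreal \<epsilon>')"
    by (rule order_trans[OF nn_integral_power_diff_triangle[where k = "\<lambda>x. cl m (g x)"] mult_left_mono[OF add_mono]])
      (use m0(2) j in \<open>auto simp: m_def\<close>)
  also have "\<dots> = ennreal \<epsilon>" using e' \<epsilon> by (simp flip: ennreal_plus ennreal_mult add: \<epsilon>'_def)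
  finally show ?thesis using ck'[of j] \<theta>(3) by (intro exI[of _ "k' j"]) (auto simp: k'_def)
qed

lemma mollifier_mono: "mollifier \<delta> \<eta> \<Longrightarrow> \<delta> \<le> \<delta>' \<Longrightarrow> mollifier \<delta>' \<eta>"
  by (auto simp: mollifier_def)

text \<open>For a continuous function with compact support the convergence is uniform; the general case follows
by density because mollification is a contraction in the mean.\<close>

proposition conv_Lp_convergence:
  fixes g :: "real^'n::finite \<Rightarrow> real"
  assumes gm[measurable]: "g \<in> borel_measurable borel" and s: "\<And>x. norm x > R \<Longrightarrow> g x = 0"
    and n: "n \<ge> 1" and gn: "integrable lborel (\<lambda>x. \<bar>g x\<bar> ^ n)" and \<epsilon>: "\<epsilon> > 0"
  shows "\<exists>\<delta>>0. \<forall>\<eta>. mollifier \<delta> \<eta> \<longrightarrow> (\<integral>\<^sup>+x. ennreal (\<bar>conv g \<eta> x - g x\<bar> ^ n) \<partial>lborel) \<le> ennreal \<epsilon>"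
proof -
  \<comment> \<open>two applications of \<open>(a + b)^n \<le> 2^n (a^n + b^n)\<close> to a sum of three errors lose exactly this factor\<close>
  define \<epsilon>' where "\<epsilon>' = \<epsilon> / (2 ^ n * (1 + 2 ^ n * 2))"
  have e': "\<epsilon>' > 0" using \<epsilon> by (simp add: \<epsilon>'_def add_pos_pos)
  have gfin: "(\<integral>\<^sup>+x. ennreal (\<bar>g x\<bar> ^ n) \<partial>lborel) < \<infinity>"
    using gn by (subst nn_integral_eq_integral) auto
  obtain k where k: "continuous_on UNIV k" "\<And>x. norm x > R + 1 \<Longrightarrow> k x = 0"
    "(\<integral>\<^sup>+x. ennreal (\<bar>g x - k x\<bar> ^ n) \<partial>lborel) \<le> ennreal \<epsilon>'"
    using Lp_continuous_dense[OF gm s n gfin e'] by blast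
  have [measurable]: "k \<in> borel_measurable borel" by (rule borel_measurable_continuous_onI[OF k(1)])
  have kint: "integrable lborel k"
  proof -
    have "integrable lborel (\<lambda>x. indicator (cball 0 (R + 1)) x *\<^sub>R k x)"
      by (intro borel_integrable_compact continuous_on_subset[OF k(1)]) auto
    also have "(\<lambda>x. indicator (cball 0 (R + 1)) x *\<^sub>R k x) = k" using k(2) by (fastforce simp: indicator_def)
    finally show ?thesis .
  qed
  have gint: "integrable lborel g" by (rule integrable_of_power_integrable[OF gm s n gn])
  have gkn: "integrable lborel (\<lambda>x. \<bar>g x - k x\<bar> ^ n)"
    using k(3) by (intro integrableI_nonneg) (auto intro: le_less_trans)
  define V where "V = measure lborel (cball (0::real^'n) (R + 2))"
  have V: "emeasure lborel (cball (0::real^'n) (R + 2)) = ennreal V" "V \<ge> 0"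
    using emeasure_bounded_finite[of "cball (0::real^'n) (R + 2)"] by (auto simp: V_def emeasure_eq_ennreal_measure less_top)
  define \<omega> where "\<omega> = root n (\<epsilon>' / (V + 1))"
  have \<omega>: "\<omega> > 0" "\<omega> ^ n * V \<le> \<epsilon>'"
    using e' V n by (auto simp: \<omega>_def field_simps)
  obtain \<delta> where \<delta>: "\<delta> > 0" "\<And>x y. norm (x - y) < \<delta> \<Longrightarrow> \<bar>k x - k y\<bar> < \<omega>"
    using compact_support_uniformly_continuous[OF k(1,2) \<omega>(1)] by blast
  have "(\<integral>\<^sup>+x. ennreal (\<bar>conv g \<eta> x - g x\<bar> ^ n) \<partial>lborel) \<le> ennreal \<epsilon>" if m: "mollifier (min \<delta> 1) \<eta>" for \<eta> :: "real^'n \<Rightarrow> real"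
  proof -
    note M = mollifier_props[OF m]
    have [measurable]: "conv g \<eta> \<in> borel_measurable borel" "conv k \<eta> \<in> borel_measurable borel"
      by (intro conv_measurable gint kint M)+
    have close: "\<bar>conv k \<eta> x - k x\<bar> \<le> \<omega> * indicator (cball 0 (R + 2)) x" for x
    proof (cases "norm x \<le> R + 2")
      case True
      have "\<bar>conv k \<eta> x - k x\<bar> \<le> \<omega>"
        using \<delta>(2) by (intro conv_close_to_const[OF m kint] AE_I2) (auto simp: norm_minus_commute intro: less_imp_le)
      thus ?thesis using True by simp
    next
      case False
      have kz: "k y = 0" if "norm (x - y) < 1" for y
        using that False norm_triangle_ineq2[of x y] by (intro k(2)) linarith
      have "k x = 0" using kz[of x] by simp
      moreover have "\<bar>conv k \<eta> x - 0\<bar> \<le> 0" using kz by (intro conv_close_to_const[OF m kint] AE_I2) auto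
      ultimately show ?thesis using \<omega>(1) by simp
    qed
    have c2: "(\<integral>\<^sup>+x. ennreal (\<bar>conv k \<eta> x - k x\<bar> ^ n) \<partial>lborel) \<le> ennreal \<epsilon>'"
    proof -
      have "(\<integral>\<^sup>+x. ennreal (\<bar>conv k \<eta> x - k x\<bar> ^ n) \<partial>lborel) \<le> (\<integral>\<^sup>+x. ennreal (\<omega> ^ n) * indicator (cball (0::real^'n) (R + 2)) x \<partial>lborel)"
      proof (rule nn_integral_mono)
        fix x :: "real^'n"
        show "ennreal (\<bar>conv k \<eta> x - k x\<bar> ^ n) \<le> ennreal (\<omega> ^ n) * indicator (cball 0 (R + 2)) x"
          using close[of x] n by (cases "x \<in> cball 0 (R + 2)") (auto intro!: ennreal_leI power_mono simp: power_0_left)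
      qed
      also have "\<dots> = ennreal (\<omega> ^ n * V)" using V \<omega> by (simp add: nn_integral_cmult_indicator ennreal_mult)
      also have "\<dots> \<le> ennreal \<epsilon>'" using \<omega> by (intro ennreal_leI)
      finally show ?thesis .
    qed
    have c1: "(\<integral>\<^sup>+x. ennreal (\<bar>conv g \<eta> x - conv k \<eta> x\<bar> ^ n) \<partial>lborel) \<le> ennreal \<epsilon>'"
    proof -
      have "conv g \<eta> x - conv k \<eta> x = conv (\<lambda>x. g x - k x) \<eta> x" for x
        unfolding conv_def using conv_integrable[OF gint M(1), of x] conv_integrable[OF kint M(1), of x]
        by (subst Bochner_Integration.integral_diff[symmetric]) (auto simp: left_diff_distrib)
      thus ?thesis using order_trans[OF conv_Lp_contraction[OF m _ gkn] k(3)] gint kint by simp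
    qed
    have "(\<integral>\<^sup>+x. ennreal (\<bar>conv g \<eta> x - g x\<bar> ^ n) \<partial>lborel)
      \<le> ennreal (2 ^ n) * ((\<integral>\<^sup>+x. ennreal (\<bar>conv g \<eta> x - conv k \<eta> x\<bar> ^ n) \<partial>lborel) + (\<integral>\<^sup>+x. ennreal (\<bar>conv k \<eta> x - g x\<bar> ^ n) \<partial>lborel))"
      by (rule nn_integral_power_diff_triangle) auto
    also have "\<dots> \<le> ennreal (2 ^ n) * (ennreal \<epsilon>' + ennreal (2 ^ n) * (ennreal \<epsilon>' + ennreal \<epsilon>'))"
    proof (intro mult_left_mono add_mono c1)
      have "(\<integral>\<^sup>+x. ennreal (\<bar>conv k \<eta> x - g x\<bar> ^ n) \<partial>lborel)
        \<le> ennreal (2 ^ n) * ((\<integral>\<^sup>+x. ennreal (\<bar>conv k \<eta> x - k x\<bar> ^ n) \<partial>lborel) + (\<integral>\<^sup>+x. ennreal (\<bar>k x - g x\<bar> ^ n) \<partial>lborel))"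
        by (rule nn_integral_power_diff_triangle) auto
      also have "\<dots> \<le> ennreal (2 ^ n) * (ennreal \<epsilon>' + ennreal \<epsilon>')"
        using c2 k(3) by (intro mult_left_mono add_mono) (auto simp: abs_minus_commute)
      finally show "(\<integral>\<^sup>+x. ennreal (\<bar>conv k \<eta> x - g x\<bar> ^ n) \<partial>lborel) \<le> ennreal (2 ^ n) * (ennreal \<epsilon>' + ennreal \<epsilon>')" .
    qed auto
    also have "\<dots> = ennreal (2 ^ n * (\<epsilon>' + 2 ^ n * (\<epsilon>' + \<epsilon>')))"
      using e' by (simp flip: ennreal_plus ennreal_mult)
    also have "2 ^ n * (\<epsilon>' + 2 ^ n * (\<epsilon>' + \<epsilon>')) = \<epsilon>"
    proof -
      have "2 ^ n * (\<epsilon>' + 2 ^ n * (\<epsilon>' + \<epsilon>')) = (2 ^ n * (1 + 2 ^ n * 2)) * \<epsilon>'" by (simp add: algebra_simps)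
      also have "(2 ^ n * (1 + 2 ^ n * 2) :: real) \<noteq> 0"
        by (intro no_zero_divisors) (auto simp: add_nonneg_eq_0_iff)
      from nonzero_mult_div_cancel_left[OF this, of \<epsilon>]
      have "(2 ^ n * (1 + 2 ^ n * 2)) * \<epsilon>' = \<epsilon>" by (simp only: \<epsilon>'_def times_divide_eq_right)
      finally show ?thesis .
    qed
    finally show ?thesis .
  qed
  thus ?thesis using \<delta>(1) by (intro exI[of _ "min \<delta> 1"]) auto
qed

text \<open>Errors bounded by \<open>2^(-m)\<close> are summable, and the sum of the errors is an integrable function. It
yields at once convergence almost everywhere and a common dominating function, so no passage to
subsequences is needed.\<close>

lemma mollifier_sequence:
  fixes \<F> :: "(real^'n::finite \<Rightarrow> real) set"
  assumes fin: "finite \<F>" and n: "n \<ge> 1" and \<delta>0: "\<delta>0 > 0"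
    and \<F>: "\<And>f. f \<in> \<F> \<Longrightarrow> f \<in> borel_measurable borel \<and> (\<forall>x. norm x > R \<longrightarrow> f x = 0) \<and> integrable lborel (\<lambda>x. \<bar>f x\<bar> ^ n)"
  obtains \<eta> :: "nat \<Rightarrow> real^'n \<Rightarrow> real" where "\<And>m. mollifier \<delta>0 (\<eta> m)"
    "\<And>f. f \<in> \<F> \<Longrightarrow> AE x in lborel. (\<lambda>m. conv f (\<eta> m) x) \<longlonglongrightarrow> f x"
    "\<And>f. f \<in> \<F> \<Longrightarrow> \<exists>w\<in>borel_measurable borel. (\<integral>\<^sup>+x. w x \<partial>lborel) < \<infinity> \<and> (\<forall>m x. ennreal (\<bar>conv f (\<eta> m) x\<bar> ^ n) \<le> w x)"
proof -
  have "\<exists>\<eta>. mollifier \<delta>0 \<eta> \<and> (\<forall>f\<in>\<F>. (\<integral>\<^sup>+x. ennreal (\<bar>conv f \<eta> x - f x\<bar> ^ n) \<partial>lborel) \<le> ennreal ((1/2) ^ m))" for m :: nat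
  proof -
    have "\<forall>f\<in>\<F>. \<exists>\<delta>>0. \<forall>\<eta>. mollifier \<delta> \<eta> \<longrightarrow> (\<integral>\<^sup>+x. ennreal (\<bar>conv f \<eta> x - f x\<bar> ^ n) \<partial>lborel) \<le> ennreal ((1/2) ^ m)"
      using \<F> n by (intro ballI conv_Lp_convergence) auto
    then obtain \<delta> where \<delta>: "\<And>f. f \<in> \<F> \<Longrightarrow> \<delta> f > 0"
      "\<And>f \<eta>. f \<in> \<F> \<Longrightarrow> mollifier (\<delta> f) \<eta> \<Longrightarrow> (\<integral>\<^sup>+x. ennreal (\<bar>conv f \<eta> x - f x\<bar> ^ n) \<partial>lborel) \<le> ennreal ((1/2) ^ m)"
      by metis
    define d where "d = Min (insert \<delta>0 (\<delta> ` \<F>))"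
    have d: "d > 0" "d \<le> \<delta>0" "\<And>f. f \<in> \<F> \<Longrightarrow> d \<le> \<delta> f" using fin \<delta>0 \<delta>(1) by (auto simp: d_def)
    obtain \<eta> :: "real^'n \<Rightarrow> real" where "mollifier d \<eta>" using mollifier_exists[OF d(1)] by blast
    thus ?thesis using d(2,3) \<delta>(2) mollifier_mono by blast
  qed
  then obtain \<eta> where \<eta>: "\<And>m. mollifier \<delta>0 (\<eta> m)"
    "\<And>m f. f \<in> \<F> \<Longrightarrow> (\<integral>\<^sup>+x. ennreal (\<bar>conv f (\<eta> m) x - f x\<bar> ^ n) \<partial>lborel) \<le> ennreal ((1/2) ^ m)" by metis
  show ?thesis
  proof (rule that[of \<eta>])
    fix f assume f: "f \<in> \<F>"
    note F = \<F>[OF f]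
    have [measurable]: "f \<in> borel_measurable borel" using F by simp
    have fint: "integrable lborel f" using F n by (intro integrable_of_power_integrable[of f R n]) auto
    have [measurable]: "conv f (\<eta> m) \<in> borel_measurable borel" for m
      by (intro conv_measurable fint mollifier_props[OF \<eta>(1)])
    define S where "S x = (\<Sum>m. ennreal (\<bar>conv f (\<eta> m) x - f x\<bar> ^ n))" for x
    have [measurable]: "S \<in> borel_measurable borel" unfolding S_def by measurable
    have "(\<integral>\<^sup>+x. S x \<partial>lborel) = (\<Sum>m. \<integral>\<^sup>+x. ennreal (\<bar>conv f (\<eta> m) x - f x\<bar> ^ n) \<partial>lborel)"
      unfolding S_def by (rule nn_integral_suminf) measurable
    also have "\<dots> \<le> (\<Sum>m. ennreal ((1/2) ^ m))" by (intro suminf_le \<eta>(2) f) auto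
    also have "\<dots> = ennreal (\<Sum>m. (1/2) ^ m)" by (intro suminf_ennreal2) (auto intro: summable_geometric)
    also have "\<dots> < \<infinity>" by simp
    finally have Sfin: "(\<integral>\<^sup>+x. S x \<partial>lborel) < \<infinity>" .
    have "AE x in lborel. S x \<noteq> \<infinity>" using Sfin by (intro nn_integral_noteq_infinite) auto
    thus "AE x in lborel. (\<lambda>m. conv f (\<eta> m) x) \<longlonglongrightarrow> f x"
    proof eventually_elim
      case (elim x)
      have "summable (\<lambda>m. \<bar>conv f (\<eta> m) x - f x\<bar> ^ n)"
        using elim by (intro summable_suminf_not_top) (auto simp: S_def)
      hence "(\<lambda>m. root n (\<bar>conv f (\<eta> m) x - f x\<bar> ^ n)) \<longlonglongrightarrow> root n 0"
        by (intro tendsto_real_root summable_LIMSEQ_zero)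
      hence "(\<lambda>m. \<bar>conv f (\<eta> m) x - f x\<bar>) \<longlonglongrightarrow> 0" using n by (simp add: real_root_power_cancel)
      hence "(\<lambda>m. conv f (\<eta> m) x - f x) \<longlonglongrightarrow> 0" by (simp add: tendsto_rabs_zero_iff)
      thus ?case by (simp add: LIM_zero_iff)
    qed
    define w where "w x = ennreal (2 ^ n) * (S x + ennreal (\<bar>f x\<bar> ^ n))" for x
    have "w \<in> borel_measurable borel" unfolding w_def by measurable
    moreover have "(\<integral>\<^sup>+x. w x \<partial>lborel) < \<infinity>"
    proof -
      have "(\<integral>\<^sup>+x. w x \<partial>lborel) = ennreal (2 ^ n) * ((\<integral>\<^sup>+x. S x \<partial>lborel) + (\<integral>\<^sup>+x. ennreal (\<bar>f x\<bar> ^ n) \<partial>lborel))"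
        unfolding w_def by (subst nn_integral_cmult, measurable) (subst nn_integral_add, auto)
      also have "(\<integral>\<^sup>+x. ennreal (\<bar>f x\<bar> ^ n) \<partial>lborel) < \<infinity>" using F by (subst nn_integral_eq_integral) auto
      hence "ennreal (2 ^ n) * ((\<integral>\<^sup>+x. S x \<partial>lborel) + (\<integral>\<^sup>+x. ennreal (\<bar>f x\<bar> ^ n) \<partial>lborel)) < \<infinity>"
        using Sfin by (simp add: ennreal_mult_less_top)
      finally show ?thesis .
    qed
    moreover have "ennreal (\<bar>conv f (\<eta> m) x\<bar> ^ n) \<le> w x" for m x
    proof -
      have "\<bar>conv f (\<eta> m) x\<bar> ^ n \<le> (\<bar>conv f (\<eta> m) x - f x\<bar> + \<bar>f x\<bar>) ^ n" by (intro power_mono) auto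
      also have "\<dots> \<le> 2 ^ n * (\<bar>conv f (\<eta> m) x - f x\<bar> ^ n + \<bar>f x\<bar> ^ n)" by (intro power_add_le) auto
      finally have "ennreal (\<bar>conv f (\<eta> m) x\<bar> ^ n) \<le> ennreal (2 ^ n * (\<bar>conv f (\<eta> m) x - f x\<bar> ^ n + \<bar>f x\<bar> ^ n))" by (rule ennreal_leI)
      also have "\<dots> = ennreal (2 ^ n) * (ennreal (\<bar>conv f (\<eta> m) x - f x\<bar> ^ n) + ennreal (\<bar>f x\<bar> ^ n))"
        by (simp add: ennreal_mult)
      also have "\<dots> \<le> w x" unfolding w_def
      proof (intro mult_left_mono add_right_mono)
        have "(\<Sum>i<Suc m. ennreal (\<bar>conv f (\<eta> i) x - f x\<bar> ^ n)) \<le> S x"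
          unfolding S_def by (intro sum_le_suminf) auto
        moreover have "ennreal (\<bar>conv f (\<eta> m) x - f x\<bar> ^ n) \<le> (\<Sum>i<Suc m. ennreal (\<bar>conv f (\<eta> i) x - f x\<bar> ^ n))"
          by (simp add: add_increasing)
        ultimately show "ennreal (\<bar>conv f (\<eta> m) x - f x\<bar> ^ n) \<le> S x" by (rule order_trans[rotated])
      qed auto
      finally show ?thesis .
    qed
    ultimately show "\<exists>w\<in>borel_measurable borel. (\<integral>\<^sup>+x. w x \<partial>lborel) < \<infinity> \<and> (\<forall>m x. ennreal (\<bar>conv f (\<eta> m) x\<bar> ^ n) \<le> w x)"
      by blast
  qed (rule \<eta>)
qed

section \<open>Smooth approximation of weakly differentiable functions\<close>

text \<open>Functions that are only given on the ball and only Lebesgue measurable are replaced by globally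
defined Borel functions that agree with them almost everywhere on a smaller ball. Product measures
and convolutions can then be formed without completions.\<close>

definition borel_cutoff :: "real \<Rightarrow> (real^'n::finite \<Rightarrow> real) \<Rightarrow> (real^'n \<Rightarrow> real) \<Rightarrow> bool" where
  "borel_cutoff R f g \<longleftrightarrow> g \<in> borel_measurable borel \<and> (\<forall>x. norm x > R \<longrightarrow> g x = 0) \<and>
     (AE x in lebesgue. norm x \<le> R \<longrightarrow> g x = f x)"

lemma borel_cutoff_exists:
  fixes f :: "real^'n::finite \<Rightarrow> real"
  assumes f: "f \<in> Lp_loc (real n) (ball 0 1)" and n: "n \<ge> 1" and R: "R < 1"
  shows "\<exists>g. borel_cutoff R f g \<and> integrable lborel (\<lambda>x. \<bar>g x\<bar> ^ n)"
proof -
  have sub: "cball (0::real^'n) R \<subseteq> ball 0 1" using R by auto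
  have fm: "f \<in> borel_measurable (lebesgue_on (ball 0 1))"
    and fi: "set_integrable lebesgue (cball 0 R) (\<lambda>x. \<bar>f x\<bar> powr real n)"
    using f sub by (auto simp: Lp_loc_def)
  have f1: "(\<lambda>x. indicator (ball 0 1) x *\<^sub>R f x) \<in> borel_measurable lebesgue"
    using fm by (subst (asm) borel_measurable_restrict_space_iff) auto
  obtain g0 where g0: "g0 \<in> borel_measurable borel" "AE x in lborel. indicator (ball 0 1) x *\<^sub>R f x = g0 x"
    using completion_ex_borel_measurable_real[OF f1] by auto
  define g where "g x = indicator (cball 0 R) x * g0 x" for x
  have gm[measurable]: "g \<in> borel_measurable borel" unfolding g_def using g0(1)
    by (intro borel_measurable_times borel_measurable_indicator borel_closed) auto
  have ae: "AE x in lebesgue. norm x \<le> R \<longrightarrow> g x = f x"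
    using AE_completion[OF g0(2)] by eventually_elim (use R in \<open>auto simp: g_def indicator_def split: if_splits\<close>)
  have z: "norm x > R \<Longrightarrow> g x = 0" for x by (simp add: g_def)
  have "(\<integral>\<^sup>+x. ennreal (\<bar>g x\<bar> ^ n) \<partial>lborel) = (\<integral>\<^sup>+x. ennreal (\<bar>g x\<bar> ^ n) \<partial>lebesgue)"
    by (simp add: nn_integral_completion)
  also have "\<dots> = (\<integral>\<^sup>+x. ennreal (norm (indicator (cball 0 R) x *\<^sub>R (\<bar>f x\<bar> powr real n))) \<partial>lebesgue)"
  proof (rule nn_integral_cong_AE)
    show "AE x in lebesgue. ennreal (\<bar>g x\<bar> ^ n) = ennreal (norm (indicator (cball 0 R) x *\<^sub>R (\<bar>f x\<bar> powr real n)))"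
      using ae
    proof eventually_elim
      case (elim x)
      show ?case
      proof (cases "norm x \<le> R")
        case True
        have "\<bar>f x\<bar> ^ n = \<bar>f x\<bar> powr real n" using n by (cases "f x = 0") (auto simp: powr_realpow power_0_left)
        thus ?thesis using True elim by simp
      qed (use z[of x] n in \<open>simp add: power_0_left\<close>)
    qed
  qed
  also have "\<dots> < \<infinity>" using fi unfolding set_integrable_def integrable_iff_bounded by blast
  finally have "integrable lborel (\<lambda>x. \<bar>g x\<bar> ^ n)" by (intro integrableI_nonneg) auto
  thus ?thesis using gm z ae unfolding borel_cutoff_def by blast
qed

lemma integral_against_cutoff:
  fixes f g \<kappa> :: "real^'n::finite \<Rightarrow> real"
  assumes f: "f \<in> borel_measurable (lebesgue_on (ball 0 1))" and g: "borel_cutoff R f g" and R: "R < 1"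
    and \<kappa>[measurable]: "\<kappa> \<in> borel_measurable borel" and \<kappa>0: "\<And>y. norm y > R \<Longrightarrow> \<kappa> y = 0"
  shows "(LINT y|lebesgue_on (ball 0 1). f y * \<kappa> y) = (\<integral>y. g y * \<kappa> y \<partial>lborel)"
proof -
  have gm[measurable]: "g \<in> borel_measurable borel" using g by (simp add: borel_cutoff_def)
  have \<kappa>l: "\<kappa> \<in> borel_measurable lebesgue" using \<kappa> by (intro measurable_completion) simp
  have f\<kappa>: "(\<lambda>y. f y * \<kappa> y) \<in> borel_measurable (lebesgue_on (ball 0 1))"
    by (intro borel_measurable_times f measurable_restrict_space1 \<kappa>l)
  have "(LINT y|lebesgue_on (ball 0 1). f y * \<kappa> y) = (LINT y|lebesgue. indicator (ball 0 1) y *\<^sub>R (f y * \<kappa> y))"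
    by (rule integral_restrict_space) auto
  also have "\<dots> = (LINT y|lebesgue. g y * \<kappa> y)"
  proof (rule integral_cong_AE)
    show "(\<lambda>y. indicator (ball 0 1) y *\<^sub>R (f y * \<kappa> y)) \<in> borel_measurable lebesgue"
      using f\<kappa> by (subst (asm) borel_measurable_restrict_space_iff) auto
    show "(\<lambda>y. g y * \<kappa> y) \<in> borel_measurable lebesgue" by (rule measurable_completion) simp
    have "AE x in lebesgue. norm x \<le> R \<longrightarrow> g x = f x" using g by (simp add: borel_cutoff_def)
    thus "AE y in lebesgue. indicator (ball 0 1) y *\<^sub>R (f y * \<kappa> y) = g y * \<kappa> y"
    proof eventually_elim
      case (elim y)
      thus ?case using \<kappa>0[of y] R by (cases "norm y \<le> R") auto
    qed
  qed
  also have "\<dots> = (\<integral>y. g y * \<kappa> y \<partial>lborel)" by (rule integral_completion) simp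
  finally show ?thesis .
qed

lemma reflected_has_derivative:
  fixes \<eta> :: "real^'n::finite \<Rightarrow> real"
  assumes "(\<eta> has_derivative D) (at (x - y))"
  shows "((\<lambda>y. a * \<eta> (x - y)) has_derivative (\<lambda>v. a * D (- v))) (at y)"
proof -
  have "((\<lambda>y. x - y) has_derivative (\<lambda>v. - v)) (at y)" by (auto intro!: derivative_eq_intros)
  from has_derivative_compose[OF this assms] show ?thesis by (rule has_derivative_mult_right)
qed

lemma Ck_reflect:
  fixes \<eta> :: "real^'n::finite \<Rightarrow> real"
  shows "Ck k \<eta> \<Longrightarrow> Ck k (\<lambda>y. a * \<eta> (x - y))"
proof (induction k arbitrary: \<eta> a)
  case 0
  have "continuous_on UNIV (\<lambda>y. \<eta> (x - y))"
    by (rule continuous_on_compose2[of UNIV \<eta>]) (use 0 in \<open>auto intro!: continuous_intros\<close>)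
  thus ?case by (auto intro!: continuous_intros)
next
  case (Suc k)
  have d: "(\<eta> has_derivative frechet_derivative \<eta> (at z)) (at z)" for z
    using Suc.prems by (simp add: frechet_derivative_works)
  note r = reflected_has_derivative[OF d, of a x]
  have "partial_deriv i (\<lambda>y. a * \<eta> (x - y)) = (\<lambda>y. (- a) * partial_deriv i \<eta> (x - y))" for i
  proof
    fix y
    have "frechet_derivative \<eta> (at (x - y)) (- axis i 1) = - frechet_derivative \<eta> (at (x - y)) (axis i 1)"
      by (rule linear_neg[OF has_derivative_linear[OF d]])
    thus "partial_deriv i (\<lambda>y. a * \<eta> (x - y)) y = (- a) * partial_deriv i \<eta> (x - y)"
      by (simp add: partial_derivI[OF r] partial_deriv_def)
  qed
  moreover have "Ck k (partial_deriv i \<eta>)" for i using Suc.prems by simp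
  ultimately have "Ck k (partial_deriv i (\<lambda>y. a * \<eta> (x - y)))" for i
    by (simp only: Suc.IH)
  moreover have "(\<lambda>y. a * \<eta> (x - y)) differentiable (at y)" for y
    unfolding differentiable_def by (rule exI) (rule r)
  ultimately show ?case by simp
qed

text \<open>For \<open>x\<close> far enough from the boundary, \<open>y \<mapsto> \<kappa> (x - y)\<close> is a test function in the ball, and
inserting it into the definition of the weak derivative moves the derivative from the kernel to the
function.\<close>

lemma weak_derivative_conv:
  fixes f k \<kappa> :: "real^'n::finite \<Rightarrow> real"
  assumes w: "weak_partial_deriv (ball 0 1) i f k" and F: "borel_cutoff R f F" and G: "borel_cutoff R k G"
    and R: "R < 1" and \<kappa>: "\<kappa> \<in> test_functions UNIV" and \<delta>: "\<And>z. norm z > \<delta> \<Longrightarrow> \<kappa> z = 0" and x: "norm x + \<delta> \<le> R"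
  shows "conv F (partial_deriv i \<kappa>) x = conv G \<kappa> x"
proof -
  define \<phi> where "\<phi> y = 1 * \<kappa> (x - y)" for y
  have far: "norm (x - y) > \<delta>" if "norm y > R" for y
    using norm_triangle_ineq2[of y x] x that by (simp add: norm_minus_commute)
  have "closure {y. \<phi> y \<noteq> 0} \<subseteq> cball 0 R"
    using \<delta> far by (intro closure_minimal) (force simp: \<phi>_def not_less[symmetric])+
  moreover have "cball (0::real^'n) R \<subseteq> ball 0 1" using R by auto
  ultimately have \<phi>s: "closure {y. \<phi> y \<noteq> 0} \<subseteq> ball 0 1" "compact (closure {y. \<phi> y \<noteq> 0})"
    by (auto simp: compact_eq_bounded_closed intro: bounded_subset[OF bounded_cball])
  moreover have "Ck j \<phi>" for j unfolding \<phi>_def using \<kappa> by (intro Ck_reflect) (simp add: test_functions_def)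
  ultimately have \<phi>: "\<phi> \<in> test_functions (ball 0 1)" by (simp add: test_functions_def)
  have pd: "partial_deriv i \<phi> y = - partial_deriv i \<kappa> (x - y)" for y
    unfolding \<phi>_def
    by (subst partial_derivI[OF reflected_has_derivative[OF test_function_has_derivative[OF \<kappa>]]])
      (simp add: axis_def sum_negf if_distrib[of "\<lambda>t. t * _"] cong: if_cong)
  have meas: "(\<lambda>y. \<theta> (x - y)) \<in> borel_measurable borel" if "\<theta> \<in> test_functions UNIV" for \<theta> :: "real^'n \<Rightarrow> real"
  proof -
    have [measurable]: "\<theta> \<in> borel_measurable borel"
      by (rule borel_measurable_continuous_onI[OF test_function_continuous[OF that]])
    show ?thesis by measurable
  qed
  have wf: "f \<in> borel_measurable (lebesgue_on (ball 0 1))" "k \<in> borel_measurable (lebesgue_on (ball 0 1))"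
    and eq: "(LINT y|lebesgue_on (ball 0 1). f y * partial_deriv i \<phi> y) = - (LINT y|lebesgue_on (ball 0 1). k y * \<phi> y)"
    using w \<phi> by (auto simp: weak_partial_deriv_def Lp_loc_def)
  have "(LINT y|lebesgue_on (ball 0 1). f y * - partial_deriv i \<kappa> (x - y)) = (\<integral>y. F y * - partial_deriv i \<kappa> (x - y) \<partial>lborel)"
    using meas[OF test_function_partial_deriv[OF \<kappa>]] far partial_deriv_zero_outside[of \<delta> \<kappa>, OF \<delta>]
    by (intro integral_against_cutoff[OF wf(1) F R]) auto
  moreover have "(LINT y|lebesgue_on (ball 0 1). k y * \<phi> y) = (\<integral>y. G y * \<phi> y \<partial>lborel)"
    using meas[OF \<kappa>] far \<delta> by (intro integral_against_cutoff[OF wf(2) G R]) (auto simp: \<phi>_def)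
  ultimately show ?thesis using eq by (simp add: pd conv_def \<phi>_def)
qed

lemma has_derivative_vec_lambda:
  fixes f :: "'n::finite \<Rightarrow> 'a::real_normed_vector \<Rightarrow> real"
  assumes "\<And>i. (f i has_derivative D i) F"
  shows "((\<lambda>x. \<chi> i. f i x) has_derivative (\<lambda>v. \<chi> i. D i v)) F"
proof -
  have "((\<lambda>x. \<Sum>i\<in>UNIV. f i x *\<^sub>R axis i (1::real)) has_derivative (\<lambda>v. \<Sum>i\<in>UNIV. D i v *\<^sub>R axis i 1)) F"
    by (intro has_derivative_sum has_derivative_scaleR_left assms)
  moreover have "(\<Sum>i\<in>UNIV. g i *\<^sub>R axis i (1::real)) = (\<chi> i. g i)" for g :: "'n \<Rightarrow> real"
    by (simp add: vec_eq_iff axis_def if_distrib[of "\<lambda>t. _ * t"] cong: if_cong)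
  ultimately show ?thesis by simp
qed

text \<open>The approximations are mollifications of cutoffs. Inside the smaller ball their derivatives are the
mollifications of the weak derivatives, and their Hessians are symmetric because both orders of
differentiation can be shifted onto the kernel.\<close>

proposition W2_loc_smooth_approximation:
  fixes u :: "real^'n::finite \<Rightarrow> real"
  assumes W: "has_W2_loc_derivs (real CARD('n)) (ball 0 1) u Du D2u"
    and cu: "continuous_on (cball 0 1) u" and r: "r < 1" and h: "h > 0"
  obtains v q H where
    "\<And>m y. y \<in> ball 0 r \<Longrightarrow> (v m has_derivative (\<lambda>w. q m y \<bullet> w)) (at y)"
    "\<And>m y. y \<in> ball 0 r \<Longrightarrow> (q m has_derivative (\<lambda>w. H m y *v w)) (at y)"
    "\<And>m y. y \<in> ball 0 r \<Longrightarrow> transpose (H m y) = H m y"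
    "\<And>m A. continuous_on A (v m)" "\<And>m A. continuous_on A (q m)" "\<And>m A. continuous_on A (H m)"
    "\<And>m y. y \<in> cball 0 r \<Longrightarrow> \<bar>v m y - u y\<bar> \<le> h"
    "AE y in lebesgue. y \<in> ball 0 r \<longrightarrow> (\<lambda>m. q m y) \<longlonglongrightarrow> Du y \<and> (\<lambda>m. H m y) \<longlonglongrightarrow> D2u y"
    "\<exists>w\<in>borel_measurable borel. (\<integral>\<^sup>+x. w x \<partial>lborel) < \<infinity> \<and>
       (\<forall>m y. ennreal ((\<Sum>i\<in>UNIV. \<bar>q m y $ i\<bar> ^ CARD('n)) + (\<Sum>i\<in>UNIV. \<Sum>j\<in>UNIV. \<bar>H m y $ i $ j\<bar> ^ CARD('n))) \<le> w y)"
proof -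
  let ?n = "CARD('n)"
  have n: "?n \<ge> 1" by (simp add: Suc_leI)
  define R where "R = max 0 ((1 + r) / 2)"
  have R: "r < R" "R < 1" using r by (auto simp: R_def less_max_iff_disj)
  have Lu: "u \<in> Lp_loc (real ?n) (ball 0 1)" and LD: "\<And>i. (\<lambda>x. Du x $ i) \<in> Lp_loc (real ?n) (ball 0 1)"
    and LH: "\<And>i j. (\<lambda>x. D2u x $ i $ j) \<in> Lp_loc (real ?n) (ball 0 1)"
    and wD: "\<And>i. weak_partial_deriv (ball 0 1) i u (\<lambda>x. Du x $ i)"
    and wH: "\<And>i j. weak_partial_deriv (ball 0 1) i (\<lambda>x. Du x $ j) (\<lambda>x. D2u x $ i $ j)"
    using W by (auto simp: has_W2_loc_derivs_def)
  obtain U where U: "borel_cutoff R u U" "integrable lborel (\<lambda>x. \<bar>U x\<bar> ^ ?n)"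
    using borel_cutoff_exists[OF Lu n R(2)] by blast
  obtain Dc where Dc: "\<And>i. borel_cutoff R (\<lambda>x. Du x $ i) (Dc i)" "\<And>i. integrable lborel (\<lambda>x. \<bar>Dc i x\<bar> ^ ?n)"
    using borel_cutoff_exists[OF LD n R(2)] by metis
  obtain Hc where Hc: "\<And>i j. borel_cutoff R (\<lambda>x. D2u x $ i $ j) (Hc i j)" "\<And>i j. integrable lborel (\<lambda>x. \<bar>Hc i j x\<bar> ^ ?n)"
    using borel_cutoff_exists[OF LH n R(2)] by metis
  have cut_int: "integrable lborel g" if "borel_cutoff R f g" "integrable lborel (\<lambda>x. \<bar>g x\<bar> ^ ?n)" for f g :: "real^'n \<Rightarrow> real"
    using that n by (intro integrable_of_power_integrable[of g R ?n]) (auto simp: borel_cutoff_def)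
  note iU = cut_int[OF U] and iD = cut_int[OF Dc] and iH = cut_int[OF Hc]
  have "uniformly_continuous_on (cball 0 1) u" by (intro compact_uniformly_continuous cu) auto
  then obtain \<delta>1 where \<delta>1: "\<delta>1 > 0" "\<And>x y. x \<in> cball 0 1 \<Longrightarrow> y \<in> cball 0 1 \<Longrightarrow> dist y x < \<delta>1 \<Longrightarrow> dist (u y) (u x) < h"
    using h unfolding uniformly_continuous_on_def by metis
  define \<delta> where "\<delta> = min \<delta>1 (R - r)"
  have \<delta>: "\<delta> > 0" "\<delta> \<le> \<delta>1" "r + \<delta> \<le> R" using \<delta>1 R by (auto simp: \<delta>_def)
  define \<F> where "\<F> = range Dc \<union> range (\<lambda>(i, j). Hc i j)"
  have fin: "finite \<F>" by (simp add: \<F>_def)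
  have \<F>: "f \<in> borel_measurable borel \<and> (\<forall>x. norm x > R \<longrightarrow> f x = 0) \<and> integrable lborel (\<lambda>x. \<bar>f x\<bar> ^ ?n)" if "f \<in> \<F>" for f
    using that Dc Hc by (auto simp: \<F>_def borel_cutoff_def)
  obtain \<eta> :: "nat \<Rightarrow> real^'n \<Rightarrow> real" where \<eta>: "\<And>m. mollifier \<delta> (\<eta> m)"
    and conv: "\<And>f. f \<in> \<F> \<Longrightarrow> AE x in lborel. (\<lambda>m. conv f (\<eta> m) x) \<longlonglongrightarrow> f x"
    and dom: "\<And>f. f \<in> \<F> \<Longrightarrow> \<exists>w\<in>borel_measurable borel. (\<integral>\<^sup>+x. w x \<partial>lborel) < \<infinity> \<and> (\<forall>m x. ennreal (\<bar>conv f (\<eta> m) x\<bar> ^ ?n) \<le> w x)"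
    by (rule mollifier_sequence[OF fin n \<delta>(1) \<F>], assumption, rule that, assumption+)
  have t: "\<eta> m \<in> test_functions UNIV" for m by (rule mollifier_props[OF \<eta>])
  have \<eta>0: "\<eta> m z = 0" if "norm z > \<delta>" for m z using mollifier_props(3)[OF \<eta>, of z m] that by simp
  have pd0: "partial_deriv i (\<eta> m) z = 0" if "norm z > \<delta>" for m z i
    by (rule partial_deriv_zero_outside[OF \<eta>0 that])
  define v where "v m = conv U (\<eta> m)" for m
  define q where "q m y = (\<chi> i. conv (Dc i) (\<eta> m) y)" for m y
  define H where "H m y = (\<chi> i j. conv (Hc i j) (\<eta> m) y)" for m y
  have near: "norm y + \<delta> \<le> R" if "y \<in> ball 0 r" for y using that \<delta> by auto
  have dU: "conv U (partial_deriv i (\<eta> m)) y = conv (Dc i) (\<eta> m) y" if "y \<in> ball 0 r" for i m y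
    by (rule weak_derivative_conv[OF wD U(1) Dc(1) R(2) t \<eta>0 near[OF that]])
  have dD: "conv (Dc j) (partial_deriv i (\<eta> m)) y = conv (Hc i j) (\<eta> m) y" if "y \<in> ball 0 r" for i j m y
    by (rule weak_derivative_conv[OF wH Dc(1) Hc(1) R(2) t \<eta>0 near[OF that]])
  have dD': "conv U (partial_deriv j (partial_deriv i (\<eta> m))) y = conv (Dc j) (partial_deriv i (\<eta> m)) y"
    if "y \<in> ball 0 r" for i j m y
    by (rule weak_derivative_conv[OF wD U(1) Dc(1) R(2) test_function_partial_deriv[OF t] pd0 near[OF that]])
  have sym: "conv (Hc i j) (\<eta> m) y = conv (Hc j i) (\<eta> m) y" if "y \<in> ball 0 r" for i j m y
  proof -
    have "partial_deriv j (partial_deriv i (\<eta> m)) = partial_deriv i (partial_deriv j (\<eta> m))"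
      using \<eta>[of m] by (simp add: mollifier_def)
    thus ?thesis using dD[OF that] dD'[OF that] by metis
  qed
  have cc: "continuous_on A (conv U (\<eta> m))" "continuous_on A (conv (Dc i) (\<eta> m))" "continuous_on A (conv (Hc i j) (\<eta> m))"
    for A m i j by (intro conv_measurable iU iD iH t)+
  show ?thesis
  proof (rule that[of v q H])
    fix m :: nat and y :: "real^'n" assume y: "y \<in> ball 0 r"
    show "(v m has_derivative (\<lambda>w. q m y \<bullet> w)) (at y)"
      using conv_has_derivative[OF iU t, of m y] by (simp add: v_def q_def inner_vec_def dU[OF y] mult.commute)
    have "(q m has_derivative (\<lambda>w. \<chi> i. \<Sum>j\<in>UNIV. w $ j * conv (Dc i) (partial_deriv j (\<eta> m)) y)) (at y)"
      unfolding q_def by (intro has_derivative_vec_lambda conv_has_derivative iD t)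
    also have "(\<lambda>w. \<chi> i. \<Sum>j\<in>UNIV. w $ j * conv (Dc i) (partial_deriv j (\<eta> m)) y) = (\<lambda>w. H m y *v w)"
    proof (rule ext)
      fix w
      have "(\<Sum>j\<in>UNIV. w $ j * conv (Dc i) (partial_deriv j (\<eta> m)) y) = (H m y *v w) $ i" for i
      proof -
        have e: "w $ j * conv (Dc i) (partial_deriv j (\<eta> m)) y = conv (Hc i j) (\<eta> m) y * w $ j" for j
          using dD[OF y, of i j m] dD[OF y, of j i m] sym[OF y, of i j m] by simp
        show ?thesis unfolding e by (simp add: H_def matrix_vector_mult_def)
      qed
      thus "(\<chi> i. \<Sum>j\<in>UNIV. w $ j * conv (Dc i) (partial_deriv j (\<eta> m)) y) = H m y *v w"
        by (simp add: vec_eq_iff)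
    qed
    finally show "(q m has_derivative (\<lambda>w. H m y *v w)) (at y)" .
    show "transpose (H m y) = H m y" using sym[OF y] by (simp add: H_def transpose_def vec_eq_iff)
  next
    show "continuous_on A (v m)" "continuous_on A (q m)" "continuous_on A (H m)" for m A
      unfolding v_def q_def H_def by (intro continuous_intros cc)+
  next
    fix m :: nat and y :: "real^'n" assume y: "y \<in> cball 0 r"
    have "AE z in lborel. norm z \<le> R \<longrightarrow> U z = u z" using U(1) by (simp add: borel_cutoff_def AE_completion_iff)
    hence ae: "AE z in lborel. norm (y - z) < \<delta> \<longrightarrow> \<bar>U z - u y\<bar> \<le> h"
    proof eventually_elim
      case (elim z)
      show ?case
      proof
        assume z: "norm (y - z) < \<delta>"
        hence "norm z \<le> R" using y \<delta>(3) norm_triangle_ineq2[of z y] by (auto simp: norm_minus_commute)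
        moreover have "dist (u z) (u y) < h"
          using z y \<delta>(2) R calculation by (intro \<delta>1(2)) (auto simp: dist_norm norm_minus_commute)
        ultimately show "\<bar>U z - u y\<bar> \<le> h" using elim by (simp add: dist_real_def)
      qed
    qed
    show "\<bar>v m y - u y\<bar> \<le> h" unfolding v_def by (rule conv_close_to_const[OF \<eta> iU ae])
  next
    have aeD: "AE y in lebesgue. y \<in> ball 0 r \<longrightarrow> (\<lambda>m. conv (Dc i) (\<eta> m) y) \<longlonglongrightarrow> Du y $ i" for i
    proof -
      have "AE y in lebesgue. (\<lambda>m. conv (Dc i) (\<eta> m) y) \<longlonglongrightarrow> Dc i y"
        by (rule AE_completion[OF conv]) (simp add: \<F>_def)
      moreover have "AE x in lebesgue. norm x \<le> R \<longrightarrow> Dc i x = Du x $ i" using Dc(1)[of i] by (simp add: borel_cutoff_def)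
      ultimately show ?thesis by eventually_elim (use R in auto)
    qed
    have aeH: "AE y in lebesgue. y \<in> ball 0 r \<longrightarrow> (\<lambda>m. conv (Hc i j) (\<eta> m) y) \<longlonglongrightarrow> D2u y $ i $ j" for i j
    proof -
      have "AE y in lebesgue. (\<lambda>m. conv (Hc i j) (\<eta> m) y) \<longlonglongrightarrow> Hc i j y"
        by (rule AE_completion[OF conv]) (auto simp: \<F>_def)
      moreover have "AE x in lebesgue. norm x \<le> R \<longrightarrow> Hc i j x = D2u x $ i $ j" using Hc(1)[of i j] by (simp add: borel_cutoff_def)
      ultimately show ?thesis by eventually_elim (use R in auto)
    qed
    have "AE y in lebesgue. \<forall>i\<in>(UNIV::'n set). y \<in> ball 0 r \<longrightarrow> (\<lambda>m. conv (Dc i) (\<eta> m) y) \<longlonglongrightarrow> Du y $ i"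
      by (rule AE_finite_allI[OF finite aeD])
    moreover have "AE y in lebesgue. \<forall>p\<in>(UNIV::('n \<times> 'n) set). y \<in> ball 0 r \<longrightarrow> (\<lambda>m. conv (Hc (fst p) (snd p)) (\<eta> m) y) \<longlonglongrightarrow> D2u y $ fst p $ snd p"
      by (rule AE_finite_allI[OF finite aeH])
    ultimately show "AE y in lebesgue. y \<in> ball 0 r \<longrightarrow> (\<lambda>m. q m y) \<longlonglongrightarrow> Du y \<and> (\<lambda>m. H m y) \<longlonglongrightarrow> D2u y"
    proof eventually_elim
      case (elim y)
      show ?case
      proof (intro impI conjI)
        assume y: "y \<in> ball 0 r"
        show "(\<lambda>m. q m y) \<longlonglongrightarrow> Du y" by (rule vec_tendstoI) (use elim(1) y in \<open>simp add: q_def\<close>)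
        show "(\<lambda>m. H m y) \<longlonglongrightarrow> D2u y"
          by (intro vec_tendstoI) (use elim(2) y in \<open>simp add: H_def\<close>)
      qed
    qed
  next
    obtain w where w: "\<And>f. f \<in> \<F> \<Longrightarrow> w f \<in> borel_measurable borel" "\<And>f. f \<in> \<F> \<Longrightarrow> (\<integral>\<^sup>+x. w f x \<partial>lborel) < \<infinity>"
      "\<And>f m x. f \<in> \<F> \<Longrightarrow> ennreal (\<bar>conv f (\<eta> m) x\<bar> ^ ?n) \<le> w f x" using dom by metis
    have FD: "Dc i \<in> \<F>" and FH: "Hc i j \<in> \<F>" for i j by (auto simp: \<F>_def)
    define W where "W x = (\<Sum>i\<in>UNIV. w (Dc i) x) + (\<Sum>i\<in>UNIV. \<Sum>j\<in>UNIV. w (Hc i j) x)" for x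
    have [measurable]: "w (Dc i) \<in> borel_measurable borel" "w (Hc i j) \<in> borel_measurable borel" for i j
      using w(1) FD FH by auto
    have "W \<in> borel_measurable borel" unfolding W_def by measurable
    moreover have "(\<integral>\<^sup>+x. W x \<partial>lborel) < \<infinity>"
    proof -
      have "(\<integral>\<^sup>+x. W x \<partial>lborel) = (\<Sum>i\<in>UNIV. \<integral>\<^sup>+x. w (Dc i) x \<partial>lborel) + (\<Sum>i\<in>UNIV. \<Sum>j\<in>UNIV. \<integral>\<^sup>+x. w (Hc i j) x \<partial>lborel)"
        unfolding W_def by (simp add: nn_integral_add nn_integral_sum)
      thus ?thesis using w(2)[OF FD] w(2)[OF FH] by simp
    qed
    moreover have "ennreal ((\<Sum>i\<in>UNIV. \<bar>q m y $ i\<bar> ^ ?n) + (\<Sum>i\<in>UNIV. \<Sum>j\<in>UNIV. \<bar>H m y $ i $ j\<bar> ^ ?n)) \<le> W y" for m y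
    proof -
      have "ennreal ((\<Sum>i\<in>UNIV. \<bar>q m y $ i\<bar> ^ ?n) + (\<Sum>i\<in>UNIV. \<Sum>j\<in>UNIV. \<bar>H m y $ i $ j\<bar> ^ ?n))
        = (\<Sum>i\<in>UNIV. ennreal (\<bar>q m y $ i\<bar> ^ ?n)) + (\<Sum>i\<in>UNIV. \<Sum>j\<in>UNIV. ennreal (\<bar>H m y $ i $ j\<bar> ^ ?n))"
        by (simp add: sum_ennreal sum_nonneg flip: ennreal_plus)
      also have "\<dots> \<le> W y" unfolding W_def q_def H_def
        by (intro add_mono sum_mono) (auto intro: w(3) FD FH)
      finally show ?thesis .
    qed
    ultimately show "\<exists>w\<in>borel_measurable borel. (\<integral>\<^sup>+x. w x \<partial>lborel) < \<infinity> \<and>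
       (\<forall>m y. ennreal ((\<Sum>i\<in>UNIV. \<bar>q m y $ i\<bar> ^ ?n) + (\<Sum>i\<in>UNIV. \<Sum>j\<in>UNIV. \<bar>H m y $ i $ j\<bar> ^ ?n)) \<le> w y)"
      by blast
  qed
qed

section \<open>The contact estimate for weakly differentiable functions\<close>

lemma drift_quotient_bound:
  fixes q :: "real^'n::finite"
  shows "\<bar>q $ i * q $ j / norm q\<bar> \<le> \<bar>q $ i\<bar>"
proof (cases "q = 0")
  case False
  have "\<bar>q $ i * q $ j / norm q\<bar> = \<bar>q $ i\<bar> * (\<bar>q $ j\<bar> / norm q)" by (simp add: abs_mult)
  also have "\<dots> \<le> \<bar>q $ i\<bar> * 1"
    using False component_le_norm_cart[of q j] by (intro mult_left_mono) (auto simp: divide_le_eq_1)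
  finally show ?thesis by simp
qed simp

lemma tendsto_drift_quotient:
  fixes q :: "'a \<Rightarrow> real^'n::finite"
  assumes q: "(q \<longlongrightarrow> q0) F"
  shows "((\<lambda>x. q x $ i * q x $ j / norm (q x)) \<longlongrightarrow> q0 $ i * q0 $ j / norm q0) F"
proof (cases "q0 = 0")
  case False
  thus ?thesis by (intro tendsto_intros q) simp
next
  case True
  have lim: "((\<lambda>x. norm (q x)) \<longlongrightarrow> 0) F" using tendsto_norm[OF q] True by simp
  have "\<bar>q x $ i * q x $ j / norm (q x)\<bar> \<le> norm (q x)" for x
    using drift_quotient_bound[of "q x" i j] component_le_norm_cart[of "q x" i] by linarith
  hence "((\<lambda>x. q x $ i * q x $ j / norm (q x)) \<longlongrightarrow> 0) F"
    by (intro Lim_null_comparison[OF _ lim] always_eventually) simp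
  thus ?thesis using True by simp
qed

text \<open>The only singular point is \<open>q = 0\<close>, where \<open>q q\<^sup>T / |q|\<close> is bounded by \<open>|q|\<close>.\<close>

lemma tendsto_drift_hessian:
  fixes q :: "'a \<Rightarrow> real^'n::finite"
  assumes "(q \<longlongrightarrow> q0) F" "(H \<longlongrightarrow> H0) F"
  shows "((\<lambda>x. drift_hessian K (q x) (H x)) \<longlongrightarrow> drift_hessian K q0 H0) F"
proof (intro vec_tendstoI)
  fix i j
  have "((\<lambda>x. - H x $ i $ j - K * (q x $ i * q x $ j / norm (q x))) \<longlongrightarrow> - H0 $ i $ j - K * (q0 $ i * q0 $ j / norm q0)) F"
    by (intro tendsto_intros tendsto_drift_quotient assms)
  thus "((\<lambda>x. drift_hessian K (q x) (H x) $ i $ j) \<longlongrightarrow> drift_hessian K q0 H0 $ i $ j) F"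
    by (simp add: drift_hessian_def)
qed

lemma tendsto_det:
  fixes A :: "'a \<Rightarrow> real^'n::finite^'n"
  assumes "(A \<longlongrightarrow> A0) F"
  shows "((\<lambda>x. det (A x)) \<longlongrightarrow> det A0) F"
  unfolding det_def by (intro tendsto_intros assms)

lemma psd_det_measurable: "(psd_det :: real^'n::finite^'n \<Rightarrow> real) \<in> borel_measurable borel"
proof -
  let ?S = "{A :: real^'n^'n. transpose A = A \<and> nonneg_definite A}"
  have "continuous_on UNIV (det :: real^'n^'n \<Rightarrow> real)"
    unfolding continuous_on_def by (auto intro: tendsto_det)
  hence "(det :: real^'n^'n \<Rightarrow> real) \<in> borel_measurable borel" by (rule borel_measurable_continuous_onI)
  hence "(\<lambda>A :: real^'n^'n. indicator ?S A * det A) \<in> borel_measurable borel"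
    using closed_psd by (intro borel_measurable_times borel_measurable_indicator borel_closed) auto
  moreover have "psd_det = (\<lambda>A :: real^'n^'n. indicator ?S A * det A)"
    by (auto simp: psd_det_def fun_eq_iff)
  ultimately show ?thesis by simp
qed

text \<open>If the limit matrix lies in the cone, its determinant is nonnegative and is approached by the
absolute values of the determinants; otherwise the matrices leave the closed cone eventually.\<close>

lemma psd_det_limsup:
  fixes A :: "nat \<Rightarrow> real^'n::finite^'n"
  assumes A: "A \<longlonglongrightarrow> A0" and C: "C \<ge> 0"
  shows "limsup (\<lambda>m. ennreal C * ennreal (psd_det (A m))) \<le> ennreal C * ennreal (psd_det A0)"
proof (cases "transpose A0 = A0 \<and> nonneg_definite A0")
  case True
  have "(\<lambda>m. C * \<bar>det (A m)\<bar>) \<longlonglongrightarrow> C * \<bar>det A0\<bar>" by (intro tendsto_intros tendsto_det A)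
  moreover have "\<bar>det A0\<bar> = psd_det A0" using True psd_det_nonneg[of A0] by (simp add: psd_det_def)
  ultimately have lim: "(\<lambda>m. ennreal (C * \<bar>det (A m)\<bar>)) \<longlonglongrightarrow> ennreal (C * psd_det A0)"
    by (simp add: tendsto_ennrealI)
  have "limsup (\<lambda>m. ennreal C * ennreal (psd_det (A m))) \<le> limsup (\<lambda>m. ennreal (C * \<bar>det (A m)\<bar>))"
  proof (intro Limsup_mono always_eventually allI)
    fix m
    have "psd_det (A m) \<le> \<bar>det (A m)\<bar>" by (auto simp: psd_det_def)
    hence "ennreal (C * psd_det (A m)) \<le> ennreal (C * \<bar>det (A m)\<bar>)" by (intro ennreal_leI mult_left_mono C)
    thus "ennreal C * ennreal (psd_det (A m)) \<le> ennreal (C * \<bar>det (A m)\<bar>)"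
      by (simp add: ennreal_mult C psd_det_nonneg)
  qed
  also have "\<dots> = ennreal (C * psd_det A0)" by (rule lim_imp_Limsup[OF _ lim]) simp
  finally show ?thesis using C psd_det_nonneg[of A0] by (simp add: ennreal_mult)
next
  case False
  have "\<forall>\<^sub>F m in sequentially. A m \<in> - {A. transpose A = A \<and> nonneg_definite A}"
    by (rule topological_tendstoD[OF A open_Compl[OF closed_psd]]) (use False in auto)
  hence "\<forall>\<^sub>F m in sequentially. 0 = ennreal C * ennreal (psd_det (A m))"
    by eventually_elim (auto simp: psd_det_def)
  hence "(\<lambda>m. ennreal C * ennreal (psd_det (A m))) \<longlonglongrightarrow> 0" by (rule Lim_transform_eventually[OF tendsto_const])
  hence "limsup (\<lambda>m. ennreal C * ennreal (psd_det (A m))) = 0" by (intro lim_imp_Limsup) auto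
  thus ?thesis by simp
qed

text \<open>The bound supplies the dominating function for the reverse Fatou lemma.\<close>

lemma psd_det_drift_hessian_le:
  fixes q :: "real^'n::finite" and H :: "real^'n^'n"
  assumes K: "K \<ge> 0"
  shows "psd_det (drift_hessian K q H) \<le> fact CARD('n) * (1 + K) ^ CARD('n) *
    ((\<Sum>i\<in>UNIV. \<bar>q $ i\<bar> ^ CARD('n)) + (\<Sum>i\<in>UNIV. \<Sum>j\<in>UNIV. \<bar>H $ i $ j\<bar> ^ CARD('n)))"
proof -
  let ?n = "CARD('n)"
  define S where "S = (\<Sum>i\<in>UNIV. \<bar>q $ i\<bar> ^ ?n) + (\<Sum>i\<in>UNIV. \<Sum>j\<in>UNIV. \<bar>H $ i $ j\<bar> ^ ?n)"
  define t where "t = root ?n S"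
  have S0: "S \<ge> 0" by (simp add: S_def sum_nonneg)
  have tn: "t ^ ?n = S" using S0 by (simp add: t_def)
  have root_le: "x \<le> t" if "x \<ge> 0" "x ^ ?n \<le> S" for x
  proof -
    have "root ?n (x ^ ?n) \<le> t" unfolding t_def using that by (intro real_root_le_mono) auto
    thus ?thesis using that by (simp add: real_root_power_cancel)
  qed
  have qt: "\<bar>q $ i\<bar> \<le> t" for i
  proof (rule root_le)
    have "\<bar>q $ i\<bar> ^ ?n \<le> (\<Sum>i\<in>UNIV. \<bar>q $ i\<bar> ^ ?n)" by (rule member_le_sum) auto
    thus "\<bar>q $ i\<bar> ^ ?n \<le> S" by (simp add: S_def sum_nonneg add_increasing2)
  qed simp
  have Ht: "\<bar>H $ i $ j\<bar> \<le> t" for i j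
  proof (rule root_le)
    have "\<bar>H $ i $ j\<bar> ^ ?n \<le> (\<Sum>j\<in>UNIV. \<bar>H $ i $ j\<bar> ^ ?n)" by (rule member_le_sum) auto
    also have "\<dots> \<le> (\<Sum>i\<in>UNIV. \<Sum>j\<in>UNIV. \<bar>H $ i $ j\<bar> ^ ?n)"
      by (rule member_le_sum[of i UNIV "\<lambda>i. \<Sum>j\<in>UNIV. \<bar>H $ i $ j\<bar> ^ ?n"]) (auto simp: sum_nonneg)
    finally show "\<bar>H $ i $ j\<bar> ^ ?n \<le> S" by (simp add: S_def sum_nonneg add_increasing)
  qed simp
  have "\<bar>drift_hessian K q H $ i $ j\<bar> \<le> (1 + K) * t" for i j
  proof -
    have "\<bar>K * (q $ i * q $ j / norm q)\<bar> \<le> K * t"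
      unfolding abs_mult using K drift_quotient_bound[of q i j] qt[of i] by (intro mult_mono) auto
    moreover have "drift_hessian K q H $ i $ j = - H $ i $ j - K * (q $ i * q $ j / norm q)"
      by (simp add: drift_hessian_def)
    ultimately have "\<bar>drift_hessian K q H $ i $ j\<bar> \<le> \<bar>H $ i $ j\<bar> + K * t" by linarith
    thus ?thesis using Ht[of i j] by (simp add: distrib_right)
  qed
  hence "\<bar>det (drift_hessian K q H)\<bar> \<le> fact ?n * ((1 + K) * t) ^ ?n" by (rule abs_det_le_entry_bound)
  hence "\<bar>det (drift_hessian K q H)\<bar> \<le> fact ?n * (1 + K) ^ ?n * S" by (simp add: power_mult_distrib tn)
  moreover have "psd_det (drift_hessian K q H) \<le> \<bar>det (drift_hessian K q H)\<bar>" by (auto simp: psd_det_def)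
  ultimately show ?thesis by (simp add: S_def)
qed

text \<open>The estimate for smooth functions holds for all mollifications with the same set \<open>E\<close> of integration,
because closeness of \<open>v\<close> to \<open>u\<close> was built into it. The upper limit of the right-hand sides is
bounded by the reverse Fatou lemma.\<close>

proposition slope_region_le_W2:
  fixes u :: "real^'n::finite \<Rightarrow> real"
  assumes K: "K > 0" and r: "r < 1" and e: "e \<in> ball 0 r" and h: "h > 0"
    and W: "has_W2_loc_derivs (real CARD('n)) (ball 0 1) u Du D2u" and cu: "continuous_on (cball 0 1) u"
    and bdry: "\<And>y. y \<in> sphere 0 r \<Longrightarrow> u y \<le> u e - h" and s: "s \<le> u e - h"
  shows "emeasure lborel {p. norm p + p \<bullet> e \<le> exp (- 2 * K) * (h / 2)}
    \<le> (\<integral>\<^sup>+y. ennreal (contact_const K CARD('n)) * (indicator {y \<in> ball 0 r. s < u y} y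
          * ennreal (psd_det (drift_hessian K (Du y) (D2u y)))) \<partial>lebesgue)"
proof -
  let ?n = "CARD('n)"
  have h16: "h / 16 > 0" using h by simp
  obtain v q H where
    dv: "\<And>m y. y \<in> ball 0 r \<Longrightarrow> (v m has_derivative (\<lambda>w. q m y \<bullet> w)) (at y)"
    and dq: "\<And>m y. y \<in> ball 0 r \<Longrightarrow> (q m has_derivative (\<lambda>w. H m y *v w)) (at y)"
    and sym: "\<And>m y. y \<in> ball 0 r \<Longrightarrow> transpose (H m y) = H m y"
    and cv: "\<And>(m::nat) A. continuous_on A (v m)" and cq: "\<And>m A. continuous_on A (q m)" and cH: "\<And>m A. continuous_on A (H m)"
    and close: "\<And>m y. y \<in> cball 0 r \<Longrightarrow> \<bar>v m y - u y\<bar> \<le> h / 16"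
    and lim: "AE y in lebesgue. y \<in> ball 0 r \<longrightarrow> (\<lambda>m. q m y) \<longlonglongrightarrow> Du y \<and> (\<lambda>m. H m y) \<longlonglongrightarrow> D2u y"
    and dom: "\<exists>w\<in>borel_measurable borel. (\<integral>\<^sup>+x. w x \<partial>lborel) < \<infinity> \<and>
       (\<forall>m y. ennreal ((\<Sum>i\<in>UNIV. \<bar>q m y $ i\<bar> ^ CARD('n)) + (\<Sum>i\<in>UNIV. \<Sum>j\<in>UNIV. \<bar>H m y $ i $ j\<bar> ^ CARD('n))) \<le> w y)"
    by (rule W2_loc_smooth_approximation[OF W cu r h16], rule that, assumption+)
  obtain w where w: "w \<in> borel_measurable borel" "(\<integral>\<^sup>+x. w x \<partial>lborel) < \<infinity>"
    "\<And>m y. ennreal ((\<Sum>i\<in>UNIV. \<bar>q m y $ i\<bar> ^ ?n) + (\<Sum>i\<in>UNIV. \<Sum>j\<in>UNIV. \<bar>H m y $ i $ j\<bar> ^ ?n)) \<le> w y"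
    using dom by blast
  define E where "E = {y \<in> ball 0 r. s < u y}"
  define C where "C = contact_const K ?n"
  define a where "a m y = ennreal C * (indicator E y * ennreal (psd_det (drift_hessian K (q m y) (H m y))))" for m y
  have oE: "open E"
  proof -
    have "open (ball 0 r \<inter> u -` {s<..})"
      by (rule continuous_open_preimage[OF continuous_on_subset[OF cu]]) (use r in auto)
    also have "ball 0 r \<inter> u -` {s<..} = E" by (auto simp: E_def)
    finally show ?thesis .
  qed
  have cA: "continuous_on UNIV (\<lambda>y. drift_hessian K (q m y) (H m y))" for m
    unfolding continuous_on_def
    by (intro ballI tendsto_drift_hessian) (use cq[of UNIV m] cH[of UNIV m] in \<open>auto simp: continuous_on_def\<close>)
  have am: "a m \<in> borel_measurable lborel" for m
  proof -
    have [measurable]: "(\<lambda>y. psd_det (drift_hessian K (q m y) (H m y))) \<in> borel_measurable borel"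
      using measurable_compose[OF borel_measurable_continuous_onI[OF cA] psd_det_measurable] .
    have [measurable]: "E \<in> sets borel" using oE by simp
    have "a m \<in> borel_measurable borel" unfolding a_def by measurable
    thus ?thesis by simp
  qed
  define D where "D = ennreal C * ennreal (fact ?n * (1 + K) ^ ?n)"
  have aw: "a m y \<le> D * w y" for m y
  proof -
    have "ennreal (psd_det (drift_hessian K (q m y) (H m y))) \<le> ennreal (fact ?n * (1 + K) ^ ?n *
      ((\<Sum>i\<in>UNIV. \<bar>q m y $ i\<bar> ^ ?n) + (\<Sum>i\<in>UNIV. \<Sum>j\<in>UNIV. \<bar>H m y $ i $ j\<bar> ^ ?n)))"
      using K by (intro ennreal_leI psd_det_drift_hessian_le) simp
    also have "\<dots> = ennreal (fact ?n * (1 + K) ^ ?n) *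
      ennreal ((\<Sum>i\<in>UNIV. \<bar>q m y $ i\<bar> ^ ?n) + (\<Sum>i\<in>UNIV. \<Sum>j\<in>UNIV. \<bar>H m y $ i $ j\<bar> ^ ?n))"
      using K by (intro ennreal_mult) (auto intro!: add_nonneg_nonneg sum_nonneg)
    also have "\<dots> \<le> ennreal (fact ?n * (1 + K) ^ ?n) * w y" by (intro mult_left_mono w) simp
    finally have "indicator E y * ennreal (psd_det (drift_hessian K (q m y) (H m y))) \<le> 1 * (ennreal (fact ?n * (1 + K) ^ ?n) * w y)"
      by (intro mult_mono) (auto simp: indicator_def)
    thus ?thesis unfolding a_def D_def by (simp add: mult.assoc mult_left_mono)
  qed
  have Dw: "(\<integral>\<^sup>+y. D * w y \<partial>lborel) < \<infinity>"
    using w by (subst nn_integral_cmult) (auto simp: D_def ennreal_mult_less_top)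
  have "emeasure lborel {p. norm p + p \<bullet> e \<le> exp (- 2 * K) * (h / 2)} \<le> (\<integral>\<^sup>+y. a m y \<partial>lborel)" for m
    unfolding a_def E_def C_def
    by (rule slope_region_le_psd_det_integral[OF K r e h dv dq sym cH continuous_on_subset[OF cu] cv close bdry s])
      (use r in auto)
  hence "emeasure lborel {p. norm p + p \<bullet> e \<le> exp (- 2 * K) * (h / 2)} \<le> limsup (\<lambda>m. \<integral>\<^sup>+y. a m y \<partial>lborel)"
    by (intro le_Limsup always_eventually) auto
  also have "\<dots> \<le> (\<integral>\<^sup>+y. limsup (\<lambda>m. a m y) \<partial>lborel)"
    by (rule nn_integral_limsup[OF am _ _ Dw]) (use aw w(1) in auto)
  also have "\<dots> = (\<integral>\<^sup>+y. limsup (\<lambda>m. a m y) \<partial>lebesgue)" by (simp add: nn_integral_completion)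
  also have "\<dots> \<le> (\<integral>\<^sup>+y. ennreal C * (indicator E y * ennreal (psd_det (drift_hessian K (Du y) (D2u y)))) \<partial>lebesgue)"
  proof (rule nn_integral_mono_AE)
    show "AE y in lebesgue. limsup (\<lambda>m. a m y) \<le> ennreal C * (indicator E y * ennreal (psd_det (drift_hessian K (Du y) (D2u y))))"
      using lim
    proof eventually_elim
      case (elim y)
      show ?case
      proof (cases "y \<in> E")
        case True
        hence y: "y \<in> ball 0 r" by (simp add: E_def)
        have C: "C \<ge> 0" using K by (simp add: C_def contact_const_def)
        have "limsup (\<lambda>m. a m y) = limsup (\<lambda>m. ennreal C * ennreal (psd_det (drift_hessian K (q m y) (H m y))))"
          unfolding a_def using True by simp
        also have "\<dots> \<le> ennreal C * ennreal (psd_det (drift_hessian K (Du y) (D2u y)))"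
          using elim y by (intro psd_det_limsup tendsto_drift_hessian C) auto
        finally show ?thesis using True by simp
      next
        case False
        hence "(\<lambda>m. a m y) = (\<lambda>m. 0)" by (simp add: a_def)
        thus ?thesis by (simp add: Limsup_const)
      qed
    qed
  qed
  finally show ?thesis by (simp add: E_def C_def)
qed

text \<open>The drift satisfies \<open>b \<bullet> q \<le> K \<mu> |q| \<le> K (q \<bullet> a q) / |q|\<close>, where \<open>\<mu>\<close> is the smallest eigenvalue, and
is outweighed by the term \<open>(K + 1) (q \<bullet> a q) / |q|\<close> that the correction subtracts from \<open>tr (a A)\<close>.
Thus \<open>tr (a A) \<le> - L\<close>. The rate \<open>K + 1\<close> is positive also for \<open>K = 0\<close>, as the profiles require. If \<open>det a = 0\<close>, the right-hand side is infinite unless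
\<open>L \<ge> 0\<close>, and then the trace inequality forces the left-hand side to vanish.\<close>

lemma psd_det_le_quotient:
  fixes a :: "real^'n::finite^'n" and D2 :: "real^'n^'n" and b q :: "real^'n"
  assumes a: "transpose a = a" "nonneg_definite a" "trace a > 0"
    and K: "K \<ge> 0" and b: "norm b \<le> K * smallest_eigenvalue a" and cu: "c \<ge> 0" "t \<ge> 0"
    and L: "L = (\<Sum>i\<in>UNIV. \<Sum>j\<in>UNIV. a $ i $ j * D2 $ i $ j) + (\<Sum>i\<in>UNIV. b $ i * q $ i) - c * t"
  shows "ennreal (psd_det (drift_hessian (K + 1) q D2)) \<le> ennreal ((if L < 0 then 1 else 0) * \<bar>L\<bar> ^ CARD('n)) / ennreal (det a)"
proof (cases "transpose (drift_hessian (K + 1) q D2) = drift_hessian (K + 1) q D2 \<and> nonneg_definite (drift_hessian (K + 1) q D2)")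
  case True
  define A where "A = drift_hessian (K + 1) q D2"
  have A: "transpose A = A" "nonneg_definite A" using True by (auto simp: A_def)
  let ?n = "CARD('n)"
  have n: "?n \<ge> 1" by (simp add: Suc_leI)
  have tr: "trace (a ** A) = - (\<Sum>i\<in>UNIV. \<Sum>j\<in>UNIV. a $ i $ j * D2 $ i $ j) - (K + 1) * (q \<bullet> (a *v q)) / norm q"
  proof -
    have "trace (a ** A) = (\<Sum>i\<in>UNIV. \<Sum>j\<in>UNIV. a $ i $ j * A $ j $ i)"
      by (simp add: trace_def matrix_matrix_mult_def)
    also have "\<dots> = (\<Sum>i\<in>UNIV. \<Sum>j\<in>UNIV. a $ i $ j * A $ i $ j)"
    proof (intro sum.cong refl)
      fix i j
      have "A $ j $ i = A $ i $ j" using A(1) by (metis transpose_def vec_lambda_beta)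
      thus "a $ i $ j * A $ j $ i = a $ i $ j * A $ i $ j" by simp
    qed
    also have "\<dots> = (\<Sum>i\<in>UNIV. \<Sum>j\<in>UNIV. - (a $ i $ j * D2 $ i $ j) - (K + 1) / norm q * (q $ i * (a $ i $ j * q $ j)))"
      by (intro sum.cong refl) (simp add: A_def drift_hessian_def algebra_simps)
    also have "\<dots> = - (\<Sum>i\<in>UNIV. \<Sum>j\<in>UNIV. a $ i $ j * D2 $ i $ j) - (K + 1) / norm q * (q \<bullet> (a *v q))"
      by (simp add: sum_subtractf sum_negf inner_vec_def matrix_vector_mult_def sum_distrib_left)
    finally show ?thesis by simp
  qed
  have bq: "(\<Sum>i\<in>UNIV. b $ i * q $ i) \<le> (K + 1) * (q \<bullet> (a *v q)) / norm q"
  proof (cases "q = 0")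
    case False
    have X: "smallest_eigenvalue a * (norm q)\<^sup>2 \<le> q \<bullet> (a *v q)" by (rule smallest_eigenvalue_le_rayleigh[OF a(1)])
    have X0: "0 \<le> q \<bullet> (a *v q)" using a(2) by (simp add: nonneg_definite_def)
    have "(\<Sum>i\<in>UNIV. b $ i * q $ i) = b \<bullet> q" by (simp add: inner_vec_def)
    also have "\<dots> \<le> norm b * norm q" by (rule norm_cauchy_schwarz)
    also have "\<dots> \<le> (K * smallest_eigenvalue a) * norm q" using b by (intro mult_right_mono) auto
    also have "\<dots> \<le> (K + 1) * (q \<bullet> (a *v q)) / norm q"
    proof -
      have "K * smallest_eigenvalue a * (norm q)\<^sup>2 \<le> (K + 1) * (q \<bullet> (a *v q))"
      proof -
        have "K * smallest_eigenvalue a * (norm q)\<^sup>2 \<le> K * (q \<bullet> (a *v q))"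
          using mult_left_mono[OF X K] by (simp add: mult.assoc)
        thus ?thesis using X0 by (simp add: distrib_right)
      qed
      thus ?thesis using False by (simp add: field_simps power2_eq_square)
    qed
    finally show ?thesis .
  qed simp
  have trL: "trace (a ** A) \<le> - L" using tr bq L cu mult_nonneg_nonneg[OF cu] by linarith
  note D = det_mul_le_trace_mul_power[OF a(1,2) A]
  have L0: "L \<le> 0" using D(1) trL by linarith
  have pd: "psd_det A = det A" using A by (simp add: psd_det_def)
  have deta: "det a \<ge> 0" by (rule det_le_trace_power(1)[OF a(1,2)])
  show ?thesis
  proof (cases "L = 0")
    case True
    hence "det A = 0" using D(3)[OF a(3)] trL by simp
    thus ?thesis by (simp add: A_def[symmetric] pd)
  next
    case False
    hence L: "L < 0" using L0 by simp
    show ?thesis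
    proof (cases "det a = 0")
      case True
      have "ennreal ((if L < 0 then 1 else 0) * \<bar>L\<bar> ^ ?n) / ennreal (det a) = top"
        using L True by (simp add: ennreal_divide_zero)
      thus ?thesis by simp
    next
      case False
      hence pos: "det a > 0" using deta by simp
      have "det a * det A \<le> (trace (a ** A) / ?n) ^ ?n" by (rule D(2))
      also have "\<dots> \<le> \<bar>L\<bar> ^ ?n"
      proof (rule power_mono)
        have "trace (a ** A) / ?n \<le> trace (a ** A)" using D(1) n by (simp add: divide_le_eq mult_le_cancel_left1)
        thus "trace (a ** A) / ?n \<le> \<bar>L\<bar>" using trL L by simp
      qed (use D(1) in simp)
      finally have "det A \<le> \<bar>L\<bar> ^ ?n / det a" using pos by (simp add: field_simps)
      hence "ennreal (det A) \<le> ennreal (\<bar>L\<bar> ^ ?n / det a)" by (rule ennreal_leI)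
      also have "\<dots> = ennreal (\<bar>L\<bar> ^ ?n) / ennreal (det a)" using pos by (simp add: divide_ennreal)
      finally show ?thesis using L by (simp add: A_def[symmetric] pd)
    qed
  qed
next
  case False
  hence "psd_det (drift_hessian (K + 1) q D2) = 0" unfolding psd_det_def by (rule if_not_P)
  thus ?thesis by simp
qed

section \<open>The weighted maximum principle\<close>

text \<open>The exponent \<open>\<beta>\<close>.\<close>

definition abp_exponent :: "real \<Rightarrow> nat \<Rightarrow> real" where
  "abp_exponent \<alpha> n = (real n + 1 - 2 * \<alpha>) / (2 * real n)"

text \<open>The quotient \<open>\<eta> / (t \<epsilon>^\<beta>)\<close> of the parameters described at the beginning.\<close>

definition abp_scale :: "real \<Rightarrow> nat \<Rightarrow> real \<Rightarrow> real" where
  "abp_scale \<alpha> n K = exp (- 2 * K) * ((1 - 2 powr (- abp_exponent \<alpha> n)) / 2)"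

lemma contact_const_pos: "K \<ge> 0 \<Longrightarrow> contact_const K n > 0"
  unfolding contact_const_def by (intro mult_pos_pos zero_less_power) auto

lemma weighted_integrand_measurable:
  fixes a :: "real^'n \<Rightarrow> real^'n::finite^'n"
  assumes a: "a \<in> borel_measurable (lebesgue_on (ball 0 1))"
    and b: "b \<in> borel_measurable (lebesgue_on (ball 0 1))" and c: "c \<in> borel_measurable (lebesgue_on (ball 0 1))"
    and W: "has_W2_loc_derivs p (ball 0 1) u Du D2u"
  shows "(\<lambda>x. ennreal (psi x powr \<alpha>) *
    (ennreal (indicator {y. diff_op a b c u Du D2u y < 0} x * \<bar>diff_op a b c u Du D2u x\<bar> ^ n) / ennreal (det (a x))))
    \<in> borel_measurable (lebesgue_on (ball 0 1))"
proof -
  let ?M = "lebesgue_on (ball (0::real^'n) 1)"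
  have nth: "(\<lambda>x. f x $ i) \<in> borel_measurable ?M" if "f \<in> borel_measurable ?M"
    for f :: "real^'n \<Rightarrow> real^'n" and i
    by (rule measurable_compose[OF that borel_measurable_continuous_onI]) (intro continuous_intros)
  have nth2: "(\<lambda>x. f x $ i $ j) \<in> borel_measurable ?M" if "f \<in> borel_measurable ?M"
    for f :: "real^'n \<Rightarrow> real^'n^'n" and i j
    by (rule measurable_compose[OF that borel_measurable_continuous_onI]) (intro continuous_intros)
  have [measurable]: "(\<lambda>x. a x $ i $ j) \<in> borel_measurable ?M" "(\<lambda>x. b x $ i) \<in> borel_measurable ?M" for i j
    using nth2[OF a] nth[OF b] by auto
  have [measurable]: "c \<in> borel_measurable ?M" by (rule c)
  have [measurable]: "u \<in> borel_measurable ?M" "(\<lambda>x. Du x $ i) \<in> borel_measurable ?M"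
    "(\<lambda>x. D2u x $ i $ j) \<in> borel_measurable ?M" for i j
    using W by (auto simp: has_W2_loc_derivs_def Lp_loc_def)
  have [measurable]: "diff_op a b c u Du D2u \<in> borel_measurable ?M"
    unfolding diff_op_def[abs_def] by measurable
  have [measurable]: "(\<lambda>x. det (a x)) \<in> borel_measurable ?M"
    unfolding det_def by measurable
  have "(\<lambda>x::real^'n. x) \<in> borel_measurable ?M"
    by (intro measurable_restrict_space1 measurable_completion) simp
  hence [measurable]: "psi \<in> borel_measurable ?M" unfolding psi_def[abs_def] by measurable
  have [measurable]: "(\<lambda>x. indicator {y. diff_op a b c u Du D2u y < 0} x :: real) \<in> borel_measurable ?M"
  proof -
    have "(\<lambda>x. if diff_op a b c u Du D2u x < 0 then 1 else 0 :: real) \<in> borel_measurable ?M" by measurable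
    moreover have "(\<lambda>x. indicator {y. diff_op a b c u Du D2u y < 0} x :: real)
        = (\<lambda>x. if diff_op a b c u Du D2u x < 0 then 1 else 0)" by (auto simp: indicator_def)
    ultimately show ?thesis by simp
  qed
  show ?thesis by measurable
qed

text \<open>On the ball \<open>\<psi> > \<psi>(e)/2\<close> the weight is bounded below by its value on the boundary, which is why the
weight may be inserted at the price of the factor \<open>(\<psi>(e)/2)^(-\<alpha>)\<close>.\<close>

lemma slope_region_le_weighted_integral:
  fixes u :: "real^'n::finite \<Rightarrow> real"
  assumes a: "a \<in> borel_measurable (lebesgue_on (ball 0 1))"
      "\<And>x. x \<in> ball 0 1 \<Longrightarrow> transpose (a x) = a x \<and> nonneg_definite (a x) \<and> trace (a x) > 0"
    and K: "K \<ge> 0" and b: "b \<in> borel_measurable (lebesgue_on (ball 0 1))"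
      "\<And>x. x \<in> ball 0 1 \<Longrightarrow> norm (b x) \<le> K * smallest_eigenvalue (a x)"
    and c: "c \<in> borel_measurable (lebesgue_on (ball 0 1))" "\<And>x. x \<in> ball 0 1 \<Longrightarrow> 0 \<le> c x"
    and W: "has_W2_loc_derivs (real CARD('n)) (ball 0 1) u Du D2u" and cu: "continuous_on (cball 0 1) u"
    and \<alpha>: "\<alpha> \<ge> 0" and e: "e \<in> ball 0 1" and h: "h > 0"
    and bdry: "\<And>y. psi y = psi e / 2 \<Longrightarrow> u y \<le> u e - h" and s: "0 \<le> s" "s \<le> u e - h"
  shows "emeasure lborel {p. norm p + p \<bullet> e \<le> exp (- 2 * (K + 1)) * (h / 2)}
    \<le> ennreal (contact_const (K + 1) CARD('n) / (psi e / 2) powr \<alpha>) * weighted_integral \<alpha> a (diff_op a b c u Du D2u)"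
proof -
  let ?n = "CARD('n)" and ?L = "diff_op a b c u Du D2u"
  define \<epsilon> where "\<epsilon> = psi e"
  have "(norm e)\<^sup>2 < 1" using e by (simp add: abs_square_less_1)
  hence \<epsilon>: "0 < \<epsilon>" "\<epsilon> \<le> 1" "(norm e)\<^sup>2 = 1 - \<epsilon>" by (auto simp: \<epsilon>_def psi_def)
  \<comment> \<open>the sphere of radius \<open>r\<close> is the level set \<open>\<psi> = \<epsilon>/2\<close>\<close>
  define r where "r = sqrt (1 - \<epsilon> / 2)"
  have r2: "r\<^sup>2 = 1 - \<epsilon> / 2" and r0: "r \<ge> 0" and r1: "r < 1" using \<epsilon> by (auto simp: r_def)
  have er: "e \<in> ball 0 r" using \<epsilon> by (auto simp: r_def intro: real_less_rsqrt)
  have br: "u y \<le> u e - h" if "y \<in> sphere 0 r" for y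
    using that r2 by (intro bdry) (simp add: psi_def[of y] \<epsilon>_def[symmetric])
  define C where "C = contact_const (K + 1) ?n"
  have C: "C > 0" unfolding C_def using K by (intro contact_const_pos) simp
  define k where "k = (\<epsilon> / 2) powr \<alpha>"
  have k: "k > 0" using \<epsilon> by (simp add: k_def)
  define E where "E = {y \<in> ball 0 r. s < u y}"
  define G where "G x = ennreal (psi x powr \<alpha>) * (ennreal (indicator {y. ?L y < 0} x * \<bar>?L x\<bar> ^ ?n) / ennreal (det (a x)))" for x
  define f where "f y = ennreal C * (indicator E y * ennreal (psd_det (drift_hessian (K + 1) (Du y) (D2u y))))" for y
  have EB: "E \<subseteq> ball 0 1" using r1 by (auto simp: E_def)
  have "emeasure lborel {p. norm p + p \<bullet> e \<le> exp (- 2 * (K + 1)) * (h / 2)} \<le> (\<integral>\<^sup>+y. f y \<partial>lebesgue)"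
    unfolding f_def C_def E_def by (rule slope_region_le_W2[OF _ r1 er h W cu br s(2)]) (use K in simp_all)
  also have "\<dots> = (\<integral>\<^sup>+y. f y * indicator (ball 0 1) y \<partial>lebesgue)"
    using EB by (intro nn_integral_cong) (auto simp: f_def indicator_def)
  also have "\<dots> = (\<integral>\<^sup>+y. f y \<partial>lebesgue_on (ball 0 1))" by (rule nn_integral_restrict_space[symmetric]) simp
  also have "\<dots> \<le> (\<integral>\<^sup>+y. ennreal (C / k) * G y \<partial>lebesgue_on (ball 0 1))"
  proof (rule nn_integral_mono)
    fix y :: "real^'n"
    show "f y \<le> ennreal (C / k) * G y"
    proof (cases "y \<in> E")
      case True
      hence y: "y \<in> ball 0 1" "norm y < r" "u y \<ge> 0" using EB s by (auto simp: E_def)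
      have "(norm y)\<^sup>2 \<le> r\<^sup>2" using y(2) by (intro power_mono) auto
      hence psi: "psi y \<ge> \<epsilon> / 2" by (simp add: psi_def r2)
      hence "k \<le> psi y powr \<alpha>" using \<epsilon> \<alpha> by (auto simp: k_def intro: powr_mono2)
      hence "(C / k) * k \<le> (C / k) * psi y powr \<alpha>" using C k by (intro mult_left_mono) auto
      hence "C \<le> (C / k) * psi y powr \<alpha>" using k by simp
      hence Ck: "ennreal C \<le> ennreal (C / k) * ennreal (psi y powr \<alpha>)"
        using C k by (subst ennreal_mult[symmetric]) (auto intro: ennreal_leI)
      have ay: "transpose (a y) = a y" "nonneg_definite (a y)" "trace (a y) > 0" using a(2)[OF y(1)] by auto
      have "ennreal (psd_det (drift_hessian (K + 1) (Du y) (D2u y)))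
          \<le> ennreal ((if ?L y < 0 then 1 else 0) * \<bar>?L y\<bar> ^ ?n) / ennreal (det (a y))"
        by (rule psd_det_le_quotient[OF ay K b(2)[OF y(1)] c(2)[OF y(1)] y(3)]) (simp add: diff_op_def)
      hence "f y \<le> ennreal C * (ennreal (indicator {y. ?L y < 0} y * \<bar>?L y\<bar> ^ ?n) / ennreal (det (a y)))"
        unfolding f_def using True by (auto simp: indicator_def intro: mult_left_mono)
      also have "\<dots> \<le> (ennreal (C / k) * ennreal (psi y powr \<alpha>)) * (ennreal (indicator {y. ?L y < 0} y * \<bar>?L y\<bar> ^ ?n) / ennreal (det (a y)))"
        by (intro mult_right_mono Ck) simp
      finally show ?thesis by (simp add: G_def mult.assoc)
    qed (simp add: f_def)
  qed
  also have "\<dots> = ennreal (C / k) * (\<integral>\<^sup>+y. G y \<partial>lebesgue_on (ball 0 1))"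
    unfolding G_def by (rule nn_integral_cmult[OF weighted_integrand_measurable[OF a(1) b(1) c(1) W]])
  also have "(\<integral>\<^sup>+y. G y \<partial>lebesgue_on (ball 0 1)) = weighted_integral \<alpha> a ?L"
    by (simp add: weighted_integral_def G_def)
  finally show ?thesis by (simp add: C_def k_def \<epsilon>_def)
qed

lemma measure_unit_ball_pos: "measure lborel (cball (0::real^'n::finite) 1) > 0"
proof -
  have "emeasure lborel (ball (0::real^'n) 1) \<noteq> 0"
  proof
    assume "emeasure lborel (ball (0::real^'n) 1) = 0"
    hence "negligible (ball (0::real^'n) 1)" by (simp add: negligible_iff_null_sets null_sets_def)
    thus False using open_not_negligible[of "ball (0::real^'n) 1"] by simp
  qed
  moreover have "emeasure lborel (ball (0::real^'n) 1) \<le> emeasure lborel (cball (0::real^'n) 1)"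
    by (intro emeasure_mono) auto
  ultimately have "emeasure lborel (cball (0::real^'n) 1) \<noteq> 0" by auto
  thus ?thesis using emeasure_bounded_finite[of "cball (0::real^'n) 1"]
    by (simp add: measure_def enn2real_positive_iff zero_less_iff_neq_zero less_top)
qed

text \<open>The choice of the point \<open>e\<close> and the cancellation of the powers of \<open>\<epsilon> = \<psi>(e)\<close> take place here.\<close>

lemma interior_estimate:
  fixes u :: "real^'n::finite \<Rightarrow> real"
  assumes a: "a \<in> borel_measurable (lebesgue_on (ball 0 1))"
      "\<And>x. x \<in> ball 0 1 \<Longrightarrow> transpose (a x) = a x \<and> nonneg_definite (a x) \<and> trace (a x) > 0"
    and K: "K \<ge> 0" and b: "b \<in> borel_measurable (lebesgue_on (ball 0 1))"
      "\<And>x. x \<in> ball 0 1 \<Longrightarrow> norm (b x) \<le> K * smallest_eigenvalue (a x)"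
    and c: "c \<in> borel_measurable (lebesgue_on (ball 0 1))" "\<And>x. x \<in> ball 0 1 \<Longrightarrow> 0 \<le> c x"
    and W: "has_W2_loc_derivs (real CARD('n)) (ball 0 1) u Du D2u" and cu: "continuous_on (cball 0 1) u"
    and \<alpha>: "0 \<le> \<alpha>" "\<alpha> < (real CARD('n) + 1) / 2"
    and x0: "x0 \<in> ball 0 1" and s: "0 \<le> s" "\<And>x. x \<in> sphere 0 1 \<Longrightarrow> u x \<le> s" and us: "s < u x0"
    and w: "weighted_integral \<alpha> a (diff_op a b c u Du D2u) = ennreal w" "w \<ge> 0"
  shows "u x0 \<le> s + 2 * root CARD('n) (contact_const (K + 1) CARD('n) * 2 powr \<alpha> /
      (measure lborel (cball (0::real^'n) 1) * abp_scale \<alpha> CARD('n) (K + 1) ^ CARD('n)))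
    * psi x0 powr abp_exponent \<alpha> CARD('n) * root CARD('n) w"
proof -
  let ?n = "CARD('n)"
  define \<beta> where "\<beta> = abp_exponent \<alpha> ?n"
  have \<beta>: "\<beta> > 0" using \<alpha> by (simp add: \<beta>_def abp_exponent_def)
  have \<beta>n: "\<beta> * real ?n = (real ?n + 1) / 2 - \<alpha>" by (simp add: \<beta>_def abp_exponent_def field_simps)
  have psi_pos: "psi y > 0" if "y \<in> ball 0 1" for y :: "real^'n" using that by (simp add: psi_def abs_square_less_1)
  have psi_nn: "psi y \<ge> 0" if "y \<in> cball 0 1" for y :: "real^'n" using that by (simp add: psi_def abs_square_le_1)
  define A where "A = psi x0 powr \<beta>"
  have A: "A > 0" using psi_pos[OF x0] by (simp add: A_def)
  have den: "A + psi y powr \<beta> > 0" for y using A by (simp add: add_pos_nonneg)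
  define F where "F y = (u y - s) / (A + psi y powr \<beta>)" for y
  have "continuous_on (cball 0 1) (\<lambda>y :: real^'n. psi y powr \<beta>)"
    unfolding psi_def by (intro continuous_on_powr' continuous_intros) (use \<beta> psi_nn in \<open>auto simp: psi_def\<close>)
  hence cF: "continuous_on (cball 0 1) F" unfolding F_def
    using den by (intro continuous_on_divide continuous_on_diff continuous_on_add cu continuous_on_const)
      (auto simp: less_le)
  have "\<exists>e\<in>cball 0 1. \<forall>y\<in>cball 0 1. F y \<le> F e"
    by (rule continuous_attains_sup[OF compact_cball _ cF]) simp
  then obtain e where ec: "e \<in> cball 0 1" and emax: "\<And>y. y \<in> cball 0 1 \<Longrightarrow> F y \<le> F e" by blast
  define t where "t = F e"
  have Fx0: "F x0 > 0" unfolding F_def using us den[of x0] by (intro divide_pos_pos) auto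
  have Ft: "F y \<le> t" if "y \<in> cball 0 1" for y unfolding t_def by (rule emax[OF that])
  have t: "t > 0" using Fx0 Ft[of x0] x0 by simp
  have ule: "u y \<le> s + t * (A + psi y powr \<beta>)" if "y \<in> cball 0 1" for y
    using Ft[OF that] den[of y] by (simp add: F_def pos_divide_le_eq)
  have ue: "u e = s + t * (A + psi e powr \<beta>)"
    using den[of e] unfolding t_def F_def by simp
  have eb: "e \<in> ball 0 1"
  proof (rule ccontr)
    assume "e \<notin> ball 0 1"
    hence "u e \<le> s" using ec s(2)[of e] by auto
    hence "F e \<le> 0" unfolding F_def using den[of e] by (intro divide_nonpos_pos) auto
    thus False using t by (simp add: t_def)
  qed
  define \<epsilon> where "\<epsilon> = psi e"
  have \<epsilon>: "\<epsilon> > 0" using psi_pos[OF eb] by (simp add: \<epsilon>_def)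
  define g where "g = 1 - 2 powr (- \<beta>)"
  have "2 powr (- \<beta>) < 2 powr 0" using \<beta> by (intro powr_less_mono) auto
  hence g: "g > 0" by (simp add: g_def)
  define h where "h = t * g * \<epsilon> powr \<beta>"
  have h: "h > 0" using t g \<epsilon> by (simp add: h_def)
  have half: "(\<epsilon> / 2) powr \<beta> = \<epsilon> powr \<beta> * (1 - g)"
  proof -
    have "(\<epsilon> / 2) powr \<beta> = \<epsilon> powr \<beta> / 2 powr \<beta>" by (rule powr_divide)
    moreover have "1 - g = 2 powr (- \<beta>)" by (simp add: g_def)
    moreover have "2 powr (- \<beta>) = 1 / 2 powr \<beta>" by (rule powr_minus_divide)
    ultimately show ?thesis by (simp only: times_divide_eq_right mult_1_right)
  qed
  have ueh: "u e - h = s + t * (A + (\<epsilon> / 2) powr \<beta>)"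
    unfolding h_def ue \<epsilon>_def[symmetric] half by (simp add: algebra_simps)
  have bdry: "u y \<le> u e - h" if "psi y = psi e / 2" for y
  proof -
    have py: "psi y = \<epsilon> / 2" using that by (simp only: \<epsilon>_def)
    hence "psi y \<ge> 0" using \<epsilon> by linarith
    hence "y \<in> cball 0 1" by (simp add: psi_def abs_square_le_1)
    from ule[OF this] show ?thesis unfolding ueh py .
  qed
  have sle: "s \<le> u e - h" unfolding ueh using t A by simp
  define \<eta> where "\<eta> = exp (- 2 * (K + 1)) * (h / 2)"
  have \<eta>: "\<eta> > 0" using h by (simp add: \<eta>_def)
  define C where "C = contact_const (K + 1) ?n"
  have C: "C > 0" unfolding C_def using K by (intro contact_const_pos) simp
  define \<kappa> where "\<kappa> = measure lborel (cball (0::real^'n) 1)"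
  have \<kappa>: "\<kappa> > 0" unfolding \<kappa>_def by (rule measure_unit_ball_pos)
  have \<kappa>e: "emeasure lborel (cball (0::real^'n) 1) = ennreal \<kappa>"
    using emeasure_bounded_finite[of "cball (0::real^'n) 1"] by (simp add: \<kappa>_def emeasure_eq_ennreal_measure less_top)
  define S where "S = abp_scale \<alpha> ?n (K + 1)"
  have S: "S > 0" using g by (simp add: S_def abp_scale_def g_def \<beta>_def)
  have \<eta>S: "\<eta> = S * t * \<epsilon> powr \<beta>"
    by (simp add: \<eta>_def h_def S_def abp_scale_def g_def \<beta>_def)
  have ne: "norm e < 1" using eb by simp
  have X0: "C / (\<epsilon> / 2) powr \<alpha> \<ge> 0" using C by simp
  have "ennreal (\<kappa> * \<eta> ^ ?n) = emeasure lborel (cball (0::real^'n) 1) * ennreal (\<eta> ^ ?n)"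
    using \<kappa> \<eta> by (simp add: \<kappa>e ennreal_mult)
  also have "\<dots> \<le> emeasure lborel {p. norm p + p \<bullet> e \<le> \<eta>} * ennreal (\<epsilon> powr ((real ?n + 1) / 2))"
    using emeasure_slope_region_ge[OF ne \<eta>] by (simp add: \<epsilon>_def psi_def)
  also have "\<dots> \<le> (ennreal (C / (\<epsilon> / 2) powr \<alpha>) * ennreal w) * ennreal (\<epsilon> powr ((real ?n + 1) / 2))"
    using slope_region_le_weighted_integral[OF a K b c W cu \<alpha>(1) eb h bdry s(1) sle]
    unfolding w(1) \<eta>_def C_def \<epsilon>_def by (intro mult_right_mono) auto
  also have "\<dots> = ennreal (C / (\<epsilon> / 2) powr \<alpha> * w * \<epsilon> powr ((real ?n + 1) / 2))"
    by (simp only: ennreal_mult mult_nonneg_nonneg[OF X0 w(2)] X0 w(2) powr_ge_zero)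
  finally have "\<kappa> * \<eta> ^ ?n \<le> C / (\<epsilon> / 2) powr \<alpha> * w * \<epsilon> powr ((real ?n + 1) / 2)"
    by (subst (asm) ennreal_le_iff[OF mult_nonneg_nonneg[OF mult_nonneg_nonneg[OF X0 w(2)] powr_ge_zero]])
  moreover have "C / (\<epsilon> / 2) powr \<alpha> * w * \<epsilon> powr ((real ?n + 1) / 2) = C * 2 powr \<alpha> * w * \<epsilon> powr (\<beta> * real ?n)"
  proof -
    have "(\<epsilon> / 2) powr \<alpha> = \<epsilon> powr \<alpha> / 2 powr \<alpha>" by (rule powr_divide)
    moreover have "C / (x / y) * w * z = C * y * w * (z / x)" for x y z :: real by simp
    ultimately show ?thesis by (simp only: \<beta>n powr_diff)
  qed
  moreover have "\<eta> ^ ?n = S ^ ?n * t ^ ?n * \<epsilon> powr (\<beta> * real ?n)"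
  proof -
    have "(\<epsilon> powr \<beta>) ^ ?n = (\<epsilon> powr \<beta>) powr real ?n"
      by (rule powr_realpow[symmetric]) (use \<epsilon> in simp)
    hence "(\<epsilon> powr \<beta>) ^ ?n = \<epsilon> powr (\<beta> * real ?n)" by (simp only: powr_powr)
    thus ?thesis by (simp add: \<eta>S power_mult_distrib)
  qed
  ultimately have "(\<kappa> * S ^ ?n * t ^ ?n) * \<epsilon> powr (\<beta> * real ?n) \<le> (C * 2 powr \<alpha> * w) * \<epsilon> powr (\<beta> * real ?n)"
    by (simp add: mult_ac)
  hence "\<kappa> * S ^ ?n * t ^ ?n \<le> C * 2 powr \<alpha> * w" using \<epsilon> by simp
  hence "t ^ ?n * (\<kappa> * S ^ ?n) \<le> C * 2 powr \<alpha> * w" by (simp only: mult_ac)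
  moreover have "\<kappa> * S ^ ?n > 0" using \<kappa> S by (intro mult_pos_pos zero_less_power)
  ultimately have "t ^ ?n \<le> (C * 2 powr \<alpha> * w) / (\<kappa> * S ^ ?n)" by (simp only: pos_le_divide_eq)
  hence tn: "t ^ ?n \<le> C * 2 powr \<alpha> / (\<kappa> * S ^ ?n) * w" by (simp only: times_divide_eq_left)
  have "t = root ?n (t ^ ?n)" using t by (simp add: real_root_power_cancel)
  also have "\<dots> \<le> root ?n (C * 2 powr \<alpha> / (\<kappa> * S ^ ?n) * w)" using tn by (intro real_root_le_mono) auto
  also have "\<dots> = root ?n (C * 2 powr \<alpha> / (\<kappa> * S ^ ?n)) * root ?n w" by (rule real_root_mult)
  finally have tle: "t \<le> root ?n (C * 2 powr \<alpha> / (\<kappa> * S ^ ?n)) * root ?n w" .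
  have "u x0 \<le> s + t * (A + A)" using ule[of x0] x0 by (simp add: A_def)
  also have "t * (A + A) = 2 * A * t" by simp
  also have "s + 2 * A * t \<le> s + 2 * A * (root ?n (C * 2 powr \<alpha> / (\<kappa> * S ^ ?n)) * root ?n w)"
    using A by (intro add_left_mono mult_left_mono tle) simp
  finally show ?thesis by (simp add: A_def C_def \<kappa>_def S_def \<beta>_def mult_ac)
qed

text \<open>It remains to treat the trivial cases: an infinite integral, and \<open>u x0\<close> not above the supremum.\<close>

theorem theorem2p1:
  fixes \<alpha> K :: real
  assumes "CARD('n::finite) \<ge> 2"
    and "0 \<le> \<alpha>" and "\<alpha> < (real CARD('n) + 1) / 2"
    and "0 \<le> K"
  shows "\<exists>N::real. N > 0 \<and>
    (\<forall>(a :: real^'n \<Rightarrow> real^'n^'n) (b :: real^'n \<Rightarrow> real^'n) (c :: real^'n \<Rightarrow> real)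
      (u :: real^'n \<Rightarrow> real) (Du :: real^'n \<Rightarrow> real^'n) (D2u :: real^'n \<Rightarrow> real^'n^'n).
        a \<in> borel_measurable (lebesgue_on (ball 0 1)) \<and>
        (\<forall>x\<in>ball 0 1. transpose (a x) = a x \<and> nonneg_definite (a x) \<and> trace (a x) > 0) \<and>
        b \<in> borel_measurable (lebesgue_on (ball 0 1)) \<and>
        (\<forall>x\<in>ball 0 1. norm (b x) \<le> K * smallest_eigenvalue (a x)) \<and>
        c \<in> borel_measurable (lebesgue_on (ball 0 1)) \<and>
        (\<forall>x\<in>ball 0 1. 0 \<le> c x) \<and> bounded (c ` ball 0 1) \<and>
        has_W2_loc_derivs (real CARD('n)) (ball 0 1) u Du D2u \<and>
        continuous_on (cball 0 1) u
      \<longrightarrow> (\<forall>x0\<in>ball 0 1.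
            ereal (u x0) \<le> ereal (SUP x\<in>sphere 0 1. pos_part (u x)) +
              enn2ereal
                (ennreal (N * psi x0 powr ((real CARD('n) + 1 - 2 * \<alpha>) / (2 * real CARD('n)))) *
                 ennreal_root CARD('n)
                   (weighted_integral \<alpha> a (diff_op a b c u Du D2u)))))"
proof -
  let ?n = "CARD('n)"
  define Q where "Q = contact_const (K + 1) ?n * 2 powr \<alpha> /
      (measure lborel (cball (0::real^'n) 1) * abp_scale \<alpha> ?n (K + 1) ^ ?n)"
  define N where "N = 2 * root ?n Q"
  have "abp_exponent \<alpha> ?n > 0" using assms(3) by (simp add: abp_exponent_def)
  hence "2 powr (- abp_exponent \<alpha> ?n) < 2 powr 0" by (intro powr_less_mono) auto
  hence "abp_scale \<alpha> ?n (K + 1) > 0" by (simp add: abp_scale_def)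
  moreover have "contact_const (K + 1) ?n > 0" using assms(4) by (intro contact_const_pos) simp
  ultimately have "Q > 0" using measure_unit_ball_pos[where ?'n = 'n]
    by (simp add: Q_def)
  hence N: "N > 0" by (simp add: N_def)
  show ?thesis
  proof (intro exI[of _ N] conjI N allI impI ballI)
    fix a :: "real^'n \<Rightarrow> real^'n^'n" and b :: "real^'n \<Rightarrow> real^'n" and c u :: "real^'n \<Rightarrow> real"
      and Du :: "real^'n \<Rightarrow> real^'n" and D2u :: "real^'n \<Rightarrow> real^'n^'n" and x0 :: "real^'n"
    assume H: "a \<in> borel_measurable (lebesgue_on (ball 0 1)) \<and>
        (\<forall>x\<in>ball 0 1. transpose (a x) = a x \<and> nonneg_definite (a x) \<and> trace (a x) > 0) \<and>
        b \<in> borel_measurable (lebesgue_on (ball 0 1)) \<and>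
        (\<forall>x\<in>ball 0 1. norm (b x) \<le> K * smallest_eigenvalue (a x)) \<and>
        c \<in> borel_measurable (lebesgue_on (ball 0 1)) \<and>
        (\<forall>x\<in>ball 0 1. 0 \<le> c x) \<and> bounded (c ` ball 0 1) \<and>
        has_W2_loc_derivs (real CARD('n)) (ball 0 1) u Du D2u \<and>
        continuous_on (cball 0 1) u" and x0: "x0 \<in> ball 0 1"
    note a = H[THEN conjunct1] and H1 = H[THEN conjunct2]
    note ax = H1[THEN conjunct1] and H2 = H1[THEN conjunct2]
    note b = H2[THEN conjunct1] and H3 = H2[THEN conjunct2]
    note bx = H3[THEN conjunct1] and H4 = H3[THEN conjunct2]
    note c = H4[THEN conjunct1] and H5 = H4[THEN conjunct2]
    note cx = H5[THEN conjunct1] and H6 = H5[THEN conjunct2, THEN conjunct2]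
    note W = H6[THEN conjunct1] and u = H6[THEN conjunct2]
    define s where "s = (SUP x\<in>sphere 0 1. pos_part (u x))"
    define I where "I = weighted_integral \<alpha> a (diff_op a b c u Du D2u)"
    define B where "B = psi x0 powr ((real ?n + 1 - 2 * \<alpha>) / (2 * real ?n))"
    have "psi x0 > 0" using x0 by (simp add: psi_def abs_square_less_1)
    hence B: "B > 0" by (simp add: B_def)
    have cp: "continuous_on (sphere 0 1) (\<lambda>x. pos_part (u x))"
    proof -
      have "continuous_on (sphere 0 1) u" by (rule continuous_on_subset[OF u]) auto
      thus ?thesis unfolding pos_part_def by (intro continuous_intros) simp_all
    qed
    have bdd: "bdd_above ((\<lambda>x. pos_part (u x)) ` sphere 0 1)"
      by (intro bounded_imp_bdd_above compact_imp_bounded compact_continuous_image cp) simp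
    have s_upper: "pos_part (u x) \<le> s" if "x \<in> sphere 0 1" for x
      unfolding s_def by (rule cSUP_upper[OF that bdd])
    have us: "u x \<le> s" if "x \<in> sphere 0 1" for x using s_upper[OF that] by (simp add: pos_part_def)
    have s0: "0 \<le> s" using s_upper[of "axis undefined 1"] by (simp add: pos_part_def)
    have "ereal (u x0) \<le> ereal s + enn2ereal (ennreal (N * B) * ennreal_root ?n I)"
    proof (cases "u x0 \<le> s")
      case True
      thus ?thesis by (intro add_increasing2) auto
    next
      case False
      hence gt: "s < u x0" by linarith
      show ?thesis
      proof (cases "I = \<infinity>")
        case True
        have "ennreal (N * B) * ennreal_root ?n I = \<infinity>"
          using N B by (simp add: True ennreal_root_def ennreal_mult_top)
        thus ?thesis by simp
      next
        case fin: False
        define w where "w = enn2real I"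
        have w: "I = ennreal w" "w \<ge> 0" using fin by (auto simp: w_def less_top)
        have "u x0 \<le> s + 2 * root ?n Q * psi x0 powr abp_exponent \<alpha> ?n * root ?n w"
          unfolding Q_def
          by (rule interior_estimate[OF a bspec[OF ax] assms(4) b bspec[OF bx] c bspec[OF cx] W u assms(2,3) x0 s0 us gt w[unfolded I_def]])
        hence le: "u x0 \<le> s + N * B * root ?n w" by (simp add: N_def B_def abp_exponent_def)
        have "ennreal (N * B) * ennreal_root ?n I = ennreal (N * B * root ?n w)"
          using N B w by (simp add: ennreal_root_def ennreal_mult)
        hence "enn2ereal (ennreal (N * B) * ennreal_root ?n I) = ereal (N * B * root ?n w)"
          using N B w(2) by (simp add: enn2ereal_ennreal)
        thus ?thesis using le by simp
      qed
    qed
    thus "ereal (u x0) \<le> ereal (SUP x\<in>sphere 0 1. pos_part (u x)) +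
              enn2ereal
                (ennreal (N * psi x0 powr ((real CARD('n) + 1 - 2 * \<alpha>) / (2 * real CARD('n)))) *
                 ennreal_root CARD('n)
                   (weighted_integral \<alpha> a (diff_op a b c u Du D2u)))"
      by (simp add: s_def B_def I_def)
  qed
qed

end
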